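(* Let $S$ be a topologically recurrent one-dimensional random walk with state space $\mathcal Z\subset\mathbb R$. Then the measures $$\pi_+(dx)=\mathbb P(X_1>x)\,\lambda(dx)\ \text{ on }\mathcal Z\cap[0,\infty),\qquad \pi_-(dx)=\mathbb P(X_1\le x)\,\lambda(dx)\ \text{ on }\mathcal Z\cap(-\infty,0),$$ and $$\pi(dx)=\bigl[\mathbf 1_{[0,\infty)}(x)\,\mathbb P(X_1>x)+\mathbf 1_{(-\infty,0)}(x)\,\mathbb P(X_1\le x)\bigr]\lambda(dx)\ \text{ on }\mathcal Z$$ are recurrent, ergodic, and uniquely invariant (i.e. invariant, and unique up to a constant factor among locally finite invariant Borel measures on the respective sets) for the chains of overshoots $O$, $O^\downarrow$, and $\mathcal O$, respectively.
   Context: Random walk. $S_n=S_0+X_1+\dots+X_n$, where $X_1,X_2,\dots$ are i.i.d. real random variables (non-degenerate) and $S_0$ is independent of them. $\mathcal Z$ is the minimal topologically closed subgroup of $(\mathbb R,+)$ containing the topological support of the distribution of $X_1$; $S_0\in\mathcal Z$. $\lambda$ is the normalized Haar measure on $\mathcal Z$: Lebesgue measure if $\mathcal Z=\mathbb R$, and $h$ times the counting measure if $\mathcal Z=h\mathbb Z$, $h>0$. $\mathbb P_x$ is the law of the walk with $S_0=x$. $S$ is topologically recurrent if $\mathbb P_0(S_n\in G\text{ infinitely often})=1$ for every open neighbourhood $G$ of $0$. Overshoots. $\mathcal T_0:=0$, $\mathcal T_n:=\inf\{k>\mathcal T_{n-1}:S_{k-1}<0,S_k\ge0\ \text{or}\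 S_{k-1}\ge0,S_k<0\}$, $\mathcal O_n:=S_{\mathcal T_n}$ for $n\ge1$. $\mathcal O=(\mathcal O_n)_{n\ge1}$ is a Markov chain on $\mathcal Z$ with kernel $x\mapsto\mathbb P_x(\mathcal O_1\in\cdot)$. $O_n:=\mathcal O_{2n-\mathbf 1(S_0<0)}$ (overshoots at up-crossings of zero), a Markov chain on $\mathcal Z\cap[0,\infty)$ with kernel $x\mapsto\mathbb P_x(O_1\in\cdot)$; $O_n^\downarrow:=\mathcal O_{2n-\mathbf 1(S_0\ge0)}$ (overshoots at down-crossings), a Markov chain on $\mathcal Z\cap(-\infty,0)$ with kernel $x\mapsto\mathbb P_x(O_1^\downarrow\in\cdot)$. For a Markov chain on $E$ with kernel $K$: a measure $\nu$ on $E$ is invariant if $\int_E K(x,B)\,\nu(dx)=\nu(B)$ for all Borel $B\subset E$; it is recurrent if for every Borel $B\subset E$ with $\nu(B)<\infty$ the chain started at $x$ returns to $B$ at some positive time with probability one for $\nu$-a.e. $x\in B$; it is ergodic if the one-sided shift on sequence space, which preserves the law of the chain started under $\nu$, is ergodic (every set invariant modulo this law is null or co-null). A Borel measure is locally finite if every point of the space has an open neighbourhood of finite measure (subspace topologies are used). *)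

theory Defs
  imports "HOL-Probability.Probability"
begin

section \<open>The random walk and its state space\<close>

text \<open>The steps are \<open>X 1, X 2, ...\<close>; \<open>X 0\<close> is never used. The law of the walk with \<open>S_0 = x\<close> is the
  law under \<open>M\<close> of the path \<open>walk X x\<close>.\<close>

definition walk :: "(nat \<Rightarrow> 'a \<Rightarrow> real) \<Rightarrow> real \<Rightarrow> 'a \<Rightarrow> nat \<Rightarrow> real" where
  "walk X x \<omega> n = x + (\<Sum>i=1..n. X i \<omega>)"

definition random_walk_steps :: "'a measure \<Rightarrow> (nat \<Rightarrow> 'a \<Rightarrow> real) \<Rightarrow> bool" where
  "random_walk_steps M X \<longleftrightarrow>
     prob_space M \<and>
     prob_space.indep_vars M (\<lambda>_. borel) X {1..} \<and>
     (\<forall>n\<ge>1. distr M borel (X n) = distr M borel (X 1)) \<and>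
     \<not> (\<exists>c. AE \<omega> in M. X 1 \<omega> = c)"

definition topologically_recurrent :: "'a measure \<Rightarrow> (nat \<Rightarrow> 'a \<Rightarrow> real) \<Rightarrow> bool" where
  "topologically_recurrent M X \<longleftrightarrow>
     (\<forall>G. open G \<and> 0 \<in> G \<longrightarrow> \<P>(\<omega> in M. \<exists>\<^sub>\<infinity>n. walk X 0 \<omega> n \<in> G) = 1)"

definition top_support :: "real measure \<Rightarrow> real set" where
  "top_support \<mu> = {x. \<forall>U. open U \<and> x \<in> U \<longrightarrow> emeasure \<mu> U > 0}"

definition additive_subgroup :: "real set \<Rightarrow> bool" where
  "additive_subgroup H \<longleftrightarrow> 0 \<in> H \<and> (\<forall>x\<in>H. \<forall>y\<in>H. x + y \<in> H) \<and> (\<forall>x\<in>H. - x \<in> H)"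

definition state_space :: "'a measure \<Rightarrow> (nat \<Rightarrow> 'a \<Rightarrow> real) \<Rightarrow> real set" where
  "state_space M X =
     \<Inter> {H. closed H \<and> additive_subgroup H \<and> top_support (distr M borel (X 1)) \<subseteq> H}"

text \<open>The normalized Haar measure of a closed subgroup \<open>Z \<noteq> {0}\<close> of the reals, as a Borel measure on
  the whole line that is concentrated on \<open>Z\<close>.\<close>

definition haar :: "real set \<Rightarrow> real measure" where
  "haar Z =
     (if Z = UNIV then lborel
      else let h = (THE h. h > 0 \<and> Z = range (\<lambda>k::int. h * of_int k))
           in distr (scale_measure (ennreal h) (count_space Z)) borel (\<lambda>z. z))"


section \<open>Overshoots\<close>

text \<open>Level-crossing times and overshoots of a path \<open>s\<close>. The infimum of the empty set is \<open>\<infinity>\<close>; an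
  overshoot at an infinite crossing time is set to 0, which for a recurrent walk happens only with
  probability zero.\<close>

primrec crossing_time :: "(nat \<Rightarrow> real) \<Rightarrow> nat \<Rightarrow> enat" where
  "crossing_time s 0 = 0"
| "crossing_time s (Suc n) =
     Inf {enat k | k. enat k > crossing_time s n \<and>
       (s (k - 1) < 0 \<and> s k \<ge> 0 \<or> s (k - 1) \<ge> 0 \<and> s k < 0)}"

definition overshoot :: "(nat \<Rightarrow> real) \<Rightarrow> nat \<Rightarrow> real" where
  "overshoot s n = (case crossing_time s n of enat k \<Rightarrow> s k | \<infinity> \<Rightarrow> 0)"

definition up_overshoot :: "(nat \<Rightarrow> real) \<Rightarrow> nat \<Rightarrow> real" where
  "up_overshoot s n = overshoot s (2 * n - (if s 0 < 0 then 1 else 0))"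

definition down_overshoot :: "(nat \<Rightarrow> real) \<Rightarrow> nat \<Rightarrow> real" where
  "down_overshoot s n = overshoot s (2 * n - (if s 0 \<ge> 0 then 1 else 0))"

abbreviation borel_on :: "real set \<Rightarrow> real measure" where
  "borel_on E \<equiv> restrict_space borel E"

text \<open>Transition kernels, as measures on \<open>borel_on E\<close> for the respective state spaces \<open>E\<close>; only
  starting points \<open>x \<in> E\<close> are relevant.\<close>

definition overshoot_kernel :: "'a measure \<Rightarrow> (nat \<Rightarrow> 'a \<Rightarrow> real) \<Rightarrow> real \<Rightarrow> real measure" where
  "overshoot_kernel M X x =
     restrict_space (distr M borel (\<lambda>\<omega>. overshoot (walk X x \<omega>) 1)) (state_space M X)"

definition up_overshoot_kernel :: "'a measure \<Rightarrow> (nat \<Rightarrow> 'a \<Rightarrow> real) \<Rightarrow> real \<Rightarrow> real measure" where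
  "up_overshoot_kernel M X x =
     restrict_space (distr M borel (\<lambda>\<omega>. up_overshoot (walk X x \<omega>) 1)) (state_space M X \<inter> {0..})"

definition down_overshoot_kernel :: "'a measure \<Rightarrow> (nat \<Rightarrow> 'a \<Rightarrow> real) \<Rightarrow> real \<Rightarrow> real measure" where
  "down_overshoot_kernel M X x =
     restrict_space (distr M borel (\<lambda>\<omega>. down_overshoot (walk X x \<omega>) 1)) (state_space M X \<inter> {..<0})"


section \<open>The candidate invariant measures\<close>

definition pi_plus :: "'a measure \<Rightarrow> (nat \<Rightarrow> 'a \<Rightarrow> real) \<Rightarrow> real measure" where
  "pi_plus M X =
     density (restrict_space (haar (state_space M X)) (state_space M X \<inter> {0..}))
       (\<lambda>x. ennreal (\<P>(\<omega> in M. X 1 \<omega> > x)))"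

definition pi_minus :: "'a measure \<Rightarrow> (nat \<Rightarrow> 'a \<Rightarrow> real) \<Rightarrow> real measure" where
  "pi_minus M X =
     density (restrict_space (haar (state_space M X)) (state_space M X \<inter> {..<0}))
       (\<lambda>x. ennreal (\<P>(\<omega> in M. X 1 \<omega> \<le> x)))"

definition pi_both :: "'a measure \<Rightarrow> (nat \<Rightarrow> 'a \<Rightarrow> real) \<Rightarrow> real measure" where
  "pi_both M X =
     density (restrict_space (haar (state_space M X)) (state_space M X))
       (\<lambda>x. ennreal (indicator {0..} x * \<P>(\<omega> in M. X 1 \<omega> > x)
                   + indicator {..<0} x * \<P>(\<omega> in M. X 1 \<omega> \<le> x)))"


section \<open>Markov chains on a Borel set of reals\<close>

text \<open>The law on sequence space of the chain on \<open>E\<close> with kernel \<open>K\<close> started at \<open>x \<in> E\<close>. It is the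
  Ionescu-Tulcea measure whose coordinate 0 is \<open>x\<close> and whose coordinate \<open>n + 1\<close> is drawn from \<open>K\<close>
  at coordinate \<open>n\<close>.\<close>

definition chain_step ::
    "real set \<Rightarrow> (real \<Rightarrow> real measure) \<Rightarrow> real \<Rightarrow> nat \<Rightarrow> (nat \<Rightarrow> real) \<Rightarrow> real measure" where
  "chain_step E K x n \<omega> = (case n of 0 \<Rightarrow> return (borel_on E) x | Suc m \<Rightarrow> K (\<omega> m))"

definition chain_law ::
    "real set \<Rightarrow> (real \<Rightarrow> real measure) \<Rightarrow> real \<Rightarrow> (nat \<Rightarrow> real) measure" where
  "chain_law E K x =
     projective_family.lim UNIV
       (Ionescu_Tulcea.CI (chain_step E K x) (\<lambda>_. borel_on E)) (\<lambda>_. borel_on E)"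

lemma Ionescu_Tulcea_chain_step:
  assumes K: "K \<in> borel_on E \<rightarrow>\<^sub>M prob_algebra (borel_on E)" and x: "x \<in> E"
  shows "Ionescu_Tulcea (chain_step E K x) (\<lambda>_. borel_on E)"
proof (rule Ionescu_Tulcea.intro)
  have K': "K \<in> borel_on E \<rightarrow>\<^sub>M subprob_algebra (borel_on E)"
    using K by (rule measurable_prob_algebraD)
  have x': "x \<in> space (borel_on E)"
    using x by (simp add: space_restrict_space)
  show "chain_step E K x n \<in> PiM {0..<n} (\<lambda>_. borel_on E) \<rightarrow>\<^sub>M subprob_algebra (borel_on E)" for n
  proof (cases n)
    case 0
    have "return (borel_on E) x \<in> space (subprob_algebra (borel_on E))"
      using measurable_space[OF return_measurable x'] .
    moreover have "chain_step E K x n = (\<lambda>_. return (borel_on E) x)"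
      by (simp add: fun_eq_iff chain_step_def 0)
    ultimately show ?thesis
      by simp
  next
    case (Suc m)
    have "(\<lambda>\<omega>. \<omega> m) \<in> PiM {0..<n} (\<lambda>_. borel_on E) \<rightarrow>\<^sub>M borel_on E"
      by (rule measurable_component_singleton) (simp add: Suc)
    moreover have "chain_step E K x n = (\<lambda>\<omega>. K (\<omega> m))"
      by (simp add: fun_eq_iff chain_step_def Suc)
    ultimately show ?thesis
      using measurable_compose[OF _ K'] by simp
  qed
  show "prob_space (chain_step E K x n \<omega>)" if "\<omega> \<in> space (PiM {0..<n} (\<lambda>_. borel_on E))" for n \<omega>
  proof (cases n)
    case 0
    then show ?thesis
      using prob_space_return[OF x'] by (simp add: chain_step_def)
  next
    case (Suc m)
    then have "\<omega> m \<in> space (borel_on E)"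
      using that by (auto simp: space_PiM PiE_iff)
    from measurable_space[OF K this] show ?thesis
      by (simp add: chain_step_def Suc space_prob_algebra)
  qed
qed

text \<open>The law of the chain started under \<open>\<nu>\<close>; it is an infinite measure if \<open>\<nu>\<close> is.\<close>

definition chain_law_from ::
    "real set \<Rightarrow> (real \<Rightarrow> real measure) \<Rightarrow> real measure \<Rightarrow> (nat \<Rightarrow> real) measure" where
  "chain_law_from E K \<nu> = bind \<nu> (chain_law E K)"

definition invariant_measure ::
    "real set \<Rightarrow> (real \<Rightarrow> real measure) \<Rightarrow> real measure \<Rightarrow> bool" where
  "invariant_measure E K \<nu> \<longleftrightarrow>
     sets \<nu> = sets (borel_on E) \<and>
     (\<forall>B\<in>sets (borel_on E). (\<integral>\<^sup>+x. emeasure (K x) B \<partial>\<nu>) = emeasure \<nu> B)"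

definition recurrent_measure ::
    "real set \<Rightarrow> (real \<Rightarrow> real measure) \<Rightarrow> real measure \<Rightarrow> bool" where
  "recurrent_measure E K \<nu> \<longleftrightarrow>
     (\<forall>B\<in>sets (borel_on E). emeasure \<nu> B < \<infinity> \<longrightarrow>
        (AE x in \<nu>. x \<in> B \<longrightarrow> (AE \<omega> in chain_law E K x. \<exists>n\<ge>1. \<omega> n \<in> B)))"

definition ergodic_measure ::
    "real set \<Rightarrow> (real \<Rightarrow> real measure) \<Rightarrow> real measure \<Rightarrow> bool" where
  "ergodic_measure E K \<nu> \<longleftrightarrow>
     (let Q = chain_law_from E K \<nu>; shift = (\<lambda>\<omega> n. \<omega> (Suc n)) in
        shift \<in> Q \<rightarrow>\<^sub>M Q \<and> distr Q Q shift = Q \<and>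
        (\<forall>A\<in>sets Q.
           emeasure Q ((A - shift -` A \<inter> space Q) \<union> (shift -` A \<inter> space Q - A)) = 0 \<longrightarrow>
           emeasure Q A = 0 \<or> emeasure Q (space Q - A) = 0))"

text \<open>Neighbourhoods are taken in the subspace topology of \<open>E\<close>, so for \<open>E = Z \<inter> {..<0}\<close> the mass near
  \<open>0\<close> may be infinite.\<close>

definition locally_finite_on :: "real set \<Rightarrow> real measure \<Rightarrow> bool" where
  "locally_finite_on E \<nu> \<longleftrightarrow> (\<forall>x\<in>E. \<exists>U. open U \<and> x \<in> U \<and> emeasure \<nu> (U \<inter> E) < \<infinity>)"

definition uniquely_invariant_measure ::
    "real set \<Rightarrow> (real \<Rightarrow> real measure) \<Rightarrow> real measure \<Rightarrow> bool" where
  "uniquely_invariant_measure E K \<nu> \<longleftrightarrow>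
     invariant_measure E K \<nu> \<and> locally_finite_on E \<nu> \<and>
     (\<forall>\<nu>'. invariant_measure E K \<nu>' \<and> locally_finite_on E \<nu>' \<longrightarrow>
        (\<exists>c::real. c \<ge> 0 \<and> \<nu>' = scale_measure (ennreal c) \<nu>))"

end

theory Submission
  imports Defs
begin

text \<open>The topologically recurrent walk satisfies a minimum principle: a nonnegative superharmonic function
  that is at least \<open>m\<close> on an open set meeting \<open>Z\<close> is at least \<open>m\<close> on \<open>Z\<close>. Applied to the lower semicontinuous
  functions \<open>x \<mapsto> \<mu> (U - x)\<close> it shows that a locally finite invariant measure \<open>\<mu>\<close> of the walk is translation
  invariant, hence a multiple of the Haar measure \<open>\<lambda>\<close>. The candidate measures are the flows of \<open>\<lambda>\<close> into the two
  half-lines, and time reversal shows that they are exchanged by the two overshoot kernels. Conversely, an invariant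
  measure of an overshoot chain is the flow of its occupation measure over one cycle, which is invariant
  for the walk, hence a multiple of \<open>\<lambda>\<close>. Likewise a bounded harmonic function of an overshoot chain extends
  to a function \<open>H\<close> for which \<open>H \<lambda>\<close> is invariant under the reversed walk, hence \<open>H\<close> is constant; this gives ergodicity.
  Recurrence follows from Maharam's theorem, because a set of finite measure is visited infinitely often.\<close>

section \<open>Markov chains on a Borel set\<close>

text \<open>Topological recurrence yields the minimum principle because every open set that meets
  \<open>Z\<close> is hit almost surely from every point of \<open>Z\<close>; a superharmonic
  function stopped at the hitting time gives the bound. Recurrence survives negation of the steps,
  so the principle holds for the reversed walk too. Both directions are used: the forward one for
  uniqueness, the reversed one for the invariance of the flows and for ergodicity. The density
  \<open>P(X_1 > x)\<close> at \<open>x >= 0\<close> is the probability that a reversed step leads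
  from \<open>x\<close> below zero, which is what makes the candidates flows. The obstacle is that
  every measure involved may be infinite. An occupation measure is not known to be locally finite,
  and an invariant measure on the negative half-line may a priori have infinite mass near 0.
  Finiteness is therefore drawn from a compact part of the half-line which the walk enters in one
  step, with probability bounded below, from an open piece of the other side; invariance and lower
  semicontinuity spread it over \<open>Z\<close>. The same compact set is the set of finite mass on
  which recurrence rests.\<close>

locale borel_chain =
  fixes E :: "real set" and K :: "real \<Rightarrow> real measure"
  assumes K: "K \<in> borel_on E \<rightarrow>\<^sub>M prob_algebra (borel_on E)"
begin

abbreviation "Seq \<equiv> PiM (UNIV :: nat set) (\<lambda>_. borel_on E)"

text \<open>Side conditions from index \<open>n\<close> on are ignored, so passing to
  \<open>\<lambda>i. F (Suc i)\<close> describes what remains of the cylinder after one step; length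
  0 gives the whole space.\<close>

definition cyl :: "nat \<Rightarrow> (nat \<Rightarrow> real set) \<Rightarrow> (nat \<Rightarrow> real) set" where
  "cyl n F = {\<omega> \<in> space Seq. \<forall>i<n. \<omega> i \<in> F i}"

lemma space_borel_on [simp]: "space (borel_on E) = E"
  by (simp add: space_restrict_space)

lemma space_Seq: "space Seq = {\<omega>. \<forall>i. \<omega> i \<in> E}"
  by (auto simp: space_PiM PiE_iff)

lemma prob_space_K: "x \<in> E \<Longrightarrow> prob_space (K x)"
  and sets_K [measurable_cong]: "x \<in> E \<Longrightarrow> sets (K x) = sets (borel_on E)"
  using measurable_space[OF K] by (auto simp: space_prob_algebra)

lemma space_K: "x \<in> E \<Longrightarrow> space (K x) = E"
  using sets_eq_imp_space_eq[OF sets_K] by simp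

lemma K_subprob [measurable]: "K \<in> borel_on E \<rightarrow>\<^sub>M subprob_algebra (borel_on E)"
  using K by (rule measurable_prob_algebraD)

lemma measurable_coord [measurable]: "(\<lambda>\<omega>. \<omega> n) \<in> Seq \<rightarrow>\<^sub>M borel_on E"
  by (rule measurable_component_singleton) simp

lemma cyl_sets [measurable]:
  assumes "\<And>i. F i \<in> sets (borel_on E)"
  shows "cyl n F \<in> sets Seq"
proof -
  have [measurable]: "F i \<in> sets (borel_on E)" for i by (rule assms)
  show ?thesis unfolding cyl_def by measurable
qed

definition cyls :: "(nat \<Rightarrow> real) set set" where
  "cyls = {cyl n F | n F. \<forall>i. F i \<in> sets (borel_on E)}"

lemma cyl_in_cyls: "(\<And>i. F i \<in> sets (borel_on E)) \<Longrightarrow> cyl n F \<in> cyls"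
  unfolding cyls_def by blast

lemma Int_stable_cyls: "Int_stable cyls"
proof (rule Int_stableI)
  fix a b assume "a \<in> cyls" "b \<in> cyls"
  then obtain n F m G where *: "a = cyl n F" "b = cyl m G"
    "\<And>i. F i \<in> sets (borel_on E)" "\<And>i. G i \<in> sets (borel_on E)"
    unfolding cyls_def by blast
  let ?H = "\<lambda>i. (if i < n then F i else E) \<inter> (if i < m then G i else E)"
  have top: "E \<in> sets (borel_on E)" using sets.top[of "borel_on E"] by simp
  have "a \<inter> b = cyl (max n m) ?H"
    unfolding * cyl_def by (auto simp: space_Seq less_max_iff_disj split: if_splits)
  moreover have "\<And>i. ?H i \<in> sets (borel_on E)"
    using * top by auto
  ultimately show "a \<inter> b \<in> cyls"
    unfolding cyls_def by blast
qed

lemma cyls_Pow: "cyls \<subseteq> Pow (space Seq)"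
  by (auto simp: cyls_def cyl_def)

lemma space_in_cyls: "space Seq \<in> cyls"
  unfolding cyls_def by (auto simp: cyl_def intro!: exI[of _ 0])

lemma sets_Seq: "sets Seq = sigma_sets (space Seq) cyls"
proof (rule antisym)
  have "{{f \<in> (\<Pi>\<^sub>E i\<in>(UNIV::nat set). space (borel_on E)). f i \<in> A} | i A. i \<in> UNIV \<and> A \<in> sets (borel_on E)} \<subseteq> cyls"
  proof safe
    fix i A assume A: "A \<in> sets (borel_on E)"
    have "E \<in> sets (borel_on E)" using sets.top[of "borel_on E"] by simp
    then have "cyl (Suc i) (\<lambda>j. if j = i then A else E) \<in> cyls"
      using A by (intro cyl_in_cyls) auto
    also have "cyl (Suc i) (\<lambda>j. if j = i then A else E) =
        {f \<in> (\<Pi>\<^sub>E i\<in>(UNIV::nat set). space (borel_on E)). f i \<in> A}"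
      unfolding cyl_def space_Seq by (auto simp: PiE_iff)
    finally show "{f \<in> (\<Pi>\<^sub>E i\<in>(UNIV::nat set). space (borel_on E)). f i \<in> A} \<in> cyls" .
  qed
  then show "sets Seq \<subseteq> sigma_sets (space Seq) cyls"
    unfolding sets_PiM_single space_PiM by (rule sigma_sets_mono')
  show "sigma_sets (space Seq) cyls \<subseteq> sets Seq"
    by (rule sets.sigma_sets_subset) (auto simp: cyls_def)
qed

text \<open>The mass of a cylinder as an iterated integral along the chain, with a weight
  \<open>g\<close> on coordinate \<open>n\<close>. The recursion works from the front, as the Markov
  property does; the weight is there to let the last coordinate be absorbed.\<close>

primrec cyl_int :: "nat \<Rightarrow> (nat \<Rightarrow> real set) \<Rightarrow> (real \<Rightarrow> ennreal) \<Rightarrow> real \<Rightarrow> ennreal" where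
  "cyl_int 0 F g x = indicator (F 0) x * g x"
| "cyl_int (Suc n) F g x = indicator (F 0) x * (\<integral>\<^sup>+y. cyl_int n (\<lambda>i. F (Suc i)) g y \<partial>K x)"

lemma nn_integral_K_measurable [measurable]:
  "f \<in> borel_measurable (borel_on E) \<Longrightarrow> (\<lambda>x. \<integral>\<^sup>+y. f y \<partial>K x) \<in> borel_measurable (borel_on E)"
  by (rule measurable_compose[OF K_subprob nn_integral_measurable_subprob_algebra])

lemma cyl_int_measurable:
  "(\<And>i. F i \<in> sets (borel_on E)) \<Longrightarrow> g \<in> borel_measurable (borel_on E) \<Longrightarrow>
    cyl_int n F g \<in> borel_measurable (borel_on E)"
proof (induction n arbitrary: F)
  case 0
  note [measurable] = 0(1)[of 0] 0(2)
  show ?case unfolding cyl_int.simps by measurable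
next
  case (Suc n)
  note [measurable] = Suc.IH[of "\<lambda>i. F (Suc i)", OF Suc.prems(1) Suc.prems(2)] Suc.prems(1)[of 0]
  show ?case unfolding cyl_int.simps by measurable
qed

text \<open>Ionescu-Tulcea measures grow at the end, \<open>cyl_int\<close> unfolds at the front.
  Averaging over the newest coordinate and storing the result in the weight reconciles the
  two.\<close>

lemma cyl_int_last:
  "x \<in> E \<Longrightarrow> cyl_int (Suc n) F g x = cyl_int n F (\<lambda>y. \<integral>\<^sup>+z. indicator (F (Suc n)) z * g z \<partial>K y) x"
proof (induction n arbitrary: F x)
  case (Suc n)
  have "(\<integral>\<^sup>+y. cyl_int (Suc n) (\<lambda>i. F (Suc i)) g y \<partial>K x) =
      (\<integral>\<^sup>+y. cyl_int n (\<lambda>i. F (Suc i)) (\<lambda>y. \<integral>\<^sup>+z. indicator (F (Suc (Suc n))) z * g z \<partial>K y) y \<partial>K x)"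
    using Suc by (intro nn_integral_cong) (simp add: space_K del: cyl_int.simps)
  then show ?case by simp
qed simp

text \<open>Induction on \<open>n\<close> for all weights at once, since each step replaces
  \<open>g\<close> by an average under \<open>K\<close>. The empty history is
  \<open>\<lambda>_. undefined\<close>, the only point of the product over no coordinates.\<close>

lemma nn_integral_C:
  assumes x: "x \<in> E"
    and F: "\<And>i. F i \<in> sets (borel_on E)" and g: "g \<in> borel_measurable (borel_on E)"
  shows "(\<integral>\<^sup>+\<omega>. (\<Prod>i\<le>n. indicator (F i) (\<omega> i)) * g (\<omega> n)
      \<partial>Ionescu_Tulcea.C (chain_step E K x) (\<lambda>_. borel_on E) 0 (Suc n) (\<lambda>_. undefined)) = cyl_int n F g x"
proof -
  interpret IT: Ionescu_Tulcea "chain_step E K x" "\<lambda>_. borel_on E"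
    using Ionescu_Tulcea_chain_step[OF K x] .
  have meas: "(\<lambda>\<omega>. (\<Prod>i\<le>n. indicator (F i) (\<omega> i)) * g (\<omega> n)) \<in> borel_measurable (PiM {0..<Suc n} (\<lambda>_. borel_on E))"
    if [measurable]: "g \<in> borel_measurable (borel_on E)" for n and g :: "real \<Rightarrow> ennreal"
  proof -
    have [measurable]: "F i \<in> sets (borel_on E)" for i by (rule F)
    have [measurable]: "(\<lambda>\<omega>. \<omega> i) \<in> PiM {0..<Suc n} (\<lambda>_. borel_on E) \<rightarrow>\<^sub>M borel_on E" if "i \<le> n" for i
      by (rule measurable_component_singleton) (use that in auto)
    show ?thesis by measurable
  qed
  have undef: "(\<lambda>_. undefined) \<in> space (PiM {0..<0::nat} (\<lambda>_. borel_on E))"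
    by (simp add: space_PiM)
  show ?thesis
    using g
  proof (induction n arbitrary: g)
    case (0 g)
    note [measurable] = 0 F[of 0]
    have "(\<integral>\<^sup>+\<omega>. (\<Prod>i\<le>0. indicator (F i) (\<omega> i)) * g (\<omega> 0) \<partial>IT.C 0 (Suc 0) (\<lambda>_. undefined))
        = (\<integral>\<^sup>+\<omega>. (\<Prod>i\<le>0. indicator (F i) (\<omega> i)) * g (\<omega> 0) \<partial>IT.eP 0 (\<lambda>_. undefined))"
      using bind_return[OF IT.measurable_eP[of 0] undef] by simp
    also have "\<dots> = (\<integral>\<^sup>+y. indicator (F 0) y * g y \<partial>chain_step E K x 0 (\<lambda>_. undefined))"
      by (subst IT.nn_integral_eP[OF undef meas[OF 0]]) simp
    also have "\<dots> = indicator (F 0) x * g x"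
      unfolding chain_step_def using x by (simp add: nn_integral_return)
    finally show ?case by simp
  next
    case (Suc n g)
    let ?f = "\<lambda>n g \<omega>. (\<Prod>i\<le>n. indicator (F i) (\<omega> i)) * g (\<omega> n) :: ennreal"
    let ?g = "\<lambda>y. \<integral>\<^sup>+z. indicator (F (Suc n)) z * g z \<partial>K y"
    have [measurable]: "F i \<in> sets (borel_on E)" "g \<in> borel_measurable (borel_on E)" for i
      by (rule F, rule Suc)
    have g': "?g \<in> borel_measurable (borel_on E)" by measurable
    have "(\<integral>\<^sup>+\<omega>. ?f (Suc n) g \<omega> \<partial>IT.C 0 (Suc (Suc n)) (\<lambda>_. undefined)) =
        (\<integral>\<^sup>+\<omega>. \<integral>\<^sup>+\<omega>'. ?f (Suc n) g \<omega>' \<partial>IT.eP (Suc n) \<omega> \<partial>IT.C 0 (Suc n) (\<lambda>_. undefined))"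
      unfolding IT.C.simps(2)[of 0 "Suc n"] add_0
      by (rule nn_integral_bind[OF meas[OF Suc.prems]])
         (simp add: measurable_cong_sets[OF IT.sets_C[OF undef, of "Suc n", unfolded add_0] refl] del: IT.C.simps)
    also have "\<dots> = (\<integral>\<^sup>+\<omega>. ?f n ?g \<omega> \<partial>IT.C 0 (Suc n) (\<lambda>_. undefined))"
    proof (rule nn_integral_cong)
      fix \<omega> assume "\<omega> \<in> space (IT.C 0 (Suc n) (\<lambda>_. undefined))"
      then have \<omega>: "\<omega> \<in> space (PiM {0..<Suc n} (\<lambda>_. borel_on E))"
        using IT.space_C[OF undef, of "Suc n"] by simp
      then have \<omega>n: "\<omega> n \<in> E" by (auto simp: space_PiM PiE_iff)
      have "(\<integral>\<^sup>+\<omega>'. ?f (Suc n) g \<omega>' \<partial>IT.eP (Suc n) \<omega>) =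
          (\<integral>\<^sup>+y. ?f (Suc n) g (fun_upd \<omega> (Suc n) y) \<partial>K (\<omega> n))"
        by (subst IT.nn_integral_eP[OF \<omega> meas[OF Suc.prems]]) (simp add: chain_step_def)
      also have "\<dots> = (\<integral>\<^sup>+y. (\<Prod>i\<le>n. indicator (F i) (\<omega> i)) * (indicator (F (Suc n)) y * g y) \<partial>K (\<omega> n))"
        by (intro nn_integral_cong) (simp add: mult.assoc)
      also have "\<dots> = ?f n ?g \<omega>"
        using \<omega>n by (intro nn_integral_cmult) (simp add: measurable_cong_sets[OF sets_K refl])
      finally show "(\<integral>\<^sup>+\<omega>'. ?f (Suc n) g \<omega>' \<partial>IT.eP (Suc n) \<omega>) = ?f n ?g \<omega>" .
    qed
    also have "\<dots> = cyl_int n F ?g x"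
      by (rule Suc.IH[OF g'])
    also have "\<dots> = cyl_int (Suc n) F g x"
      by (rule cyl_int_last[OF x, symmetric])
    finally show ?case .
  qed
qed

lemma sets_chain_law: "x \<in> E \<Longrightarrow> sets (chain_law E K x) = sets Seq"
  and space_chain_law: "x \<in> E \<Longrightarrow> space (chain_law E K x) = space Seq"
proof -
  assume x: "x \<in> E"
  interpret IT: Ionescu_Tulcea "chain_step E K x" "\<lambda>_. borel_on E"
    using Ionescu_Tulcea_chain_step[OF K x] .
  show "sets (chain_law E K x) = sets Seq" "space (chain_law E K x) = space Seq"
    by (simp_all add: chain_law_def)
qed

text \<open>A cylinder of length \<open>Suc n\<close> constrains the coordinates 0 to
  \<open>n\<close>, hence the index \<open>n\<close> on the right.\<close>

lemma emeasure_chain_law_cyl: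
  assumes x: "x \<in> E" and F: "\<And>i. F i \<in> sets (borel_on E)"
  shows "emeasure (chain_law E K x) (cyl (Suc n) F) = cyl_int n F (\<lambda>_. 1) x"
proof -
  interpret IT: Ionescu_Tulcea "chain_step E K x" "\<lambda>_. borel_on E"
    using Ionescu_Tulcea_chain_step[OF K x] .
  have undef: "(\<lambda>_. undefined) \<in> space (PiM {0..<0::nat} (\<lambda>_. borel_on E))"
    by (simp add: space_PiM)
  let ?J = "{0..<Suc n}" and ?M = "\<lambda>_::nat. borel_on E"
  have X: "Pi\<^sub>E ?J F \<in> sets (PiM ?J ?M)"
    by (intro sets_PiM_I_finite) (auto simp: F)
  have [simp]: "IT.PF.emb ?J ?J (Pi\<^sub>E ?J F) = Pi\<^sub>E ?J F"
    using sets.sets_into_space[OF X] by (intro prod_emb_id) (auto simp: space_PiM)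
  have "cyl (Suc n) F = IT.PF.emb UNIV ?J (Pi\<^sub>E ?J F)"
    by (auto simp: cyl_def prod_emb_def space_PiM PiE_iff)
  then have "emeasure (chain_law E K x) (cyl (Suc n) F) = emeasure (IT.CI ?J) (Pi\<^sub>E ?J F)"
    unfolding chain_law_def using IT.lim[OF _ X] by simp
  also have "\<dots> = emeasure (IT.C 0 (Suc n) (\<lambda>_. undefined)) (Pi\<^sub>E ?J F)"
    using IT.emeasure_CI[OF subset_refl X] by simp
  also have "\<dots> = (\<integral>\<^sup>+\<omega>. indicator (Pi\<^sub>E ?J F) \<omega> \<partial>IT.C 0 (Suc n) (\<lambda>_. undefined))"
    using X IT.sets_C[OF undef, of "Suc n"] by (intro nn_integral_indicator[symmetric]) simp
  also have "\<dots> = (\<integral>\<^sup>+\<omega>. (\<Prod>i\<le>n. indicator (F i) (\<omega> i)) * 1 \<partial>IT.C 0 (Suc n) (\<lambda>_. undefined))"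
  proof (rule nn_integral_cong)
    fix \<omega> assume "\<omega> \<in> space (IT.C 0 (Suc n) (\<lambda>_. undefined))"
    then have "\<omega> \<in> space (PiM ?J ?M)"
      using IT.space_C[OF undef, of "Suc n"] by simp
    then have "\<omega> \<in> Pi\<^sub>E ?J F \<longleftrightarrow> (\<forall>i\<le>n. \<omega> i \<in> F i)"
      by (auto simp: space_PiM PiE_iff)
    moreover have "(\<Prod>i\<le>n. indicator (F i) (\<omega> i)) = (if \<forall>i\<le>n. \<omega> i \<in> F i then 1 else 0 :: ennreal)"
      by (auto simp: indicator_def)
    ultimately show "indicator (Pi\<^sub>E ?J F) \<omega> = (\<Prod>i\<le>n. indicator (F i) (\<omega> i)) * (1 :: ennreal)"
      by (auto simp: indicator_def)
  qed
  also have "\<dots> = cyl_int n F (\<lambda>_. 1) x"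
    by (rule nn_integral_C[OF x F]) auto
  finally show ?thesis .
qed

lemma prob_space_chain_law:
  assumes x: "x \<in> E" shows "prob_space (chain_law E K x)"
proof (rule prob_spaceI)
  have E: "E \<in> sets (borel_on E)" using sets.top[of "borel_on E"] by simp
  have "space (chain_law E K x) = cyl (Suc 0) (\<lambda>_. E)"
    using x by (auto simp: space_chain_law cyl_def space_Seq)
  then show "emeasure (chain_law E K x) (space (chain_law E K x)) = 1"
    using emeasure_chain_law_cyl[OF x E, of 0] x by simp
qed

lemma emeasure_chain_law_space: "x \<in> E \<Longrightarrow> emeasure (chain_law E K x) (space Seq) = 1"
  using prob_space.emeasure_space_1[OF prob_space_chain_law[of x]] by (simp add: space_chain_law)

text \<open>Cylinders form an intersection-stable generator, so measurability in the starting point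
  needs to be checked only on the iterated integrals.\<close>

lemma chain_law_measurable [measurable]: "chain_law E K \<in> borel_on E \<rightarrow>\<^sub>M prob_algebra Seq"
proof (rule measurable_prob_algebra_generated[OF sets_Seq Int_stable_cyls cyls_Pow])
  fix A assume "A \<in> cyls"
  then obtain n F where A: "A = cyl n F" and F: "\<And>i. F i \<in> sets (borel_on E)"
    unfolding cyls_def by blast
  show "(\<lambda>x. emeasure (chain_law E K x) A) \<in> borel_measurable (borel_on E)"
  proof (cases n)
    case 0
    then have A': "A = space Seq" by (simp add: A cyl_def)
    have "(\<lambda>x. emeasure (chain_law E K x) A) \<in> borel_measurable (borel_on E) \<longleftrightarrow>
      (\<lambda>x. 1::ennreal) \<in> borel_measurable (borel_on E)"
      using prob_space.emeasure_space_1[OF prob_space_chain_law]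
      by (intro measurable_cong) (simp add: A' space_chain_law)
    then show ?thesis by simp
  next
    case (Suc m)
    have "(\<lambda>x. emeasure (chain_law E K x) A) \<in> borel_measurable (borel_on E) \<longleftrightarrow>
      cyl_int m F (\<lambda>_. 1) \<in> borel_measurable (borel_on E)"
      using emeasure_chain_law_cyl[OF _ F, of _ m] Suc
      by (intro measurable_cong) (simp add: A)
    then show ?thesis using cyl_int_measurable[OF F, of "\<lambda>_. 1" m] by simp
  qed
qed (auto simp: prob_space_chain_law sets_chain_law)

lemma chain_law_subprob [measurable]: "chain_law E K \<in> borel_on E \<rightarrow>\<^sub>M subprob_algebra Seq"
  by (rule measurable_prob_algebraD) measurable

lemma measurable_case_nat_Seq [measurable]:
  "x \<in> E \<Longrightarrow> (\<lambda>\<omega>. case_nat x \<omega>) \<in> Seq \<rightarrow>\<^sub>M Seq"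
  by (rule measurable_PiM_single') (auto simp: space_Seq split: nat.split)

lemma emeasure_distr_case_nat:
  assumes x: "x \<in> E" and y: "y \<in> E" and A: "A \<in> sets Seq"
  shows "emeasure (distr (chain_law E K y) Seq (case_nat x)) A =
    emeasure (chain_law E K y) (case_nat x -` A \<inter> space Seq)"
  using measurable_case_nat_Seq[OF x] A
  by (subst emeasure_distr) (auto simp: measurable_cong_sets[OF sets_chain_law[OF y] refl] space_chain_law[OF y])

text \<open>Both sides are finite measures, so agreement on cylinders suffices, and there it is the
  recursion of \<open>cyl_int\<close>.\<close>

lemma chain_law_Markov:
  assumes x: "x \<in> E"
  shows "chain_law E K x = K x \<bind> (\<lambda>y. distr (chain_law E K y) Seq (case_nat x))"
proof (rule measure_eqI_generator_eq[OF Int_stable_cyls cyls_Pow, where A="\<lambda>_::nat. space Seq"])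
  have Kx: "K x \<in> space (prob_algebra (borel_on E))"
    using prob_space_K[OF x] sets_K[OF x] by (simp add: space_prob_algebra)
  have m: "(\<lambda>y. distr (chain_law E K y) Seq (case_nat x)) \<in> borel_on E \<rightarrow>\<^sub>M prob_algebra Seq"
    using x by measurable
  have s: "sets (K x \<bind> (\<lambda>y. distr (chain_law E K y) Seq (case_nat x))) = sets Seq"
    using x by (intro sets_bind) (auto simp: space_K)
  then show "sets (K x \<bind> (\<lambda>y. distr (chain_law E K y) Seq (case_nat x))) = sigma_sets (space Seq) cyls"
    by (simp add: sets_Seq)
  show "sets (chain_law E K x) = sigma_sets (space Seq) cyls"
    using x by (simp add: sets_chain_law sets_Seq)
  show "range (\<lambda>_::nat. space Seq) \<subseteq> cyls" "(\<Union>i::nat. space Seq) = space Seq"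
    using space_in_cyls by auto
  show "emeasure (chain_law E K x) (space Seq) \<noteq> \<infinity>"
    using prob_space.emeasure_space_1[OF prob_space_chain_law[OF x]] x by (simp add: space_chain_law)
  fix A assume "A \<in> cyls"
  then obtain n F where A: "A = cyl n F" and F: "\<And>i. F i \<in> sets (borel_on E)"
    unfolding cyls_def by blast
  have [measurable]: "A \<in> sets Seq" using F unfolding A by measurable
  have *: "emeasure (K x \<bind> (\<lambda>y. distr (chain_law E K y) Seq (case_nat x))) A =
      (\<integral>\<^sup>+y. emeasure (chain_law E K y) (case_nat x -` A \<inter> space Seq) \<partial>K x)"
    using x by (subst emeasure_bind_prob_algebra[OF Kx m])
      (auto intro!: nn_integral_cong emeasure_distr_case_nat simp: space_K)
  \<comment> \<open>A cylinder of length 0 or 1 leaves nothing for the chain from \<open>y\<close>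
    to satisfy; the recursion of \<open>cyl_int\<close> applies from length 2 on.\<close>
  consider "n = 0" | "n = Suc 0" | m where "n = Suc (Suc m)"
    using not0_implies_Suc by metis
  then show "emeasure (chain_law E K x) A = emeasure (K x \<bind> (\<lambda>y. distr (chain_law E K y) Seq (case_nat x))) A"
  proof cases
    case 1
    then have A': "A = space Seq" by (simp add: A cyl_def)
    have "case_nat x -` A \<inter> space Seq = space Seq"
      using x by (auto simp: A' space_Seq split: nat.split)
    then show ?thesis
      unfolding * using prob_space.emeasure_space_1[OF prob_space_K[OF x]] x
      by (simp add: A' emeasure_chain_law_space space_K cong: nn_integral_cong_simp)
  next
    case 2
    have "case_nat x -` A \<inter> space Seq = (if x \<in> F 0 then space Seq else {})"
      using x by (auto simp: A cyl_def 2 space_Seq split: nat.split)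
    then have "(\<integral>\<^sup>+y. emeasure (chain_law E K y) (case_nat x -` A \<inter> space Seq) \<partial>K x) = (\<integral>\<^sup>+y. indicator (F 0) x \<partial>K x)"
      using x by (intro nn_integral_cong) (simp add: space_K emeasure_chain_law_space)
    also have "\<dots> = indicator (F 0) x"
      using prob_space.emeasure_space_1[OF prob_space_K[OF x]] by simp
    finally show ?thesis
      unfolding * using emeasure_chain_law_cyl[OF x F, of 0] by (simp add: A 2)
  next
    case (3 m)
    have "case_nat x -` A \<inter> space Seq = (if x \<in> F 0 then cyl (Suc m) (\<lambda>i. F (Suc i)) else {})"
      using x by (auto simp: A cyl_def 3 space_Seq All_less_Suc2 split: nat.splits)
    then have "(\<integral>\<^sup>+y. emeasure (chain_law E K y) (case_nat x -` A \<inter> space Seq) \<partial>K x)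
       = (\<integral>\<^sup>+y. indicator (F 0) x * cyl_int m (\<lambda>i. F (Suc i)) (\<lambda>_. 1) y \<partial>K x)"
      using x emeasure_chain_law_cyl[of _ "\<lambda>i. F (Suc i)" m] F
      by (intro nn_integral_cong) (simp add: space_K)
    also have "\<dots> = indicator (F 0) x * (\<integral>\<^sup>+y. cyl_int m (\<lambda>i. F (Suc i)) (\<lambda>_. 1) y \<partial>K x)"
      using cyl_int_measurable[of "\<lambda>i. F (Suc i)" "\<lambda>_. 1" m] F x
      by (intro nn_integral_cmult) (simp add: measurable_cong_sets[OF sets_K refl])
    finally show ?thesis
      unfolding * using emeasure_chain_law_cyl[OF x F, of "Suc m"] by (simp add: A 3)
  qed
qed

lemma emeasure_chain_law_case_nat:
  assumes x: "x \<in> E" and A [measurable]: "A \<in> sets Seq"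
  shows "emeasure (chain_law E K x) A =
    (\<integral>\<^sup>+y. emeasure (chain_law E K y) (case_nat x -` A \<inter> space Seq) \<partial>K x)"
proof -
  have Kx: "K x \<in> space (prob_algebra (borel_on E))"
    using prob_space_K[OF x] sets_K[OF x] by (simp add: space_prob_algebra)
  have m: "(\<lambda>y. distr (chain_law E K y) Seq (case_nat x)) \<in> borel_on E \<rightarrow>\<^sub>M prob_algebra Seq"
    using x by measurable
  show ?thesis
    using x by (subst chain_law_Markov[OF x], subst emeasure_bind_prob_algebra[OF Kx m])
      (auto intro!: nn_integral_cong emeasure_distr_case_nat simp: space_K)
qed


section \<open>Shifts of trajectories and visits to a set\<close>

abbreviation shift_seq :: "nat \<Rightarrow> (nat \<Rightarrow> real) \<Rightarrow> nat \<Rightarrow> real" where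
  "shift_seq k \<equiv> (\<lambda>\<omega> n. \<omega> (n + k))"

lemma measurable_shift_seq [measurable]: "shift_seq k \<in> Seq \<rightarrow>\<^sub>M Seq"
  by (rule measurable_PiM_single') (auto simp: space_Seq)

lemma AE_chain_law_0:
  assumes x: "x \<in> E" shows "AE \<omega> in chain_law E K x. \<omega> 0 = x"
proof -
  let ?A = "{\<omega> \<in> space Seq. \<omega> 0 \<noteq> x}"
  have [measurable]: "(\<lambda>\<omega>. \<omega> 0) \<in> borel_measurable Seq"
    using measurable_coord[of 0] by (simp add: measurable_restrict_space2_iff)
  have A: "?A \<in> sets Seq" by measurable
  have "case_nat x -` ?A \<inter> space Seq = {}" by auto
  then have "emeasure (chain_law E K x) ?A = 0"
    by (subst emeasure_chain_law_case_nat[OF x A]) simp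
  then show ?thesis
    using A x by (subst AE_iff_measurable[of ?A]) (auto simp: sets_chain_law space_chain_law)
qed

lemma emeasure_chain_law_shift:
  assumes x: "x \<in> E" and A: "A \<in> sets Seq"
  shows "emeasure (chain_law E K x) (shift_seq 1 -` A \<inter> space Seq) = (\<integral>\<^sup>+y. emeasure (chain_law E K y) A \<partial>K x)"
proof -
  have "case_nat x -` (shift_seq 1 -` A \<inter> space Seq) \<inter> space Seq = A"
    using x sets.sets_into_space[OF A] by (auto simp: space_Seq split: nat.splits)
  then show ?thesis
    by (subst emeasure_chain_law_case_nat[OF x measurable_sets[OF measurable_shift_seq A]]) simp
qed

text \<open>The property is required from every starting point, because \<open>K x\<close> is not
  tied to a reference measure whose null sets could be discarded.\<close>

lemma AE_chain_law_shift:
  assumes x: "x \<in> E" and P: "{\<omega> \<in> space Seq. P \<omega>} \<in> sets Seq"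
    and "\<And>y. y \<in> E \<Longrightarrow> AE \<omega> in chain_law E K y. P \<omega>"
  shows "AE \<omega> in chain_law E K x. P (shift_seq 1 \<omega>)"
proof -
  let ?A = "{\<omega> \<in> space Seq. \<not> P \<omega>}"
  have "?A = space Seq - {\<omega> \<in> space Seq. P \<omega>}" by auto
  then have A: "?A \<in> sets Seq" using P by auto
  have "emeasure (chain_law E K y) ?A = 0" if "y \<in> E" for y
    using assms(3)[OF that] A that
    by (subst (asm) AE_iff_measurable[of ?A]) (auto simp: sets_chain_law space_chain_law)
  then have "emeasure (chain_law E K x) (shift_seq 1 -` ?A \<inter> space Seq) = 0"
    using x by (subst emeasure_chain_law_shift[OF x A]) (simp add: space_K cong: nn_integral_cong_simp)
  moreover have "shift_seq 1 -` ?A \<inter> space Seq \<in> sets Seq"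
    by (rule measurable_sets[OF measurable_shift_seq A])
  moreover have "shift_seq 1 -` ?A \<inter> space Seq = {\<omega> \<in> space (chain_law E K x). \<not> P (shift_seq 1 \<omega>)}"
    using x by (auto simp: space_chain_law space_Seq)
  ultimately show ?thesis
    using x by (subst AE_iff_measurable[OF _ refl]) (auto simp: sets_chain_law)
qed

text \<open>The probability that \<open>C\<close> is never visited at positive times, as a function
  of the start, solves this equation; if only zero solves it, a visit is certain. The analytic form
  can be verified for kernels given by operators, without trajectories.\<close>

definition no_escape :: "real set \<Rightarrow> bool" where
  "no_escape C \<longleftrightarrow> (\<forall>w\<in>borel_measurable (borel_on E). (\<forall>x\<in>E. w x \<le> 1) \<longrightarrow>
     (\<forall>x\<in>E. w x = (\<integral>\<^sup>+y. indicator (- C) y * w y \<partial>K x)) \<longrightarrow> (\<forall>x\<in>E. w x = (0 :: ennreal)))"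

lemma no_escapeD:
  assumes "no_escape C" "w \<in> borel_measurable (borel_on E)" "\<And>x. x \<in> E \<Longrightarrow> w x \<le> 1"
    "\<And>x. x \<in> E \<Longrightarrow> w x = (\<integral>\<^sup>+y. indicator (- C) y * w y \<partial>K x)" "x \<in> E"
  shows "w x = 0"
  using assms unfolding no_escape_def by blast

lemma AE_hits_infinitely_often:
  assumes C [measurable]: "C \<in> sets (borel_on E)" and x: "x \<in> E"
    and no_escape: "no_escape C"
  shows "AE \<omega> in chain_law E K x. \<exists>\<^sub>\<infinity>n. \<omega> n \<in> C"
proof -
  let ?N = "{\<omega> \<in> space Seq. \<forall>n. \<omega> (Suc n) \<notin> C}"
  let ?w = "\<lambda>x. emeasure (chain_law E K x) ?N"
  have N: "?N \<in> sets Seq" by measurable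
  have w0: "?w x = 0" if "x \<in> E" for x
  proof (rule no_escapeD[OF no_escape _ _ _ that])
    show "?w \<in> borel_measurable (borel_on E)"
      using N by measurable
    show "?w x \<le> 1" if "x \<in> E" for x
      using prob_space.measure_le_1[OF prob_space_chain_law[OF that]] by auto
    show "?w x = (\<integral>\<^sup>+y. indicator (- C) y * ?w y \<partial>K x)" if x: "x \<in> E" for x
      unfolding emeasure_chain_law_case_nat[OF x N]
    proof (rule nn_integral_cong)
      fix y assume "y \<in> space (K x)"
      then have y: "y \<in> E" using x by (simp add: space_K)
      have *: "case_nat x -` ?N \<inter> space Seq = {\<omega> \<in> space Seq. \<forall>n. \<omega> n \<notin> C}"
        using x by (auto simp: space_Seq split: nat.splits)
      show "emeasure (chain_law E K y) (case_nat x -` ?N \<inter> space Seq) = indicator (- C) y * ?w y"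
      proof (cases "y \<in> C")
        case True
        have "emeasure (chain_law E K y) {\<omega> \<in> space Seq. \<forall>n. \<omega> n \<notin> C} = emeasure (chain_law E K y) {}"
          using AE_chain_law_0[OF y] True y
          by (intro emeasure_eq_AE) (auto simp: sets_chain_law)
        then show ?thesis using True * by simp
      next
        case False
        have "emeasure (chain_law E K y) {\<omega> \<in> space Seq. \<forall>n. \<omega> n \<notin> C} = ?w y"
        proof (rule emeasure_eq_AE)
          show "AE \<omega> in chain_law E K y. (\<omega> \<in> {\<omega> \<in> space Seq. \<forall>n. \<omega> n \<notin> C}) = (\<omega> \<in> ?N)"
            using AE_chain_law_0[OF y]
          proof eventually_elim
            case (elim \<omega>)
            have "(\<forall>n. \<omega> n \<notin> C) \<longleftrightarrow> (\<forall>n. \<omega> (Suc n) \<notin> C)"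
              using elim False by (metis not0_implies_Suc)
            then show ?case by simp
          qed
        qed (use y in \<open>simp_all add: sets_chain_law\<close>)
        then show ?thesis using False * by simp
      qed
    qed
  qed
  have hit: "AE \<omega> in chain_law E K x. \<exists>n. \<omega> (Suc n) \<in> C" if x: "x \<in> E" for x
    using w0[OF x] N x by (subst AE_iff_measurable[of ?N]) (auto simp: sets_chain_law space_chain_law)
  \<comment> \<open>A hit that is certain from every starting point can be repeated: a visit after
    time \<open>m\<close> of the shifted chain is a visit after time \<open>m + 1\<close>.\<close>
  have "AE \<omega> in chain_law E K x. \<exists>n\<ge>m. \<omega> n \<in> C" if "x \<in> E" for m x
    using that
  proof (induction m arbitrary: x)
    case 0
    show ?case using hit[OF 0] by eventually_elim auto
  next
    case (Suc m)
    have "AE \<omega> in chain_law E K x. \<exists>n\<ge>m. shift_seq 1 \<omega> n \<in> C"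
      by (rule AE_chain_law_shift[OF Suc.prems _ Suc.IH]) measurable
    then show ?case
      by eventually_elim (auto intro: Suc_le_mono[THEN iffD2])
  qed
  then have "AE \<omega> in chain_law E K x. \<forall>m. \<exists>n\<ge>m. \<omega> n \<in> C"
    using x by (simp add: AE_all_countable)
  then show ?thesis
    by eventually_elim (simp add: INFM_nat_le)
qed

end

text \<open>\<open>nonempty\<close> matters because \<open>bind\<close> over a measure on the empty
  space is degenerate; sigma-finiteness lets cylinders of finite mass exhaust the trajectory
  space.\<close>

locale invariant_chain = borel_chain +
  fixes \<nu> :: "real measure"
  assumes inv: "invariant_measure E K \<nu>"
    and sigma_finite: "sigma_finite_measure \<nu>"
    and nonempty: "E \<noteq> {}"
begin

lemma sets_nu: "sets \<nu> = sets (borel_on E)"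
  using inv by (simp add: invariant_measure_def)

lemma space_nu: "space \<nu> = E"
  using sets_eq_imp_space_eq[OF sets_nu] by simp

lemma measurable_nu_iff: "measurable \<nu> N = measurable (borel_on E) N"
  by (rule measurable_cong_sets[OF sets_nu refl])

lemma K_nu: "K \<in> \<nu> \<rightarrow>\<^sub>M subprob_algebra (borel_on E)"
  unfolding measurable_nu_iff by (rule K_subprob)

lemma chain_law_nu: "chain_law E K \<in> \<nu> \<rightarrow>\<^sub>M subprob_algebra Seq"
  unfolding measurable_nu_iff by (rule chain_law_subprob)

lemma bind_K: "\<nu> \<bind> K = \<nu>"
proof (rule measure_eqI)
  show s: "sets (\<nu> \<bind> K) = sets \<nu>"
    using nonempty by (subst sets_bind[of _ _ "borel_on E"]) (auto simp: space_nu sets_K sets_nu)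
  fix B assume "B \<in> sets (\<nu> \<bind> K)"
  then have B: "B \<in> sets (borel_on E)" using s sets_nu by simp
  have "emeasure (\<nu> \<bind> K) B = (\<integral>\<^sup>+x. emeasure (K x) B \<partial>\<nu>)"
    using nonempty B by (intro emeasure_bind[OF _ K_nu]) (auto simp: space_nu)
  then show "emeasure (\<nu> \<bind> K) B = emeasure \<nu> B"
    using inv B by (simp add: invariant_measure_def)
qed

lemma nn_integral_nu_K:
  assumes [measurable]: "f \<in> borel_measurable (borel_on E)"
  shows "(\<integral>\<^sup>+x. \<integral>\<^sup>+y. f y \<partial>K x \<partial>\<nu>) = (\<integral>\<^sup>+x. f x \<partial>\<nu>)"
proof -
  have "(\<integral>\<^sup>+x. f x \<partial>(\<nu> \<bind> K)) = (\<integral>\<^sup>+x. \<integral>\<^sup>+y. f y \<partial>K x \<partial>\<nu>)"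
    by (rule nn_integral_bind[OF assms K_nu])
  then show ?thesis by (simp add: bind_K)
qed

lemma AE_nu_K:
  assumes "AE y in \<nu>. P y"
  shows "AE x in \<nu>. AE y in K x. P y"
proof -
  obtain N where N: "{y \<in> space \<nu>. \<not> P y} \<subseteq> N" "emeasure \<nu> N = 0" "N \<in> sets \<nu>"
    using assms by (rule AE_E)
  then have [measurable]: "N \<in> sets (borel_on E)" by (simp add: sets_nu)
  have "(\<integral>\<^sup>+x. emeasure (K x) N \<partial>\<nu>) = 0"
    using inv N by (simp add: invariant_measure_def)
  moreover have "(\<lambda>x. emeasure (K x) N) \<in> borel_measurable \<nu>"
    unfolding measurable_nu_iff by measurable
  ultimately have "AE x in \<nu>. emeasure (K x) N = 0"
    using nn_integral_0_iff_AE by blast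
  then show ?thesis
    using AE_space
  proof eventually_elim
    case (elim x)
    show ?case
      using elim N by (intro AE_I[of _ _ N]) (auto simp: space_nu space_K sets_K sets_nu)
  qed
qed

definition Q :: "(nat \<Rightarrow> real) measure" where
  "Q = chain_law_from E K \<nu>"

lemma sets_Q [measurable_cong]: "sets Q = sets Seq"
  unfolding Q_def chain_law_from_def
  using nonempty by (intro sets_bind) (auto simp: space_nu sets_chain_law)

lemma space_Q: "space Q = space Seq"
  by (rule sets_eq_imp_space_eq[OF sets_Q])

lemma emeasure_Q:
  assumes "A \<in> sets Seq"
  shows "emeasure Q A = (\<integral>\<^sup>+x. emeasure (chain_law E K x) A \<partial>\<nu>)"
  unfolding Q_def chain_law_from_def
  using nonempty assms by (intro emeasure_bind[OF _ chain_law_nu]) (auto simp: space_nu)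

lemma AE_Q_iff:
  assumes P: "{\<omega> \<in> space Seq. P \<omega>} \<in> sets Seq"
  shows "(AE \<omega> in Q. P \<omega>) \<longleftrightarrow> (AE x in \<nu>. AE \<omega> in chain_law E K x. P \<omega>)"
  unfolding Q_def chain_law_from_def
  using P by (intro AE_bind[OF chain_law_nu]) (simp add: pred_def)

lemma emeasure_Q_0:
  assumes "B \<in> sets (borel_on E)"
  shows "emeasure Q {\<omega> \<in> space Seq. \<omega> 0 \<in> B} = emeasure \<nu> B"
proof -
  have [measurable]: "B \<in> sets (borel_on E)" by fact
  have A: "{\<omega> \<in> space Seq. \<omega> 0 \<in> B} \<in> sets Seq" by measurable
  have "emeasure (chain_law E K x) {\<omega> \<in> space Seq. \<omega> 0 \<in> B} = indicator B x" if x: "x \<in> E" for x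
  proof -
    have "emeasure (chain_law E K x) {\<omega> \<in> space Seq. \<omega> 0 \<in> B} =
        emeasure (chain_law E K x) (if x \<in> B then space Seq else {})"
      using AE_chain_law_0[OF x] A x AE_space[of "chain_law E K x"]
      by (intro emeasure_eq_AE) (auto simp: sets_chain_law space_chain_law)
    then show ?thesis
      using prob_space.emeasure_space_1[OF prob_space_chain_law[OF x]] x
      by (simp add: space_chain_law)
  qed
  then have "emeasure Q {\<omega> \<in> space Seq. \<omega> 0 \<in> B} = (\<integral>\<^sup>+x. indicator B x \<partial>\<nu>)"
    unfolding emeasure_Q[OF A] by (intro nn_integral_cong) (simp add: space_nu)
  also have "\<dots> = emeasure \<nu> B"
    using assms by (intro nn_integral_indicator) (simp add: sets_nu)
  finally show ?thesis .
qed

lemma emeasure_Q_shift: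
  "A \<in> sets Seq \<Longrightarrow> emeasure Q (shift_seq k -` A \<inter> space Seq) = emeasure Q A"
proof (induction k arbitrary: A)
  case 0
  then show ?case using sets.sets_into_space[OF 0] by (simp add: Int_absorb2)
next
  case (Suc k)
  have A': "shift_seq k -` A \<inter> space Seq \<in> sets Seq"
    by (rule measurable_sets[OF measurable_shift_seq Suc.prems])
  have "shift_seq (Suc k) -` A \<inter> space Seq = shift_seq 1 -` (shift_seq k -` A \<inter> space Seq) \<inter> space Seq"
    by (auto simp: space_Seq)
  then have "emeasure Q (shift_seq (Suc k) -` A \<inter> space Seq) =
      (\<integral>\<^sup>+x. emeasure (chain_law E K x) (shift_seq 1 -` (shift_seq k -` A \<inter> space Seq) \<inter> space Seq) \<partial>\<nu>)"
    by (simp only: emeasure_Q[OF measurable_sets[OF measurable_shift_seq A']])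
  also have "\<dots> = (\<integral>\<^sup>+x. \<integral>\<^sup>+y. emeasure (chain_law E K y) (shift_seq k -` A \<inter> space Seq) \<partial>K x \<partial>\<nu>)"
    by (intro nn_integral_cong emeasure_chain_law_shift[OF _ A']) (simp add: space_nu)
  also have "\<dots> = emeasure Q (shift_seq k -` A \<inter> space Seq)"
    using A' by (subst nn_integral_nu_K) (auto simp: emeasure_Q)
  also have "\<dots> = emeasure Q A"
    by (rule Suc.IH[OF Suc.prems])
  finally show ?case .
qed

text \<open>Maharam's recurrence theorem. The set \<open>V\<close> of trajectories that start in \<open>B\<close> and never come
  back is wandering, so by stationarity the expected number of visits to \<open>C\<close> on \<open>V\<close> is at most the
  mass of \<open>C\<close>; but \<open>C\<close> is visited infinitely often.\<close>

lemma recurrent_measureI: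
  assumes C [measurable]: "C \<in> sets (borel_on E)" and fin: "emeasure \<nu> C < \<infinity>"
    and no_escape: "no_escape C"
  shows "recurrent_measure E K \<nu>"
  unfolding recurrent_measure_def
proof safe
  fix B assume B [measurable]: "B \<in> sets (borel_on E)"
  define V where "V = {\<omega> \<in> space Seq. \<omega> 0 \<in> B \<and> (\<forall>n. \<omega> (Suc n) \<notin> B)}"
  have V [measurable]: "V \<in> sets Seq" unfolding V_def by measurable
  let ?C = "\<lambda>k. {\<omega> \<in> space Seq. \<omega> k \<in> C}"
  have visits: "(\<Sum>k<n. emeasure Q (V \<inter> ?C k)) \<le> emeasure \<nu> C" for n
  proof -
    \<comment> \<open>On \<open>W k\<close> the last visit to \<open>B\<close> up to time
      \<open>n\<close> takes place at time \<open>n - k\<close>, so these events are disjoint for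
      different \<open>k\<close>. All of them put the trajectory in \<open>C\<close> at the common
      time \<open>n\<close>, which bounds their total mass by the mass of \<open>C\<close>.\<close>
    define W where "W k = shift_seq (n - k) -` (V \<inter> ?C k) \<inter> space Seq" for k
    have W: "W k \<in> sets Q" for k
      using measurable_sets[OF measurable_shift_seq, of "V \<inter> ?C k" "n - k"]
      by (simp add: sets_Q W_def)
    have disj: "disjoint_family_on W {..<n}"
      unfolding disjoint_family_on_def
    proof (intro ballI impI)
      have *: False if "i < j" "j < n" "\<omega> \<in> W i" "\<omega> \<in> W j" for i j \<omega>
      proof -
        have "\<omega> (Suc (j - i - 1) + (n - j)) \<notin> B" "\<omega> (0 + (n - i)) \<in> B"
          using that unfolding V_def W_def by blast+
        moreover have "Suc (j - i - 1) + (n - j) = 0 + (n - i)" using that by simp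
        ultimately show False by metis
      qed
      fix i j assume "i \<in> {..<n}" "j \<in> {..<n}" "i \<noteq> j"
      then show "W i \<inter> W j = {}"
        using *[of i j] *[of j i] by (cases "i < j") auto
    qed
    have "(\<Sum>k<n. emeasure Q (V \<inter> ?C k)) = (\<Sum>k<n. emeasure Q (W k))"
      unfolding W_def by (intro sum.cong refl emeasure_Q_shift[symmetric]) measurable
    also have "\<dots> = emeasure Q (\<Union>k<n. W k)"
      using W disj by (intro sum_emeasure) auto
    also have "\<dots> \<le> emeasure Q (shift_seq n -` ?C 0 \<inter> space Seq)"
    proof (rule emeasure_mono)
      show "(\<Union>k<n. W k) \<subseteq> shift_seq n -` ?C 0 \<inter> space Seq"
        by (auto simp: W_def space_Seq)
      show "shift_seq n -` ?C 0 \<inter> space Seq \<in> sets Q"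
        unfolding sets_Q by (rule measurable_sets[OF measurable_shift_seq]) measurable
    qed
    also have "\<dots> = emeasure \<nu> C"
      by (subst emeasure_Q_shift) (auto simp: emeasure_Q_0)
    finally show ?thesis .
  qed
  have "(\<integral>\<^sup>+\<omega>. (\<Sum>k. indicator (V \<inter> ?C k) \<omega>) \<partial>Q) = (\<Sum>k. emeasure Q (V \<inter> ?C k))"
    by (subst nn_integral_suminf) simp_all
  also have "\<dots> \<le> emeasure \<nu> C"
    unfolding suminf_eq_SUP by (rule SUP_least) (rule visits)
  finally have "(\<integral>\<^sup>+\<omega>. (\<Sum>k. indicator (V \<inter> ?C k) \<omega>) \<partial>Q) \<noteq> \<infinity>"
    using fin by auto
  then have "AE \<omega> in Q. (\<Sum>k. indicator (V \<inter> ?C k) \<omega>) \<noteq> (\<infinity> :: ennreal)"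
    by (intro nn_integral_PInf_AE) measurable
  moreover have "AE \<omega> in Q. \<exists>\<^sub>\<infinity>n. \<omega> n \<in> C"
  proof (subst AE_Q_iff)
    show "{\<omega> \<in> space Seq. \<exists>\<^sub>\<infinity>n. \<omega> n \<in> C} \<in> sets Seq"
      unfolding INFM_nat_le by measurable
    show "AE x in \<nu>. AE \<omega> in chain_law E K x. \<exists>\<^sub>\<infinity>n. \<omega> n \<in> C"
      by (rule AE_I2, rule AE_hits_infinitely_often[OF C _ no_escape]) (simp add: space_nu)
  qed
  ultimately have "AE \<omega> in Q. \<omega> \<notin> V"
    using AE_space
  proof eventually_elim
    case (elim \<omega>)
    show ?case
    proof
      assume "\<omega> \<in> V"
      then have eq: "indicator (V \<inter> ?C k) \<omega> = (indicator {k. \<omega> k \<in> C} k :: ennreal)" for k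
        using elim by (auto simp: space_Q indicator_def)
      have "(\<Sum>k. indicator {k. \<omega> k \<in> C} k :: ennreal) = emeasure (count_space UNIV) {k. \<omega> k \<in> C}"
        by (subst nn_integral_count_space_nat[symmetric]) simp
      also have "\<dots> = \<infinity>"
        using elim(2) by (simp add: INFM_iff_infinite)
      finally show False
        using elim(1) eq by simp
    qed
  qed
  then have "AE x in \<nu>. AE \<omega> in chain_law E K x. \<omega> \<notin> V"
    by (subst (asm) AE_Q_iff) measurable
  then show "AE x in \<nu>. x \<in> B \<longrightarrow> (AE \<omega> in chain_law E K x. \<exists>n\<ge>1. \<omega> n \<in> B)"
    using AE_space
  proof eventually_elim
    case (elim x)
    then have x: "x \<in> E" by (simp add: space_nu)
    show ?case
    proof
      assume xB: "x \<in> B"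
      show "AE \<omega> in chain_law E K x. \<exists>n\<ge>1. \<omega> n \<in> B"
        using elim(1) AE_chain_law_0[OF x] AE_space
      proof eventually_elim
        case (elim \<omega>)
        then obtain n where "\<omega> (Suc n) \<in> B"
          using xB x by (auto simp: V_def space_chain_law)
        then show ?case by (intro exI[of _ "Suc n"]) simp
      qed
    qed
  qed
qed

text \<open>The conditional probability of a shift-invariant event \<open>A\<close> given the first \<open>n\<close> coordinates is
  a harmonic function of the last one. If this function is a constant \<open>c\<close>, then \<open>Q (A \<inter> C) = c Q C\<close>
  for all cylinders \<open>C\<close>, hence also for the complement \<open>C\<close> of \<open>A\<close>.\<close>

lemma ergodic_measureI:
  assumes Liouville: "\<And>h. h \<in> borel_measurable (borel_on E) \<Longrightarrow> (\<And>x. x \<in> E \<Longrightarrow> h x \<le> 1) \<Longrightarrow>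
      (AE x in \<nu>. h x = (\<integral>\<^sup>+y. h y \<partial>K x)) \<Longrightarrow> \<exists>c :: ennreal. AE x in \<nu>. h x = c"
  shows "ergodic_measure E K \<nu>"
proof -
  let ?s = "\<lambda>\<omega> n. \<omega> (Suc n)"
  have s1: "?s = shift_seq 1" by simp
  have meas: "?s \<in> Q \<rightarrow>\<^sub>M Q"
    unfolding s1 using measurable_shift_seq[of 1] by (simp add: measurable_cong_sets[OF sets_Q sets_Q])
  have "distr Q Q ?s = Q"
  proof (rule measure_eqI)
    fix A assume "A \<in> sets (distr Q Q ?s)"
    then have A: "A \<in> sets Seq" by (simp add: sets_Q)
    have "emeasure (distr Q Q ?s) A = emeasure Q (?s -` A \<inter> space Q)"
      using A by (intro emeasure_distr[OF meas]) (simp add: sets_Q)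
    then show "emeasure (distr Q Q ?s) A = emeasure Q A"
      using emeasure_Q_shift[OF A, of 1] by (simp add: space_Q)
  qed simp
  moreover have "emeasure Q A = 0 \<or> emeasure Q (space Q - A) = 0"
    if "A \<in> sets Q" and null: "emeasure Q ((A - ?s -` A \<inter> space Q) \<union> (?s -` A \<inter> space Q - A)) = 0" for A
  proof -
    have A [measurable]: "A \<in> sets Seq" using that by (simp add: sets_Q)
    have sA [measurable]: "shift_seq 1 -` A \<inter> space Seq \<in> sets Seq"
      by (rule measurable_sets[OF measurable_shift_seq A])
    let ?D = "(A - (shift_seq 1 -` A \<inter> space Seq)) \<union> (shift_seq 1 -` A \<inter> space Seq - A)"
    have D: "?D \<in> sets Seq" using A sA by blast
    have "emeasure Q ?D = 0" using null by (simp add: space_Q)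
    moreover have "(\<lambda>x. emeasure (chain_law E K x) ?D) \<in> borel_measurable \<nu>"
      unfolding measurable_nu_iff using D by measurable
    ultimately have "AE x in \<nu>. emeasure (chain_law E K x) ?D = 0"
      unfolding emeasure_Q[OF D] using nn_integral_0_iff_AE by blast
    then have same: "AE x in \<nu>. AE \<omega> in chain_law E K x. \<omega> \<in> A \<longleftrightarrow> \<omega> \<in> shift_seq 1 -` A \<inter> space Seq"
      using AE_space
    proof eventually_elim
      case (elim x)
      then show ?case
        using D by (intro AE_I[of _ _ ?D]) (auto simp: space_nu sets_chain_law)
    qed
    let ?h = "\<lambda>x. emeasure (chain_law E K x) A"
    have h_meas: "?h \<in> borel_measurable (borel_on E)" by measurable
    have "AE x in \<nu>. ?h x = (\<integral>\<^sup>+y. ?h y \<partial>K x)"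
      using same AE_space
    proof eventually_elim
      case (elim x)
      then have x: "x \<in> E" by (simp add: space_nu)
      have "?h x = emeasure (chain_law E K x) (shift_seq 1 -` A \<inter> space Seq)"
        using elim x A sA by (intro emeasure_eq_AE) (auto simp: sets_chain_law)
      then show ?case
        using emeasure_chain_law_shift[OF x A] by simp
    qed
    moreover have "?h x \<le> 1" if "x \<in> E" for x
      using prob_space.measure_le_1[OF prob_space_chain_law[OF that]] by auto
    ultimately obtain c where c: "AE x in \<nu>. ?h x = c"
      using Liouville[OF h_meas] by auto
    \<comment> \<open>Induction on the length by conditioning on the first step. Invariance modulo
      null sets lets \<open>A\<close> be replaced by its shifted preimage, and
      \<open>AE_nu_K\<close> carries the exceptional set of the shorter cylinder one step
      back.\<close>
    have cyl: "AE x in \<nu>. emeasure (chain_law E K x) (cyl n F \<inter> A) = c * emeasure (chain_law E K x) (cyl n F)"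
      if "\<And>i. F i \<in> sets (borel_on E)" for n F
      using that
    proof (induction n arbitrary: F)
      case 0
      have [simp]: "cyl 0 F = space Seq" "space Seq \<inter> A = A"
        using sets.sets_into_space[OF A] by (auto simp: cyl_def)
      show ?case
        using c AE_space
        by eventually_elim
          (use prob_space.emeasure_space_1[OF prob_space_chain_law] in \<open>simp add: space_nu space_chain_law\<close>)
    next
      case (Suc n)
      let ?F = "\<lambda>i. F (Suc i)"
      have cS [measurable]: "cyl (Suc n) F \<in> sets Seq" and [measurable]: "cyl n ?F \<in> sets Seq"
        using Suc.prems by (auto intro: cyl_sets)
      have "AE x in \<nu>. AE y in K x. emeasure (chain_law E K y) (cyl n ?F \<inter> A) =
          c * emeasure (chain_law E K y) (cyl n ?F)"
        by (intro AE_nu_K Suc.IH Suc.prems)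
      then show ?case
        using same AE_space
      proof eventually_elim
        case (elim x)
        then have x: "x \<in> E" by (simp add: space_nu)
        have 1: "case_nat x -` (cyl (Suc n) F \<inter> (shift_seq 1 -` A \<inter> space Seq)) \<inter> space Seq =
            (if x \<in> F 0 then cyl n ?F \<inter> A else {})"
          using x sets.sets_into_space[OF A]
          by (auto simp: cyl_def space_Seq All_less_Suc2 split: nat.splits if_splits)
        have 2: "case_nat x -` cyl (Suc n) F \<inter> space Seq = (if x \<in> F 0 then cyl n ?F else {})"
          using x by (auto simp: cyl_def space_Seq All_less_Suc2 split: nat.splits if_splits)
        have "emeasure (chain_law E K x) (cyl (Suc n) F \<inter> A) =
            emeasure (chain_law E K x) (cyl (Suc n) F \<inter> (shift_seq 1 -` A \<inter> space Seq))"
        proof (rule emeasure_eq_AE)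
          show "cyl (Suc n) F \<inter> A \<in> sets (chain_law E K x)"
            "cyl (Suc n) F \<inter> (shift_seq 1 -` A \<inter> space Seq) \<in> sets (chain_law E K x)"
            unfolding sets_chain_law[OF x] by (rule sets.Int[OF cS A] sets.Int[OF cS sA])+
        qed (use elim(2) in auto)
        also have "\<dots> = (\<integral>\<^sup>+y. indicator (F 0) x * emeasure (chain_law E K y) (cyl n ?F \<inter> A) \<partial>K x)"
          by (subst emeasure_chain_law_case_nat[OF x sets.Int[OF cS sA]]) (unfold 1, auto intro!: nn_integral_cong)
        also have "\<dots> = (\<integral>\<^sup>+y. c * (indicator (F 0) x * emeasure (chain_law E K y) (cyl n ?F)) \<partial>K x)"
          using elim(1) by (intro nn_integral_cong_AE) (auto simp: ac_simps)
        also have "\<dots> = c * (\<integral>\<^sup>+y. indicator (F 0) x * emeasure (chain_law E K y) (cyl n ?F) \<partial>K x)"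
          using x by (intro nn_integral_cmult) (simp add: measurable_cong_sets[OF sets_K refl])
        also have "(\<integral>\<^sup>+y. indicator (F 0) x * emeasure (chain_law E K y) (cyl n ?F) \<partial>K x) =
            emeasure (chain_law E K x) (cyl (Suc n) F)"
          by (subst emeasure_chain_law_case_nat[OF x cS]) (unfold 2, auto intro!: nn_integral_cong)
        finally show ?case .
      qed
    qed
    \<comment> \<open>Both measures may be infinite; the cylinders over a sigma-finite exhaustion
      for \<open>\<nu>\<close> supply the sets of finite mass that uniqueness on a generator
      demands.\<close>
    have "density Q (indicator A) = density Q (\<lambda>_. c)"
    proof -
      obtain S :: "nat \<Rightarrow> real set" where S: "range S \<subseteq> sets \<nu>" "(\<Union>i. S i) = space \<nu>" "\<And>i. emeasure \<nu> (S i) \<noteq> \<infinity>"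
        using sigma_finite_measure.sigma_finite[OF sigma_finite] by metis
      have S': "S i \<in> sets (borel_on E)" for i using S(1) by (auto simp: sets_nu)
      have cylS: "cyl 1 (\<lambda>_. S i) = {\<omega> \<in> space Seq. \<omega> 0 \<in> S i}" for i
        by (auto simp: cyl_def)
      show ?thesis
      proof (rule measure_eqI_generator_eq[OF Int_stable_cyls cyls_Pow, where A="\<lambda>i. cyl 1 (\<lambda>_. S i)"])
        show "sets (density Q (indicator A)) = sigma_sets (space Seq) cyls"
          "sets (density Q (\<lambda>_. c)) = sigma_sets (space Seq) cyls"
          by (simp_all add: sets_Q sets_Seq)
        show "range (\<lambda>i. cyl 1 (\<lambda>_. S i)) \<subseteq> cyls"
          using S' by (auto intro: cyl_in_cyls)
        show "(\<Union>i. cyl 1 (\<lambda>_. S i)) = space Seq"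
          using S(2) by (auto simp: cyl_def space_Seq space_nu)
        fix i
        have "emeasure (density Q (indicator A)) (cyl 1 (\<lambda>_. S i)) \<le> emeasure Q (cyl 1 (\<lambda>_. S i))"
          using cyl_sets[of "\<lambda>_. S i" 1, OF S']
          by (subst emeasure_density)
             (auto simp: sets_Q nn_integral_indicator[symmetric] simp del: nn_integral_indicator
               intro!: nn_integral_mono split: split_indicator)
        also have "\<dots> = emeasure \<nu> (S i)"
          unfolding cylS by (rule emeasure_Q_0[OF S'])
        finally show "emeasure (density Q (indicator A)) (cyl 1 (\<lambda>_. S i)) \<noteq> \<infinity>"
          using S(3)[of i] by (auto simp: top_unique)
      next
        fix X assume "X \<in> cyls"
        then obtain n F where X: "X = cyl n F" and F: "\<And>i. F i \<in> sets (borel_on E)"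
          unfolding cyls_def by blast
        have Xs [measurable]: "X \<in> sets Seq" unfolding X by (rule cyl_sets[OF F])
        have "emeasure (density Q (indicator A)) X = emeasure Q (X \<inter> A)"
          by (subst emeasure_density)
            (auto simp: sets_Q nn_integral_indicator[symmetric] indicator_inter_arith ac_simps simp del: nn_integral_indicator)
        also have "\<dots> = (\<integral>\<^sup>+x. c * emeasure (chain_law E K x) X \<partial>\<nu>)"
          unfolding emeasure_Q[OF sets.Int[OF Xs A]] using cyl[OF F, of n]
          by (intro nn_integral_cong_AE) (simp add: X)
        also have "\<dots> = c * emeasure Q X"
          unfolding emeasure_Q[OF Xs]
        proof (rule nn_integral_cmult)
          show "(\<lambda>x. emeasure (chain_law E K x) X) \<in> borel_measurable \<nu>"
            unfolding measurable_nu_iff by measurable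
        qed
        also have "\<dots> = emeasure (density Q (\<lambda>_. c)) X"
          by (subst emeasure_density_const) (auto simp: sets_Q)
        finally show "emeasure (density Q (indicator A)) X = emeasure (density Q (\<lambda>_. c)) X" .
      qed
    qed
    then have eq: "emeasure (density Q (indicator A)) X = c * emeasure Q X" if "X \<in> sets Seq" for X
      using that by (simp add: emeasure_density_const sets_Q)
    have dens: "emeasure (density Q (indicator A)) X = emeasure Q (A \<inter> X)" if "X \<in> sets Seq" for X
      using that by (subst emeasure_density)
        (auto simp: sets_Q nn_integral_indicator[symmetric] indicator_inter_arith simp del: nn_integral_indicator)
    \<comment> \<open>The value of \<open>c\<close> need not be found. Tested on the complement of
      \<open>A\<close>, the identity forces \<open>c = 0\<close> or a null complement; tested on
      \<open>A\<close> itself, \<open>c = 0\<close> makes \<open>A\<close> null.\<close>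
    have "c * emeasure Q (space Seq - A) = emeasure Q (A \<inter> (space Seq - A))"
      using eq[of "space Seq - A"] dens[of "space Seq - A"] by simp
    then have "c = 0 \<or> emeasure Q (space Seq - A) = 0" by simp
    moreover have "emeasure Q A = c * emeasure Q A"
      using eq[OF A] dens[OF A] by simp
    ultimately show ?thesis by (auto simp: space_Q)
  qed
  ultimately show ?thesis
    using meas unfolding ergodic_measure_def Let_def Q_def[symmetric] by blast
qed

end

text \<open>The values on indicators form a measure, and the three rules carry integration from
  indicators to all measurable functions. Homogeneity with factor 0 supplies the value at the zero
  function. This turns operators on functions back into measures.\<close>

lemma exists_measure_of_functional:
  fixes \<Phi> :: "(real \<Rightarrow> ennreal) \<Rightarrow> ennreal"
  assumes add: "\<And>f g. f \<in> borel_measurable borel \<Longrightarrow> g \<in> borel_measurable borel \<Longrightarrow> \<Phi> (\<lambda>x. f x + g x) = \<Phi> f + \<Phi> g"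
    and cmult: "\<And>c f. f \<in> borel_measurable borel \<Longrightarrow> \<Phi> (\<lambda>x. c * f x) = c * \<Phi> f"
    and SUP: "\<And>F. (\<And>n::nat. F n \<in> borel_measurable borel) \<Longrightarrow> incseq F \<Longrightarrow> \<Phi> (\<lambda>x. SUP n. F n x) = (SUP n. \<Phi> (F n))"
  obtains \<mu> where "sets \<mu> = sets borel" "\<And>f. f \<in> borel_measurable borel \<Longrightarrow> (\<integral>\<^sup>+x. f x \<partial>\<mu>) = \<Phi> f"
proof -
  have zero: "\<Phi> (\<lambda>_. 0) = 0"
    using cmult[of "\<lambda>_. 0" 0] by simp
  have sum: "\<Phi> (\<lambda>x. \<Sum>i\<in>I. F i x) = (\<Sum>i\<in>I. \<Phi> (F i))"
    if "finite I" "\<And>i. F i \<in> borel_measurable borel" for F and I :: "nat set"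
    using that(1)
  proof (induction rule: finite_induct)
    case (insert i I)
    have "\<Phi> (\<lambda>x. F i x + (\<Sum>j\<in>I. F j x)) = \<Phi> (F i) + \<Phi> (\<lambda>x. \<Sum>j\<in>I. F j x)"
      by (intro add that(2) borel_measurable_sum)
    then show ?case using insert by simp
  qed (simp add: zero)
  define \<mu> where "\<mu> = measure_of UNIV (sets borel) (\<lambda>A. \<Phi> (indicator A))"
  have sets [simp, measurable_cong]: "sets \<mu> = sets borel"
    unfolding \<mu>_def by (subst sets_measure_of) (auto simp: sets.sigma_sets_eq[of borel, simplified])
  have em: "emeasure \<mu> A = \<Phi> (indicator A)" if "A \<in> sets borel" for A
  proof (rule emeasure_measure_of[OF \<mu>_def])
    show "positive (sets \<mu>) (\<lambda>A. \<Phi> (indicator A))"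
      using zero by (simp add: positive_def indicator_def[abs_def])
    show "countably_additive (sets \<mu>) (\<lambda>A. \<Phi> (indicator A))"
    proof (rule countably_additiveI)
      fix A :: "nat \<Rightarrow> real set"
      assume A: "range A \<subseteq> sets \<mu>" and disj: "disjoint_family A"
      have [measurable]: "A i \<in> sets borel" for i using A by auto
      let ?F = "\<lambda>n x. \<Sum>i<n. indicator (A i) x :: ennreal"
      have inc: "incseq ?F"
        by (intro monoI le_funI sum_mono2) auto
      have "indicator (\<Union>i. A i) = (\<lambda>x. SUP n. ?F n x)"
        unfolding suminf_eq_SUP[symmetric] using disj by (intro ext) (simp add: suminf_indicator)
      then have "\<Phi> (indicator (\<Union>i. A i)) = (SUP n. \<Phi> (?F n))"
        using SUP[of ?F] inc by simp
      also have "\<dots> = (SUP n. \<Sum>i<n. \<Phi> (indicator (A i)))"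
        by (intro SUP_cong refl sum) auto
      finally show "(\<Sum>i. \<Phi> (indicator (A i))) = \<Phi> (indicator (\<Union>i. A i))"
        by (simp add: suminf_eq_SUP)
    qed
  qed (use that in auto)
  have "(\<integral>\<^sup>+x. f x \<partial>\<mu>) = \<Phi> f" if "f \<in> borel_measurable borel" for f
    using that
  proof (induction rule: borel_measurable_induct)
    case (cong f g)
    then have "f = g" by auto
    then show ?case using cong by simp
  next
    case (set A)
    then show ?case using em by simp
  next
    case (mult u c)
    then show ?case by (simp add: nn_integral_cmult cmult)
  next
    case (add u v)
    then show ?case by (simp add: nn_integral_add assms(1))
  next
    case (seq U)
    have "(SUP i. U i) = (\<lambda>x. SUP i. U i x)" by (auto simp: image_comp)
    then show ?case
      using seq by (simp add: nn_integral_monotone_convergence_SUP SUP)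
  qed
  then show ?thesis using that sets by blast
qed

section \<open>Recurrent step laws\<close>

text \<open>Besides a step law, \<open>D\<close> may be any measure: with \<open>\<mu>\<close> in
  its place, the indicator of \<open>U\<close> is mapped to the mass of \<open>U - x\<close>, the
  function studied for translation invariance.\<close>

definition step_op :: "real measure \<Rightarrow> (real \<Rightarrow> ennreal) \<Rightarrow> real \<Rightarrow> ennreal" where
  "step_op D f x = (\<integral>\<^sup>+y. f (x + y) \<partial>D)"

lemma step_op_measurable [measurable]:
  assumes "sigma_finite_measure D" "sets D = sets borel" and [measurable]: "f \<in> borel_measurable borel"
  shows "step_op D f \<in> borel_measurable borel"
proof -
  interpret sigma_finite_measure D by fact
  have [measurable_cong]: "sets D = sets borel" by fact
  show ?thesis unfolding step_op_def by measurable
qed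

section \<open>Lower semicontinuous functions\<close>

definition lsc :: "(real \<Rightarrow> ennreal) \<Rightarrow> bool" where
  "lsc f \<longleftrightarrow> (\<forall>t. open {x. t < f x})"

lemma lsc_measurable: "lsc f \<Longrightarrow> f \<in> borel_measurable borel"
  unfolding lsc_def by (intro borel_measurableI_greater) auto

lemma lsc_indicator: "open U \<Longrightarrow> lsc (indicator U)"
proof -
  assume "open U"
  moreover have "{x. t < (indicator U x :: ennreal)} = (if t < 1 then U else {})" for t
    by (auto simp: indicator_def)
  ultimately show ?thesis by (simp add: lsc_def)
qed

text \<open>This is Fatou's lemma.\<close>

lemma lsc_step_op:
  assumes D: "sets D = sets borel" and f: "lsc f"
  shows "lsc (step_op D f)"
  unfolding lsc_def
proof
  fix t
  have [measurable]: "f \<in> borel_measurable borel" by (rule lsc_measurable[OF f])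
  have [measurable_cong]: "sets D = sets borel" by (rule D)
  have liminf: "f l \<le> liminf (\<lambda>n. f (u n))" if "u \<longlonglongrightarrow> l" for u l
    unfolding le_Liminf_iff
  proof safe
    fix y assume "y < f l"
    then have "open {x. y < f x}" "l \<in> {x. y < f x}" using f by (auto simp: lsc_def)
    then show "\<forall>\<^sub>F n in sequentially. y < f (u n)"
      using topological_tendstoD[OF that] by fastforce
  qed
  have "closed {x. step_op D f x \<le> t}"
    unfolding closed_sequential_limits
  proof safe
    fix u l assume u: "\<forall>n. u n \<in> {x. step_op D f x \<le> t}" "u \<longlonglongrightarrow> l"
    have "step_op D f l \<le> (\<integral>\<^sup>+y. liminf (\<lambda>n. f (u n + y)) \<partial>D)"
      unfolding step_op_def
      by (intro nn_integral_mono liminf tendsto_intros u)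
    also have "\<dots> \<le> liminf (\<lambda>n. step_op D f (u n))"
      unfolding step_op_def by (rule nn_integral_liminf) measurable
    also have "\<dots> \<le> t"
      using u(1) Liminf_mono[of "\<lambda>n. step_op D f (u n)" "\<lambda>_. t" sequentially] by (simp add: Liminf_const)
    finally show "step_op D f l \<le> t" .
  qed
  then show "open {x. t < step_op D f x}"
    by (simp add: closed_def Compl_eq not_le)
qed

lemma sigma_finite_of_bounded:
  assumes \<mu>: "sets \<mu> = sets borel" and fin: "\<And>r. emeasure \<mu> {- r..r::real} < \<infinity>"
  shows "sigma_finite_measure \<mu>"
proof
  have "\<exists>n::nat. x \<in> {- real n..real n}" for x
  proof -
    obtain n where "\<bar>x\<bar> \<le> real n" using real_arch_simple by blast
    then show ?thesis by (intro exI[of _ n]) auto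
  qed
  then have "(\<Union>n::nat. {- real n..real n}) = space \<mu>"
    using sets_eq_imp_space_eq[OF \<mu>] by auto
  then show "\<exists>A. countable A \<and> A \<subseteq> sets \<mu> \<and> \<Union>A = space \<mu> \<and> (\<forall>a\<in>A. emeasure \<mu> a \<noteq> \<infinity>)"
    using fin by (intro exI[of _ "range (\<lambda>n::nat. {- real n..real n})"]) (auto simp: \<mu> less_top[symmetric])
qed

text \<open>The last assumption is the minimum principle for superharmonic functions. It is what topological
  recurrence is used for.\<close>

locale recurrent_law =
  fixes D :: "real measure" and Z :: "real set" and L :: "real measure"
  assumes prob_D: "prob_space D"
    and sets_D [measurable_cong]: "sets D = sets borel"
    and closed_Z: "closed Z"
    and subgroup_Z: "additive_subgroup Z"
    and D_Z: "AE y in D. y \<in> Z"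
    and sets_L [measurable_cong]: "sets L = sets borel"
    and L_Z: "AE x in L. x \<in> Z"
    and L_plus: "\<And>z. z \<in> Z \<Longrightarrow> distr L borel (\<lambda>x. x + z) = L"
    and L_bounded: "\<And>r. emeasure L {- r..r} < \<infinity>"
    and L_pos: "emeasure L {-1<..<1} > 0"
    and minimum_principle: "\<And>g G m x. g \<in> borel_measurable borel \<Longrightarrow> open G \<Longrightarrow> G \<inter> Z \<noteq> {} \<Longrightarrow>
      (\<And>x. x \<in> Z \<Longrightarrow> step_op D g x \<le> g x) \<Longrightarrow> (\<And>x. x \<in> G \<inter> Z \<Longrightarrow> m \<le> g x) \<Longrightarrow> x \<in> Z \<Longrightarrow> m \<le> g x"
begin

sublocale D: prob_space D by (rule prob_D)

lemma space_L: "space L = UNIV"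
  using sets_eq_imp_space_eq[OF sets_L] by simp

lemma Z_sets [measurable]: "Z \<in> sets borel"
  using closed_Z by simp

lemma Z_add: "x \<in> Z \<Longrightarrow> y \<in> Z \<Longrightarrow> x + y \<in> Z"
  and Z_minus: "x \<in> Z \<Longrightarrow> - x \<in> Z" and Z_0: "0 \<in> Z"
  using subgroup_Z by (auto simp: additive_subgroup_def)

sublocale L: sigma_finite_measure L
  by (rule sigma_finite_of_bounded[OF sets_L L_bounded])

section \<open>Calculus of the step operator\<close>

abbreviation "St \<equiv> step_op D"

lemma St_measurable [measurable]: "f \<in> borel_measurable borel \<Longrightarrow> St f \<in> borel_measurable borel"
  using D.sigma_finite_measure_axioms sets_D by (rule step_op_measurable)

lemma measurable_translate [measurable (raw)]:
  fixes f :: "real \<Rightarrow> ennreal"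
  shows "f \<in> borel_measurable borel \<Longrightarrow> (\<lambda>y. f (x + y)) \<in> borel_measurable borel"
  by (rule measurable_compose[of "\<lambda>y. x + y" borel borel]) simp_all

lemma measurable_translate_D: "f \<in> borel_measurable borel \<Longrightarrow> (\<lambda>y. f (x + y) :: ennreal) \<in> borel_measurable D"
  using measurable_translate by (simp add: measurable_cong_sets[OF sets_D refl])

lemma St_add: "f \<in> borel_measurable borel \<Longrightarrow> g \<in> borel_measurable borel \<Longrightarrow> St (\<lambda>x. f x + g x) x = St f x + St g x"
  unfolding step_op_def by (intro nn_integral_add measurable_translate_D)

lemma St_cmult: "f \<in> borel_measurable borel \<Longrightarrow> St (\<lambda>x. c * f x) x = c * St f x"
  unfolding step_op_def by (intro nn_integral_cmult measurable_translate_D)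

lemma St_const: "St (\<lambda>_. c) x = c"
  using D.emeasure_space_1 by (simp add: step_op_def)

lemma St_mono: "x \<in> Z \<Longrightarrow> (\<And>y. y \<in> Z \<Longrightarrow> f y \<le> g y) \<Longrightarrow> St f x \<le> St g x"
  unfolding step_op_def using D_Z by (intro nn_integral_mono_AE) (auto elim!: eventually_mono intro: Z_add)

lemma St_cong: "x \<in> Z \<Longrightarrow> (\<And>y. y \<in> Z \<Longrightarrow> f y = g y) \<Longrightarrow> St f x = St g x"
  by (intro antisym St_mono) auto

lemma St_suminf: "(\<And>n. F n \<in> borel_measurable borel) \<Longrightarrow> St (\<lambda>x. \<Sum>n. F n x) x = (\<Sum>n. St (F n) x)"
  unfolding step_op_def by (intro nn_integral_suminf measurable_translate_D)

lemma St_SUP: "(\<And>n::nat. F n \<in> borel_measurable borel) \<Longrightarrow> incseq F \<Longrightarrow> St (\<lambda>x. SUP n. F n x) x = (SUP n. St (F n) x)"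
  unfolding step_op_def
  by (intro nn_integral_monotone_convergence_SUP measurable_translate_D) (auto simp: incseq_def le_fun_def)

lemma St_if:
  assumes [measurable]: "f \<in> borel_measurable borel" "A \<in> sets borel"
  shows "St f x = St (\<lambda>x. indicator A x * f x) x + St (\<lambda>x. indicator (- A) x * f x) x"
  by (subst St_add[symmetric]) (auto intro!: arg_cong2[where f=St] simp: indicator_def)

lemma funpow_measurable:
  fixes T :: "(real \<Rightarrow> ennreal) \<Rightarrow> real \<Rightarrow> ennreal"
  assumes "\<And>f. f \<in> borel_measurable borel \<Longrightarrow> T f \<in> borel_measurable borel"
  shows "f \<in> borel_measurable borel \<Longrightarrow> (T ^^ n) f \<in> borel_measurable borel"
  using assms by (induction n) auto

lemma nn_integral_L_plus:
  assumes [measurable]: "f \<in> borel_measurable borel" and z: "z \<in> Z"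
  shows "(\<integral>\<^sup>+x. f (x + z) \<partial>L) = (\<integral>\<^sup>+x. f x \<partial>L)"
  by (subst (2) L_plus[OF z, symmetric]) (simp add: nn_integral_distr)

text \<open>The expected number of visits to \<open>G\<close>, as a sum over times, is superharmonic
  and at least 1 on \<open>G\<close>; the minimum principle makes it at least 1 on all of
  \<open>Z\<close>, so some term is positive.\<close>

lemma reaches_open:
  assumes G: "open G" "G \<inter> Z \<noteq> {}" and x: "x \<in> Z"
  obtains n where "(St ^^ n) (indicator G) x > 0"
proof -
  have [measurable]: "(St ^^ n) (indicator G) \<in> borel_measurable borel" for n
    using G by (intro funpow_measurable) auto
  let ?g = "\<lambda>x. \<Sum>n. (St ^^ n) (indicator G) x"
  have "1 \<le> ?g x"
  proof (rule minimum_principle[OF _ G])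
    show "St ?g y \<le> ?g y" for y
    proof -
      have "St ?g y = (\<Sum>n. (St ^^ Suc n) (indicator G) y)"
        by (simp add: St_suminf)
      also have "\<dots> \<le> ?g y"
        using suminf_offset[of "\<lambda>n. (St ^^ n) (indicator G) y" 1] by simp
      finally show ?thesis .
    qed
    show "1 \<le> ?g y" if "y \<in> G \<inter> Z" for y
      using sum_le_suminf[of "\<lambda>n. (St ^^ n) (indicator G) y" "{0}"] that by simp
  qed (use x in auto)
  then have "?g x \<noteq> 0" by auto
  then show ?thesis using that by (force simp: zero_less_iff_neq_zero)
qed

text \<open>Finiteness spreads backwards along the walk. Every \<open>x\<close> in \<open>Z\<close>
  reaches \<open>J\<close> in some number of steps with positive probability; the set where this
  probability exceeds a suitable \<open>t > 0\<close> is an open neighbourhood of \<open>x\<close>,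
  and by invariance and Markov's inequality its mass is at most that of \<open>J\<close> divided by
  \<open>t\<close>. Compactness does the rest.\<close>

lemma locally_finite:
  assumes \<mu>: "sets \<mu> = sets borel"
    and inv: "\<And>f. f \<in> borel_measurable borel \<Longrightarrow> (\<integral>\<^sup>+x. St f x \<partial>\<mu>) = (\<integral>\<^sup>+x. f x \<partial>\<mu>)"
    and \<mu>_Z: "AE x in \<mu>. x \<in> Z"
    and J: "open J" "J \<inter> Z \<noteq> {}" "emeasure \<mu> J < \<infinity>"
  shows "emeasure \<mu> {- r..r} < \<infinity>"
proof -
  have [measurable_cong]: "sets \<mu> = sets borel" by (rule \<mu>)
  have nbhd: "\<exists>U. open U \<and> x \<in> U \<and> emeasure \<mu> U < \<infinity>" if x: "x \<in> Z" for x
  proof -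
    obtain n where n: "(St ^^ n) (indicator J) x > 0"
      using reaches_open[OF J(1,2) x] .
    let ?f = "(St ^^ n) (indicator J)"
    have lsc: "lsc ((St ^^ n) (indicator J))" for n
      by (induction n) (use sets_D J in \<open>auto intro: lsc_indicator lsc_step_op\<close>)
    have [measurable]: "(St ^^ n) (indicator J) \<in> borel_measurable borel" for n
      by (rule lsc_measurable[OF lsc])
    have int: "(\<integral>\<^sup>+x. (St ^^ n) (indicator J) x \<partial>\<mu>) = emeasure \<mu> J" for n
      by (induction n) (use J in \<open>auto simp: inv \<mu>\<close>)
    obtain t where t: "0 < t" "t < ?f x"
      using dense[OF n] by auto
    let ?U = "{y. t < ?f y}"
    have "t * emeasure \<mu> ?U = (\<integral>\<^sup>+y. t * indicator ?U y \<partial>\<mu>)"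
      by (subst nn_integral_cmult_indicator) auto
    also have "\<dots> \<le> (\<integral>\<^sup>+y. ?f y \<partial>\<mu>)"
      by (intro nn_integral_mono) (auto split: split_indicator)
    also have "\<dots> < \<infinity>" using J int by simp
    finally have "emeasure \<mu> ?U < \<infinity>"
      using t by (auto simp: ennreal_mult_less_top less_top[symmetric] top_unique)
    moreover have "open ?U" using lsc by (auto simp: lsc_def)
    ultimately show ?thesis using t by blast
  qed
  have comp: "compact (Z \<inter> {- r..r})"
    using closed_Z by (intro closed_Int_compact) auto
  have "\<forall>x\<in>Z \<inter> {- r..r}. \<exists>U. open U \<and> x \<in> U \<and> emeasure \<mu> U < \<infinity>"
    using nbhd by blast
  then obtain U where U: "\<And>x. x \<in> Z \<inter> {- r..r} \<Longrightarrow> open (U x) \<and> x \<in> U x \<and> emeasure \<mu> (U x) < \<infinity>"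
    by metis
  have U_sets: "x \<in> F \<Longrightarrow> U x \<in> sets borel" if "F \<subseteq> Z \<inter> {- r..r}" for x F
    using U[of x] that borel_open[of "U x"] by blast
  obtain F where F: "F \<subseteq> Z \<inter> {- r..r}" "finite F" "Z \<inter> {- r..r} \<subseteq> (\<Union>x\<in>F. U x)"
    by (rule compactE_image[OF comp, of "Z \<inter> {- r..r}" U]) (use U in auto)
  have "emeasure \<mu> {- r..r} = emeasure \<mu> (Z \<inter> {- r..r})"
    using \<mu>_Z by (intro emeasure_eq_AE) (auto simp: \<mu>)
  also have "\<dots> \<le> emeasure \<mu> (\<Union>x\<in>F. U x)"
    using F U_sets[OF F(1)] by (intro emeasure_mono sets.finite_UN) (auto simp: \<mu>)
  also have "\<dots> \<le> (\<Sum>x\<in>F. emeasure \<mu> (U x))"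
    using F U_sets[OF F(1)] by (intro emeasure_subadditive_finite) (auto simp: \<mu>)
  also have "\<dots> < \<infinity>"
    using F U by (auto simp: subset_eq)
  finally show ?thesis .
qed

text \<open>For open \<open>U\<close> the function \<open>x \<mapsto> \<mu> (U - x)\<close> is harmonic and lower semicontinuous, so it is constant by
  the minimum principle. Thus \<open>\<mu>\<close> is translation invariant.\<close>

lemma translation_invariant:
  assumes \<mu>: "sets \<mu> = sets borel"
    and inv: "\<And>f. f \<in> borel_measurable borel \<Longrightarrow> (\<integral>\<^sup>+x. St f x \<partial>\<mu>) = (\<integral>\<^sup>+x. f x \<partial>\<mu>)"
    and fin: "\<And>r. emeasure \<mu> {- r..r} < \<infinity>"
    and z: "z \<in> Z"
  shows "distr \<mu> borel (\<lambda>x. x + z) = \<mu>"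
proof -
  have [measurable_cong]: "sets \<mu> = sets borel" by (rule \<mu>)
  interpret \<mu>: sigma_finite_measure \<mu>
    by (rule sigma_finite_of_bounded[OF \<mu> fin])
  interpret P: pair_sigma_finite \<mu> D ..
  have const: "step_op \<mu> (indicator U) b \<le> step_op \<mu> (indicator U) a"
    if U: "open U" and a: "a \<in> Z" and b: "b \<in> Z" for U a b
  proof (rule dense_le)
    \<comment> \<open>Every level \<open>m\<close> below the value at \<open>b\<close> is exceeded
      on an open set around \<open>b\<close>, so the minimum principle carries \<open>m\<close> over
      to \<open>a\<close>.\<close>
    fix m assume m: "m < step_op \<mu> (indicator U) b"
    let ?g = "step_op \<mu> (indicator U)"
    have lsc: "lsc ?g" by (intro lsc_step_op lsc_indicator U \<mu>)
    show "m \<le> ?g a"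
    proof (rule minimum_principle[of ?g "{x. m < ?g x}"])
      show "?g \<in> borel_measurable borel" by (rule lsc_measurable[OF lsc])
      show "open {x. m < ?g x}" using lsc by (auto simp: lsc_def)
      show "{x. m < ?g x} \<inter> Z \<noteq> {}" using m b by auto
      show "St ?g x \<le> ?g x" for x
      proof -
        have [measurable]: "U \<in> sets borel" using U by simp
        have "St ?g x = (\<integral>\<^sup>+y. \<integral>\<^sup>+w. indicator U (x + y + w) \<partial>\<mu> \<partial>D)"
          by (simp add: step_op_def)
        also have "\<dots> = (\<integral>\<^sup>+w. \<integral>\<^sup>+y. indicator U (x + y + w) \<partial>D \<partial>\<mu>)"
          by (rule P.Fubini') measurable
        also have "\<dots> = (\<integral>\<^sup>+w. St (\<lambda>w. indicator U (x + w)) w \<partial>\<mu>)"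
          by (simp add: step_op_def ac_simps)
        also have "\<dots> = ?g x"
          by (subst inv) (auto simp: step_op_def)
        finally show ?thesis by simp
      qed
    qed (use a in auto)
  qed
  have eq: "emeasure \<mu> U = emeasure (distr \<mu> borel (\<lambda>x. x + z)) U" if "open U" for U
  proof -
    have [measurable]: "U \<in> sets borel" using that by simp
    have "step_op \<mu> (indicator U) 0 = step_op \<mu> (indicator U) z"
      using const[OF that z Z_0] const[OF that Z_0 z] by simp
    then show ?thesis
      by (simp add: step_op_def nn_integral_distr[symmetric, of "\<lambda>x. x + z" _ borel] add.commute \<mu>
        flip: nn_integral_indicator)
  qed
  show ?thesis
  proof (rule measure_eqI_generator_eq[where E="Collect open" and \<Omega>=UNIV and A="\<lambda>n::nat. {- real n<..<real n}", symmetric])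
    show "Int_stable (Collect open :: real set set)" by (auto simp: Int_stable_def)
    show "sets \<mu> = sigma_sets UNIV (Collect open)" "sets (distr \<mu> borel (\<lambda>x. x + z)) = sigma_sets UNIV (Collect open)"
      by (simp_all add: \<mu> borel_def)
    have "\<exists>n. x \<in> {- real n<..<real n}" for x
    proof -
      obtain n where "\<bar>x\<bar> < real n" using reals_Archimedean2 by blast
      then show ?thesis by (intro exI[of _ n]) auto
    qed
    then show "(\<Union>n. {- real n<..<real n}) = UNIV" by auto
    show "emeasure \<mu> {- real n<..<real n} \<noteq> \<infinity>" for n
    proof -
      have "emeasure \<mu> {- real n<..<real n} \<le> emeasure \<mu> {- real n..real n}"
        by (intro emeasure_mono) (auto simp: \<mu>)
      then show ?thesis using fin[of "real n"] by (auto simp: top_unique)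
    qed
  qed (use eq in auto)
qed

text \<open>Uniqueness of Haar measure. The double integral of
  \<open>indicator U x * indicator B (y + x)\<close> is computed in both orders, using the
  invariance of each measure under \<open>Z\<close>, with \<open>U\<close> the interval from -1 to
  1. The constant is the ratio of the two masses of \<open>U\<close>; that of \<open>L\<close> is
  finite and positive.\<close>

lemma unique_invariant:
  assumes \<mu>: "sets \<mu> = sets borel"
    and inv: "\<And>f. f \<in> borel_measurable borel \<Longrightarrow> (\<integral>\<^sup>+x. St f x \<partial>\<mu>) = (\<integral>\<^sup>+x. f x \<partial>\<mu>)"
    and \<mu>_Z: "AE x in \<mu>. x \<in> Z"
    and fin: "\<And>r. emeasure \<mu> {- r..r} < \<infinity>"
  obtains c where "c < \<infinity>" "\<mu> = scale_measure c L"
proof -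
  have [measurable_cong]: "sets \<mu> = sets borel" by (rule \<mu>)
  have space_\<mu>: "space \<mu> = UNIV" using sets_eq_imp_space_eq[OF \<mu>] by simp
  interpret \<mu>: sigma_finite_measure \<mu>
    by (rule sigma_finite_of_bounded[OF \<mu> fin])
  interpret P: pair_sigma_finite \<mu> L ..
  let ?U = "{-1<..<1::real}"
  have U: "emeasure \<mu> ?U < \<infinity>" "emeasure L ?U < \<infinity>" "emeasure L ?U > 0"
    using L_pos le_less_trans[OF emeasure_mono[of ?U "{-1..1}" \<mu>] fin[of 1]]
      le_less_trans[OF emeasure_mono[of ?U "{-1..1}" L] L_bounded[of 1]]
    by (auto simp: \<mu> sets_L greaterThanLessThan_subseteq_atLeastAtMost_iff)
  have \<mu>_plus: "(\<integral>\<^sup>+y. f (y + z) \<partial>\<mu>) = (\<integral>\<^sup>+y. f y \<partial>\<mu>)" if [measurable]: "f \<in> borel_measurable borel" and "z \<in> Z" for f z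
    by (subst (2) translation_invariant[OF \<mu> inv fin \<open>z \<in> Z\<close>, symmetric]) (simp_all add: nn_integral_distr)
  have key: "emeasure L ?U * emeasure \<mu> B = emeasure L B * emeasure \<mu> ?U" if [measurable]: "B \<in> sets borel" for B
  proof -
    have [measurable]: "?U \<in> sets borel" by simp
    have "emeasure L ?U * emeasure \<mu> B = (\<integral>\<^sup>+x. indicator ?U x * emeasure \<mu> B \<partial>L)"
      by (subst nn_integral_multc) (auto simp: sets_L)
    also have "\<dots> = (\<integral>\<^sup>+x. \<integral>\<^sup>+y. indicator ?U x * indicator B (y + x) \<partial>\<mu> \<partial>L)"
    proof (rule nn_integral_cong_AE)
      show "AE x in L. indicator ?U x * emeasure \<mu> B = (\<integral>\<^sup>+y. indicator ?U x * indicator B (y + x) \<partial>\<mu>)"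
        using L_Z by eventually_elim (subst nn_integral_cmult, simp_all add: \<mu>_plus \<mu>)
    qed
    also have "\<dots> = (\<integral>\<^sup>+y. \<integral>\<^sup>+x. indicator ?U x * indicator B (y + x) \<partial>L \<partial>\<mu>)"
      by (rule P.Fubini') measurable
    also have "\<dots> = (\<integral>\<^sup>+y. \<integral>\<^sup>+x. indicator ?U (x - y) * indicator B x \<partial>L \<partial>\<mu>)"
    proof (rule nn_integral_cong_AE)
      have "(\<integral>\<^sup>+x. indicator ?U x * indicator B (y + x) \<partial>L) = (\<integral>\<^sup>+x. indicator ?U (x - y) * indicator B x \<partial>L)"
        if "y \<in> Z" for y
        using nn_integral_L_plus[of "\<lambda>x. indicator ?U (x - y) * indicator B x" y] that by (simp add: add.commute)
      then show "AE y in \<mu>. (\<integral>\<^sup>+x. indicator ?U x * indicator B (y + x) \<partial>L) = (\<integral>\<^sup>+x. indicator ?U (x - y) * indicator B x \<partial>L)"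
        using \<mu>_Z by auto
    qed
    also have "\<dots> = (\<integral>\<^sup>+x. \<integral>\<^sup>+y. indicator ?U (x - y) * indicator B x \<partial>\<mu> \<partial>L)"
      by (rule P.Fubini'[symmetric]) measurable
    also have "\<dots> = (\<integral>\<^sup>+x. indicator B x * emeasure \<mu> ?U \<partial>L)"
    proof (rule nn_integral_cong_AE)
      have "(\<integral>\<^sup>+y. indicator ?U (x - y) * indicator B x \<partial>\<mu>) = indicator B x * emeasure \<mu> ?U" if "x \<in> Z" for x
      proof -
        have "(\<integral>\<^sup>+y. indicator ?U (x - y) * indicator B x \<partial>\<mu>) = (\<integral>\<^sup>+y. indicator ?U (x - y) \<partial>\<mu>) * indicator B x"
          by (rule nn_integral_multc) measurable
        also have "(\<integral>\<^sup>+y. indicator ?U (x - y) \<partial>\<mu>) = (\<integral>\<^sup>+y. indicator ?U (y + - x) \<partial>\<mu>)"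
          by (intro nn_integral_cong) (auto simp: indicator_def)
        also have "\<dots> = (\<integral>\<^sup>+y. indicator ?U y \<partial>\<mu>)"
          using that by (intro \<mu>_plus) (auto intro: Z_minus)
        finally show ?thesis by (simp add: \<mu> mult.commute)
      qed
      then show "AE x in L. (\<integral>\<^sup>+y. indicator ?U (x - y) * indicator B x \<partial>\<mu>) = indicator B x * emeasure \<mu> ?U"
        using L_Z by auto
    qed
    also have "\<dots> = emeasure L B * emeasure \<mu> ?U"
      by (subst nn_integral_multc) (auto simp: sets_L)
    finally show ?thesis .
  qed
  define c where "c = emeasure \<mu> ?U / emeasure L ?U"
  have "c < \<infinity>" using U by (auto simp: c_def ennreal_divide_eq_top_iff simp flip: less_top)
  moreover have "\<mu> = scale_measure c L"
  proof (rule measure_eqI)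
    fix B assume "B \<in> sets \<mu>"
    then have B: "B \<in> sets borel" by (simp add: \<mu>)
    have "emeasure \<mu> B = emeasure L ?U * emeasure \<mu> B / emeasure L ?U"
      using U by (subst mult.commute) (simp add: ennreal_mult_divide_eq)
    also have "\<dots> = emeasure (scale_measure c L) B"
      using key[OF B] by (simp add: c_def mult.commute ennreal_times_divide)
    finally show "emeasure \<mu> B = emeasure (scale_measure c L) B" .
  qed (simp add: \<mu> sets_L)
  ultimately show ?thesis using that by blast
qed

end

section \<open>Exit laws\<close>

text \<open>Kernels are encoded by their action on functions because the Green kernels below are not finite.\<close>

definition kernel_op :: "((real \<Rightarrow> ennreal) \<Rightarrow> real \<Rightarrow> ennreal) \<Rightarrow> bool" where
  "kernel_op T \<longleftrightarrow>
     (\<forall>f\<in>borel_measurable borel. T f \<in> borel_measurable borel) \<and>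
     (\<forall>f\<in>borel_measurable borel. \<forall>g\<in>borel_measurable borel. T (\<lambda>x. f x + g x) = (\<lambda>x. T f x + T g x)) \<and>
     (\<forall>c. \<forall>f\<in>borel_measurable borel. T (\<lambda>x. c * f x) = (\<lambda>x. c * T f x)) \<and>
     (\<forall>F. (\<forall>n::nat. F n \<in> borel_measurable borel) \<longrightarrow> incseq F \<longrightarrow>
        T (\<lambda>x. SUP n. F n x) = (\<lambda>x. SUP n. T (F n) x))"

lemma
  assumes "kernel_op T"
  shows kernel_op_measurable: "f \<in> borel_measurable borel \<Longrightarrow> T f \<in> borel_measurable borel"
    and kernel_op_add: "f \<in> borel_measurable borel \<Longrightarrow> g \<in> borel_measurable borel \<Longrightarrow>
      T (\<lambda>x. f x + g x) = (\<lambda>x. T f x + T g x)"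
    and kernel_op_cmult: "f \<in> borel_measurable borel \<Longrightarrow> T (\<lambda>x. c * f x) = (\<lambda>x. c * T f x)"
    and kernel_op_SUP: "(\<And>n::nat. F n \<in> borel_measurable borel) \<Longrightarrow> incseq F \<Longrightarrow>
      T (\<lambda>x. SUP n. F n x) = (\<lambda>x. SUP n. T (F n) x)"
  using assms unfolding kernel_op_def by blast+

text \<open>Monotonicity is hidden in the continuity rule: apply it to the increasing sequence
  \<open>f, g, g, ...\<close>.\<close>

lemma kernel_op_mono:
  assumes T: "kernel_op T" and f: "f \<in> borel_measurable borel" and g: "g \<in> borel_measurable borel" and le: "f \<le> g"
  shows "T f \<le> T g"
proof -
  let ?F = "\<lambda>n::nat. if n = 0 then f else g"
  have [simp]: "(\<lambda>x. SUP n. ?F n x) = g"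
  proof
    fix x
    show "(SUP n. ?F n x) = g x"
    proof (rule antisym)
      show "(SUP n. ?F n x) \<le> g x" using le by (auto intro!: SUP_least simp: le_fun_def)
      show "g x \<le> (SUP n. ?F n x)" by (rule SUP_upper2[of 1]) auto
    qed
  qed
  have "T (\<lambda>x. SUP n. ?F n x) = (\<lambda>x. SUP n. T (?F n) x)"
    using f g le by (intro kernel_op_SUP[OF T]) (auto simp: incseq_def)
  then have "T g x = (SUP n. T (?F n) x)" for x by (simp add: fun_eq_iff)
  moreover have "T f x \<le> (SUP n. T (?F n) x)" for x
    by (rule SUP_upper2[of 0]) auto
  ultimately show ?thesis by (simp add: le_fun_def)
qed

lemma kernel_op_sum:
  assumes T: "kernel_op T" and F: "\<And>i::nat. F i \<in> borel_measurable borel"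
  shows "T (\<lambda>x. \<Sum>i<n. F i x) = (\<lambda>x. \<Sum>i<n. T (F i) x)"
proof (induction n)
  case 0
  show ?case using kernel_op_cmult[OF T, of "\<lambda>_. 0" 0] by simp
next
  case (Suc n)
  then show ?case using F by (simp add: kernel_op_add[OF T])
qed

lemma kernel_op_suminf:
  assumes T: "kernel_op T" and F: "\<And>i::nat. F i \<in> borel_measurable borel"
  shows "T (\<lambda>x. \<Sum>i. F i x) = (\<lambda>x. \<Sum>i. T (F i) x)"
proof -
  have "T (\<lambda>x. SUP n. \<Sum>i<n. F i x) = (\<lambda>x. SUP n. T (\<lambda>x. \<Sum>i<n. F i x) x)"
    using F by (intro kernel_op_SUP[OF T]) (auto intro!: monoI le_funI sum_mono2)
  then show ?thesis by (simp add: suminf_eq_SUP kernel_op_sum[OF T F])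
qed

lemma kernel_op_id: "kernel_op (\<lambda>f. f)"
  by (simp add: kernel_op_def)

lemma kernel_op_comp:
  assumes T: "kernel_op T" and S: "kernel_op S"
  shows "kernel_op (\<lambda>f. T (S f))"
  unfolding kernel_op_def
proof (intro conjI ballI allI impI)
  fix F :: "nat \<Rightarrow> real \<Rightarrow> ennreal" assume F: "\<forall>n. F n \<in> borel_measurable borel" "incseq F"
  have "incseq (\<lambda>n. S (F n))"
    using F by (auto simp: incseq_def intro!: kernel_op_mono[OF S])
  then show "T (S (\<lambda>x. SUP n. F n x)) = (\<lambda>x. SUP n. T (S (F n)) x)"
    using F by (simp add: kernel_op_SUP[OF S] kernel_op_SUP[OF T] kernel_op_measurable[OF S])
qed (simp_all add: kernel_op_measurable[OF S] kernel_op_measurable[OF T] kernel_op_add[OF S]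
  kernel_op_add[OF T] kernel_op_cmult[OF S] kernel_op_cmult[OF T])

lemma kernel_op_funpow: "kernel_op T \<Longrightarrow> kernel_op (T ^^ n)"
proof (induction n)
  case 0
  show ?case using kernel_op_id by (simp add: id_def)
next
  case (Suc n)
  then show ?case using kernel_op_comp[of T "T ^^ n"] by (simp add: comp_def)
qed

lemma kernel_op_suminf_op:
  assumes T: "\<And>n::nat. kernel_op (T n)"
  shows "kernel_op (\<lambda>f x. \<Sum>n. T n f x)"
  unfolding kernel_op_def
proof (intro conjI ballI allI impI)
  fix f :: "real \<Rightarrow> ennreal" assume "f \<in> borel_measurable borel"
  then have [measurable]: "T n f \<in> borel_measurable borel" for n by (rule kernel_op_measurable[OF T])
  show "(\<lambda>x. \<Sum>n. T n f x) \<in> borel_measurable borel" by measurable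
next
  fix F :: "nat \<Rightarrow> real \<Rightarrow> ennreal" assume F: "\<forall>n. F n \<in> borel_measurable borel" "incseq F"
  have "(\<Sum>n. SUP k. T n (F k) x) = (SUP k. \<Sum>n. T n (F k) x)" for x
  proof (rule ennreal_suminf_SUP_eq)
    show "incseq (\<lambda>k. T n (F k) x)" for n
      using F kernel_op_mono[OF T] by (auto simp: incseq_def le_fun_def)
  qed
  then show "(\<lambda>x. \<Sum>n. T n (\<lambda>x. SUP n. F n x) x) = (\<lambda>x. SUP k. \<Sum>n. T n (F k) x)"
    using F by (simp add: kernel_op_SUP[OF T])
qed (simp_all add: kernel_op_add[OF T] kernel_op_cmult[OF T] suminf_add[symmetric] ennreal_suminf_cmult)

lemma kernel_op_indicator:
  assumes "A \<in> sets borel" shows "kernel_op (\<lambda>f x. indicator A x * f x)"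
  unfolding kernel_op_def using assms by (auto simp: distrib_left ac_simps SUP_mult_left_ennreal)

text \<open>A quantitative form of "\<open>A\<close> can be entered". \<open>C\<close> is compact
  because an invariant measure is known to be finite only on compact subsets of \<open>A\<close>;
  \<open>J\<close> is open because the minimum principle and the spreading of finiteness start from
  open sets; \<open>p\<close> makes the entrance uniform over \<open>J\<close>.\<close>

definition enterable :: "real measure \<Rightarrow> real set \<Rightarrow> real set \<Rightarrow> bool" where
  "enterable D Z A \<longleftrightarrow> (\<exists>J C p. open J \<and> J \<inter> Z \<noteq> {} \<and> J \<inter> Z \<inter> A = {} \<and> compact C \<and> C \<subseteq> A \<and> 0 < p \<and>
     (\<forall>y\<in>J \<inter> Z. p \<le> step_op D (indicator C) y))"

context recurrent_law
begin

text \<open>In \<open>killed A f\<close> the step is suppressed if it ends outside \<open>A\<close>. Thus \<open>exit_op A f x\<close> is the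
  expectation, under the walk from \<open>x\<close>, of \<open>f\<close> at the first positive time spent outside \<open>A\<close>.\<close>

definition killed :: "real set \<Rightarrow> (real \<Rightarrow> ennreal) \<Rightarrow> real \<Rightarrow> ennreal" where
  "killed A f = St (\<lambda>x. indicator A x * f x)"

text \<open>The expected sum of \<open>f\<close> along the walk over the times before its first
  positive time outside \<open>A\<close>. Time 0 always counts, wherever the start lies.\<close>

definition green :: "real set \<Rightarrow> (real \<Rightarrow> ennreal) \<Rightarrow> real \<Rightarrow> ennreal" where
  "green A f x = (\<Sum>n. (killed A ^^ n) f x)"

definition exit_op :: "real set \<Rightarrow> (real \<Rightarrow> ennreal) \<Rightarrow> real \<Rightarrow> ennreal" where
  "exit_op A f = green A (killed (- A) f)"

lemma kernel_op_St: "kernel_op St"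
  unfolding kernel_op_def by (auto simp: St_add St_cmult St_SUP fun_eq_iff)

lemma kernel_op_killed: "A \<in> sets borel \<Longrightarrow> kernel_op (killed A)"
  unfolding killed_def by (rule kernel_op_comp[OF kernel_op_St kernel_op_indicator])

lemma kernel_op_green: "A \<in> sets borel \<Longrightarrow> kernel_op (green A)"
  unfolding green_def[abs_def] by (intro kernel_op_suminf_op kernel_op_funpow kernel_op_killed)

lemma kernel_op_exit: "A \<in> sets borel \<Longrightarrow> kernel_op (exit_op A)"
  unfolding exit_op_def by (intro kernel_op_comp[OF kernel_op_green kernel_op_killed]) auto

lemmas killed_measurable [measurable] = kernel_op_measurable[OF kernel_op_killed]
  and green_measurable [measurable] = kernel_op_measurable[OF kernel_op_green]
  and exit_measurable [measurable] = kernel_op_measurable[OF kernel_op_exit]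

lemma St_killed: "A \<in> sets borel \<Longrightarrow> f \<in> borel_measurable borel \<Longrightarrow> St f x = killed A f x + killed (- A) f x"
  unfolding killed_def by (rule St_if)

text \<open>For \<open>n > 0\<close> only values at points of \<open>Z\<close> inside
  \<open>A\<close> enter, whereas \<open>n = 0\<close> evaluates at the start itself; hence the last
  assumption.\<close>

lemma killed_pow_cong:
  assumes "\<And>y. y \<in> Z \<inter> A \<Longrightarrow> f y = g y" "x \<in> Z" "n = 0 \<Longrightarrow> x \<in> A"
  shows "(killed A ^^ n) f x = (killed A ^^ n) g x"
  using assms(2,3)
proof (induction n arbitrary: x)
  case 0
  then show ?case using assms(1) by simp
next
  case (Suc n)
  have "St (\<lambda>y. indicator A y * (killed A ^^ n) f y) x = St (\<lambda>y. indicator A y * (killed A ^^ n) g y) x"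
    using Suc by (intro St_cong) (auto simp: indicator_def)
  then show ?case
    by (simp add: killed_def[of A "(killed A ^^ n) f"] killed_def[of A "(killed A ^^ n) g"])
qed

lemma killed_cong: "(\<And>y. y \<in> Z \<inter> A \<Longrightarrow> f y = g y) \<Longrightarrow> x \<in> Z \<Longrightarrow> killed A f x = killed A g x"
  using killed_pow_cong[of A f g x 1] by simp

lemma green_cong: "(\<And>y. y \<in> Z \<inter> A \<Longrightarrow> f y = g y) \<Longrightarrow> x \<in> Z \<inter> A \<Longrightarrow> green A f x = green A g x"
  unfolding green_def by (intro suminf_cong killed_pow_cong) auto

lemma green_cong_Z: "(\<And>y. y \<in> Z \<Longrightarrow> f y = g y) \<Longrightarrow> x \<in> Z \<Longrightarrow> green A f x = green A g x"
proof -
  assume *: "\<And>y. y \<in> Z \<Longrightarrow> f y = g y" "x \<in> Z"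
  have "(killed A ^^ n) f x = (killed A ^^ n) g x" for n
    using * killed_pow_cong[of A f g x n] by (cases n) auto
  then show ?thesis by (simp add: green_def)
qed

lemma exit_cong: "(\<And>y. y \<in> Z - A \<Longrightarrow> f y = g y) \<Longrightarrow> x \<in> Z \<Longrightarrow> exit_op A f x = exit_op A g x"
  unfolding exit_op_def by (intro green_cong_Z killed_cong) auto

text \<open>The series is cut after its first term, and the extra step is placed at the beginning or
  at the end of the path. The second form is the one that suits occupation measures.\<close>

lemma green_unfold:
  assumes [measurable]: "A \<in> sets borel" "f \<in> borel_measurable borel"
  shows "green A f x = f x + killed A (green A f) x" "green A f x = f x + green A (killed A f) x"
proof -
  have [measurable]: "(killed A ^^ n) f \<in> borel_measurable borel" for n
    by (intro kernel_op_measurable[OF kernel_op_funpow[OF kernel_op_killed]]) auto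
  have *: "green A f x = f x + (\<Sum>n. (killed A ^^ Suc n) f x)"
    using suminf_offset[of "\<lambda>n. (killed A ^^ n) f x" 1] by (simp add: green_def add.commute)
  have "killed A (green A f) = (\<lambda>x. \<Sum>n. killed A ((killed A ^^ n) f) x)"
    unfolding green_def[abs_def] by (rule kernel_op_suminf[OF kernel_op_killed]) auto
  then show "green A f x = f x + killed A (green A f) x"
    unfolding * by simp
  show "green A f x = f x + green A (killed A f) x"
    unfolding * by (simp add: green_def[of A "killed A f"] funpow_swap1)
qed

lemma exit_unfold:
  assumes "A \<in> sets borel" "f \<in> borel_measurable borel"
  shows "exit_op A f x = killed (- A) f x + killed A (exit_op A f) x"
  unfolding exit_op_def using assms by (intro green_unfold) auto

lemma green_St:
  assumes [measurable]: "A \<in> sets borel" "f \<in> borel_measurable borel"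
  shows "green A (St f) x = green A (killed A f) x + exit_op A f x"
proof -
  have "St f = (\<lambda>x. killed A f x + killed (- A) f x)"
    by (simp add: fun_eq_iff St_killed[of A])
  then show ?thesis
    by (simp add: exit_op_def kernel_op_add[OF kernel_op_green])
qed

text \<open>Conservation of mass: the walk has left \<open>A\<close> at one of the times 1 to
  \<open>n\<close>, or it has survived \<open>n\<close> steps.\<close>

lemma exit_sum:
  assumes [measurable]: "A \<in> sets borel"
  shows "(\<Sum>k<n. (killed A ^^ k) (killed (- A) (\<lambda>_. 1)) x) + (killed A ^^ n) (\<lambda>_. 1) x = 1"
proof (induction n)
  case (Suc n)
  have "(\<lambda>_. 1) = (\<lambda>x. killed A (\<lambda>_. 1) x + killed (- A) (\<lambda>_. 1) x)"
    using St_killed[of A "\<lambda>_. 1"] by (simp add: St_const fun_eq_iff)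
  then have "(killed A ^^ n) (\<lambda>_. 1) x = (killed A ^^ n) (\<lambda>x. killed A (\<lambda>_. 1) x + killed (- A) (\<lambda>_. 1) x) x"
    by simp
  also have "\<dots> = (killed A ^^ Suc n) (\<lambda>_. 1) x + (killed A ^^ n) (killed (- A) (\<lambda>_. 1)) x"
    by (subst kernel_op_add[OF kernel_op_funpow[OF kernel_op_killed]]) (auto simp: funpow_swap1)
  finally show ?case using Suc by (simp add: ac_simps)
qed simp

lemma exit_le_1: "A \<in> sets borel \<Longrightarrow> exit_op A (\<lambda>_. 1) x \<le> 1"
proof -
  assume A: "A \<in> sets borel"
  have "(\<Sum>k<n. (killed A ^^ k) (killed (- A) (\<lambda>_. 1)) x) \<le> 1" for n
    by (subst exit_sum[OF A, symmetric, of x n]) simp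
  then show ?thesis
    unfolding exit_op_def green_def suminf_eq_SUP by (rule SUP_least)
qed

text \<open>The exit probability inside \<open>A\<close>, continued by 1 outside, is superharmonic
  and equals 1 on \<open>G\<close>, so the minimum principle makes it 1 on \<open>Z\<close>.\<close>

lemma exit_1:
  assumes A [measurable]: "A \<in> sets borel" and G: "open G" "G \<inter> Z \<noteq> {}" "G \<inter> Z \<inter> A = {}" and x: "x \<in> Z"
  shows "exit_op A (\<lambda>_. 1) x = 1"
proof (rule antisym)
  show "exit_op A (\<lambda>_. 1) x \<le> 1" by (rule exit_le_1[OF A])
  let ?g = "\<lambda>x. indicator A x * exit_op A (\<lambda>_. 1) x + indicator (- A) x * 1"
  have St_g: "St ?g x = exit_op A (\<lambda>_. 1) x" for x
    by (subst St_add) (auto simp: exit_unfold[OF A, of "\<lambda>_. 1" x] killed_def)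
  have "1 \<le> ?g y" if "y \<in> Z" for y
  proof (rule minimum_principle[OF _ G(1,2) _ _ that])
    show "St ?g y \<le> ?g y" for y
      unfolding St_g using exit_le_1[OF A] by (cases "y \<in> A") auto
    show "1 \<le> ?g y" if "y \<in> G \<inter> Z" for y
    proof -
      have "y \<notin> A" using that G by blast
      then show ?thesis by simp
    qed
  qed auto
  then have "St (\<lambda>_. 1) x \<le> St ?g x" by (rule St_mono[OF x])
  then show "1 \<le> exit_op A (\<lambda>_. 1) x" unfolding St_g St_const .
qed

text \<open>Two bounded solutions of the first-step equation differ at most by the mass that survives \<open>n\<close> steps
  in \<open>A\<close>, which vanishes as \<open>n\<close> grows.\<close>

lemma exit_unique:
  assumes A [measurable]: "A \<in> sets borel" and G: "open G" "G \<inter> Z \<noteq> {}" "G \<inter> Z \<inter> A = {}"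
    and [measurable]: "F \<in> borel_measurable borel" "g \<in> borel_measurable borel"
    and F_le: "\<And>x. F x \<le> 1"
    and F: "\<And>x. x \<in> Z \<inter> A \<Longrightarrow> F x = killed (- A) g x + killed A F x"
    and x: "x \<in> Z \<inter> A"
  shows "F x = exit_op A g x"
proof -
  note T = kernel_op_funpow[OF kernel_op_killed[OF A]]
  have eq: "F x = (\<Sum>k<n. (killed A ^^ k) (killed (- A) g) x) + (killed A ^^ n) F x" for n
  proof (induction n)
    case (Suc n)
    have "(killed A ^^ n) F x = (killed A ^^ n) (\<lambda>x. killed (- A) g x + killed A F x) x"
      using x F by (intro killed_pow_cong) auto
    also have "\<dots> = (killed A ^^ n) (killed (- A) g) x + (killed A ^^ Suc n) F x"
      by (subst kernel_op_add[OF T]) (auto simp: funpow_swap1)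
    finally show ?case using Suc by (simp add: ac_simps)
  qed simp
  have lim: "(\<lambda>n. \<Sum>k<n. (killed A ^^ k) f x) \<longlonglongrightarrow> green A f x" for f
    unfolding green_def by (intro summable_LIMSEQ) simp
  have one: "1 - (\<Sum>k<n. (killed A ^^ k) (killed (- A) (\<lambda>_. 1)) x) = (killed A ^^ n) (\<lambda>_. 1) x" for n
  proof -
    have "(\<Sum>k<n. (killed A ^^ k) (killed (- A) (\<lambda>_. 1)) x) \<noteq> \<top>"
      using exit_sum[OF A, of x n] by (metis ennreal_add_eq_top ennreal_one_neq_top)
    then show ?thesis
      using exit_sum[OF A, of x n] by (metis ennreal_add_diff_cancel_left infinity_ennreal_def)
  qed
  have "(\<lambda>n. 1 - (\<Sum>k<n. (killed A ^^ k) (killed (- A) (\<lambda>_. 1)) x)) \<longlonglongrightarrow> 1 - exit_op A (\<lambda>_. 1) x"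
    unfolding exit_op_def by (rule tendsto_diff_ennreal_general[OF tendsto_const lim]) simp
  then have l1: "(\<lambda>n. (killed A ^^ n) (\<lambda>_. 1) x) \<longlonglongrightarrow> 0"
    unfolding one using exit_1[OF A G, of x] x by simp
  have l2: "(killed A ^^ n) F x \<le> (killed A ^^ n) (\<lambda>_. 1) x" for n
    using kernel_op_mono[OF T, of F "\<lambda>_. 1" n] F_le by (auto simp: le_fun_def)
  have "(\<lambda>n. (killed A ^^ n) F x) \<longlonglongrightarrow> 0"
    by (rule tendsto_sandwich[OF _ _ tendsto_const l1]) (simp_all add: l2)
  then have "(\<lambda>n. (\<Sum>k<n. (killed A ^^ k) (killed (- A) g) x) + (killed A ^^ n) F x) \<longlonglongrightarrow> exit_op A g x + 0"
    unfolding exit_op_def by (intro tendsto_add lim)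
  then show ?thesis
    unfolding eq[symmetric] by (simp add: LIMSEQ_const_iff)
qed

text \<open>Think of \<open>w\<close> as the probability that the walk never enters \<open>C\<close> from outside \<open>A\<close>; \<open>W\<close> extends \<open>w\<close> to all starting points, and \<open>sup W - W\<close> is
  superharmonic.\<close>

lemma entrance_no_escape:
  assumes A [measurable]: "A \<in> sets borel" and C [measurable]: "C \<in> sets borel" and CA: "C \<subseteq> A"
    and J: "open J" "J \<inter> Z \<noteq> {}" "J \<inter> Z \<inter> A = {}"
    and p: "0 < p" "\<And>y. y \<in> J \<inter> Z \<Longrightarrow> p \<le> St (indicator C) y"
    and w [measurable]: "w \<in> borel_measurable borel" and w_le: "\<And>x. w x \<le> 1"
    and w_sub: "\<And>x. x \<in> Z \<inter> A \<Longrightarrow> w x \<le> exit_op A (exit_op (- A) (\<lambda>x. indicator (- C) x * w x)) x"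
    and x: "x \<in> Z \<inter> A"
  shows "w x = 0"
proof -
  let ?w = "\<lambda>x. indicator (- C) x * w x"
  let ?u = "exit_op (- A) ?w"
  define W where "W = (\<lambda>x. indicator A x * exit_op A ?u x + indicator (- A) x * ?u x)"
  have W_meas [measurable]: "W \<in> borel_measurable borel" unfolding W_def by measurable
  have u_le: "exit_op B f x \<le> 1" if "B \<in> sets borel" "f \<in> borel_measurable borel" "\<And>x. f x \<le> 1" for B f x
    using kernel_op_mono[OF kernel_op_exit, of B f "\<lambda>_. 1"] exit_le_1[of B x] that
    by (auto simp: le_fun_def intro: order_trans)
  have w_le': "?w x \<le> 1" for x using w_le by (auto simp: indicator_def)
  have W_le: "W x \<le> 1" for x
    unfolding W_def using u_le w_le' by (cases "x \<in> A") auto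
  have St_W: "St W x = killed A (exit_op A ?u) x + killed (- A) ?u x" for x
    unfolding W_def killed_def by (rule St_add) auto
  have WA: "W x = St W x" if "x \<in> A" for x
    unfolding St_W using that exit_unfold[OF A, of ?u x] by (simp add: W_def add.commute)
  have WB: "W x = killed A ?w x + killed (- A) ?u x" if "x \<notin> A" for x
    using that exit_unfold[of "- A" ?w x] by (simp add: W_def)
  \<comment> \<open>On \<open>A\<close> the function is harmonic. Off \<open>A\<close>, a step that
    enters \<open>A\<close> is valued by \<open>w\<close> with \<open>C\<close> discarded, and by
    the assumption on \<open>w\<close> this is at most \<open>W\<close> there.\<close>
  have W_sub: "W x \<le> St W x" if x: "x \<in> Z" for x
  proof (cases "x \<in> A")
    case False
    have "killed A ?w x \<le> killed A (exit_op A ?u) x"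
      unfolding killed_def
    proof (rule St_mono[OF x])
      fix y assume "y \<in> Z"
      then show "indicator A y * ?w y \<le> indicator A y * exit_op A ?u y"
        using w_sub[of y] by (auto simp: indicator_def)
    qed
    then show ?thesis
      using WB[OF False] St_W[of x] by simp
  qed (simp add: WA)
  define s where "s = (SUP x\<in>Z. W x)"
  have s_le: "s \<le> 1" unfolding s_def using W_le by (rule SUP_least)
  have W_s: "W x \<le> s" if "x \<in> Z" for x unfolding s_def using that by (rule SUP_upper)
  have s_fin: "s \<noteq> \<top>" using s_le by (auto simp: top_unique)
  \<comment> \<open>A step from \<open>J\<close> enters \<open>C\<close>, where the value is lost,
    with probability at least \<open>p\<close>; elsewhere \<open>s\<close> is the bound. The minimum
    principle extends the deficit \<open>s * p\<close> from \<open>J\<close> to all of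
    \<open>Z\<close>.\<close>
  have super: "s * p \<le> s - W x" if x: "x \<in> Z" for x
  proof (rule minimum_principle[OF _ J(1,2) _ _ x])
    show "St (\<lambda>x. s - W x) x \<le> s - W x" if x: "x \<in> Z" for x
    proof -
      have "W x + St (\<lambda>x. s - W x) x \<le> St W x + St (\<lambda>x. s - W x) x"
        by (intro add_right_mono W_sub x)
      also have "\<dots> = St (\<lambda>x. W x + (s - W x)) x"
        by (rule St_add[symmetric]) auto
      also have "\<dots> = s"
      proof -
        have "St (\<lambda>x. W x + (s - W x)) x = St (\<lambda>_. s) x"
          by (rule St_cong[OF x]) (simp add: W_s add_diff_inverse_ennreal)
        then show ?thesis by (simp add: St_const)
      qed
      finally show ?thesis
        by (simp add: ennreal_le_minus_iff add.commute)
    qed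
    show "s * p \<le> s - W x" if x: "x \<in> J \<inter> Z" for x
    proof -
      have "x \<notin> A" "x \<in> Z" using x J by auto
      have "W x \<le> St (\<lambda>y. s * indicator (- C) y) x"
      proof -
        have "W x = St (\<lambda>y. indicator A y * ?w y + indicator (- A) y * ?u y) x"
          unfolding WB[OF \<open>x \<notin> A\<close>] killed_def by (rule St_add[symmetric]) auto
        also have "\<dots> \<le> St (\<lambda>y. s * indicator (- C) y) x"
        proof (rule St_mono[OF \<open>x \<in> Z\<close>])
          fix y assume y: "y \<in> Z"
          have "w y \<le> s" if "y \<in> A"
            using w_sub[of y] W_s[OF y] that y by (auto simp: W_def intro: order_trans)
          moreover have "?u y \<le> s" if "y \<notin> A"
            using W_s[OF y] that by (simp add: W_def)
          ultimately show "indicator A y * ?w y + indicator (- A) y * ?u y \<le> s * indicator (- C) y"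
            using CA by (auto simp: indicator_def)
        qed
        finally show ?thesis .
      qed
      then have "s * p + W x \<le> s * St (indicator C) x + St (\<lambda>y. s * indicator (- C) y) x"
        using p(2)[OF x] by (intro add_mono mult_left_mono) auto
      also have "\<dots> = St (\<lambda>y. s * indicator C y + s * indicator (- C) y) x"
        by (subst St_add) (auto simp: St_cmult)
      also have "\<dots> = St (\<lambda>_. s) x"
        by (rule arg_cong[where f="\<lambda>f. St f x"]) (auto simp: indicator_def)
      finally show ?thesis
        by (simp add: ennreal_le_minus_iff St_const)
    qed
  qed auto
  have "W x \<le> s - s * p" if x: "x \<in> Z" for x
    using super[OF x] W_s[OF x] by (auto simp: ennreal_le_minus_iff add.commute)
  \<comment> \<open>Taking the supremum leaves \<open>s\<close> no larger than
    \<open>s - s * p\<close>; since \<open>s\<close> is finite, \<open>s * p\<close> vanishes and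
    with it \<open>s\<close>.\<close>
  then have "s \<le> s - s * p"
    by (subst (1) s_def) (rule SUP_least)
  then have "s + s * p \<le> s + 0 \<or> s = 0"
    by (auto simp: ennreal_le_minus_iff)
  then have "s * p = 0"
    using s_fin by (auto simp only: ennreal_add_left_cancel_le infinity_ennreal_def le_zero_eq mult_zero_left)
  then have "s = 0" using p by auto
  then show "w x = 0"
    using w_sub[OF x] W_s[of x] x by (simp add: W_def)
qed

end

lemma kernel_op_plus:
  assumes T: "kernel_op T" and S: "kernel_op S"
  shows "kernel_op (\<lambda>f x. T f x + S f x)"
  unfolding kernel_op_def
proof (intro conjI ballI allI impI)
  fix F :: "nat \<Rightarrow> real \<Rightarrow> ennreal" assume F: "\<forall>n. F n \<in> borel_measurable borel" "incseq F"
  have "incseq (\<lambda>n. T (F n) x)" "incseq (\<lambda>n. S (F n) x)" for x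
    using F kernel_op_mono[OF T] kernel_op_mono[OF S] by (auto simp: incseq_def le_fun_def)
  then show "(\<lambda>x. T (\<lambda>x. SUP n. F n x) x + S (\<lambda>x. SUP n. F n x) x) = (\<lambda>x. SUP n. T (F n) x + S (F n) x)"
    using F by (simp add: kernel_op_SUP[OF T] kernel_op_SUP[OF S] ennreal_SUP_add)
qed (simp_all add: kernel_op_measurable[OF S] kernel_op_measurable[OF T] borel_measurable_add kernel_op_add[OF S]
  kernel_op_add[OF T] kernel_op_cmult[OF S] kernel_op_cmult[OF T] ac_simps distrib_left)

text \<open>The action of a kernel on measures, recovered from its action on functions. No
  finiteness of \<open>\<nu>\<close> or of the kernel is assumed, so occupation measures are
  covered.\<close>

lemma kernel_op_push_measure:
  assumes T: "kernel_op T" and \<nu>: "sets \<nu> = sets borel"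
  obtains \<mu> where "sets \<mu> = sets borel" "\<And>f. f \<in> borel_measurable borel \<Longrightarrow> (\<integral>\<^sup>+x. f x \<partial>\<mu>) = (\<integral>\<^sup>+x. T f x \<partial>\<nu>)"
proof -
  have meas: "T f \<in> borel_measurable \<nu>" if "f \<in> borel_measurable borel" for f
    using kernel_op_measurable[OF T that] by (simp add: measurable_cong_sets[OF \<nu> refl])
  show ?thesis
  proof (rule exists_measure_of_functional[of "\<lambda>f. \<integral>\<^sup>+x. T f x \<partial>\<nu>"])
    fix F :: "nat \<Rightarrow> real \<Rightarrow> ennreal" assume F: "\<And>n. F n \<in> borel_measurable borel" "incseq F"
    have "incseq (\<lambda>n. T (F n))"
      using F kernel_op_mono[OF T] by (auto simp: incseq_def)
    then show "(\<integral>\<^sup>+x. T (\<lambda>x. SUP n. F n x) x \<partial>\<nu>) = (SUP n. \<integral>\<^sup>+x. T (F n) x \<partial>\<nu>)"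
      using F meas by (simp add: kernel_op_SUP[OF T] nn_integral_monotone_convergence_SUP)
  qed (use meas that in \<open>simp_all add: kernel_op_add[OF T] kernel_op_cmult[OF T] nn_integral_add nn_integral_cmult\<close>)
qed

section \<open>Entrance flows and time reversal\<close>

locale two_sided_law = recurrent_law D Z L + dual: recurrent_law "distr D borel uminus" Z L for D Z L
begin

lemma dual_St: "f \<in> borel_measurable borel \<Longrightarrow> dual.St f x = (\<integral>\<^sup>+y. f (x - y) \<partial>D)"
  unfolding step_op_def by (subst nn_integral_distr) auto

text \<open>Fubini, followed by a translation of \<open>L\<close> by the step, which lies in
  \<open>Z\<close> almost surely: the reversed walk is the adjoint with respect to
  \<open>L\<close>.\<close>

lemma St_duality:
  assumes [measurable]: "f \<in> borel_measurable borel" "g \<in> borel_measurable borel"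
  shows "(\<integral>\<^sup>+x. f x * St g x \<partial>L) = (\<integral>\<^sup>+x. dual.St f x * g x \<partial>L)"
proof -
  interpret P: pair_sigma_finite L D ..
  have "(\<integral>\<^sup>+x. f x * St g x \<partial>L) = (\<integral>\<^sup>+x. \<integral>\<^sup>+y. f x * g (x + y) \<partial>D \<partial>L)"
    unfolding step_op_def by (intro nn_integral_cong nn_integral_cmult[symmetric]) measurable
  also have "\<dots> = (\<integral>\<^sup>+y. \<integral>\<^sup>+x. f x * g (x + y) \<partial>L \<partial>D)"
    by (rule P.Fubini'[symmetric]) measurable
  also have "\<dots> = (\<integral>\<^sup>+y. \<integral>\<^sup>+x. f (x - y) * g x \<partial>L \<partial>D)"
  proof (rule nn_integral_cong_AE)
    have "(\<integral>\<^sup>+x. f x * g (x + y) \<partial>L) = (\<integral>\<^sup>+x. f (x - y) * g x \<partial>L)" if "y \<in> Z" for y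
      using nn_integral_L_plus[of "\<lambda>x. f (x - y) * g x" y] that by simp
    then show "AE y in D. (\<integral>\<^sup>+x. f x * g (x + y) \<partial>L) = (\<integral>\<^sup>+x. f (x - y) * g x \<partial>L)"
      using D_Z by auto
  qed
  also have "\<dots> = (\<integral>\<^sup>+x. \<integral>\<^sup>+y. f (x - y) * g x \<partial>D \<partial>L)"
    by (rule P.Fubini') measurable
  also have "\<dots> = (\<integral>\<^sup>+x. dual.St f x * g x \<partial>L)"
    by (intro nn_integral_cong) (simp add: dual_St nn_integral_multc)
  finally show ?thesis .
qed

text \<open>The stationary flow of the walk from the complement of \<open>A\<close> into \<open>A\<close>, as a measure on \<open>A\<close>.\<close>

definition entrance :: "real set \<Rightarrow> real measure" where
  "entrance A = density L (\<lambda>x. indicator A x * dual.St (indicator (- A)) x)"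

lemma sets_entrance [measurable_cong]: "sets (entrance A) = sets borel"
  by (simp add: entrance_def sets_L)

lemma nn_integral_entrance:
  assumes [measurable]: "A \<in> sets borel" "f \<in> borel_measurable borel"
  shows "(\<integral>\<^sup>+x. f x \<partial>entrance A) = (\<integral>\<^sup>+x. indicator A x * dual.St (indicator (- A)) x * f x \<partial>L)"
  unfolding entrance_def by (subst nn_integral_density) auto

lemma AE_entrance:
  assumes "A \<in> sets borel" and "AE x in L. x \<in> A \<longrightarrow> P x"
  shows "AE x in entrance A. P x"
  unfolding entrance_def using assms
  by (subst AE_density) (auto elim!: eventually_mono simp: indicator_def split: if_splits)

text \<open>\<open>St_duality\<close> moves the step from the density to \<open>f\<close>. The
  right-hand form does not mention the reversed walk, so it can be read with another measure in
  place of \<open>L\<close>.\<close>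

lemma entrance_eq_flow:
  assumes [measurable]: "A \<in> sets borel" "f \<in> borel_measurable borel"
  shows "(\<integral>\<^sup>+x. f x \<partial>entrance A) = (\<integral>\<^sup>+x. indicator (- A) x * killed A f x \<partial>L)"
proof -
  have "(\<integral>\<^sup>+x. indicator (- A) x * killed A f x \<partial>L) = (\<integral>\<^sup>+x. dual.St (indicator (- A)) x * (indicator A x * f x) \<partial>L)"
    unfolding killed_def by (rule St_duality) auto
  also have "\<dots> = (\<integral>\<^sup>+x. f x \<partial>entrance A)"
    by (subst nn_integral_entrance) (auto intro!: nn_integral_cong simp: ac_simps)
  finally show ?thesis ..
qed

text \<open>\<open>St_duality\<close> iterated along paths confined to \<open>A\<close>;
  \<open>w\<close> is generalised because each use moves one step across to it.\<close>

lemma killed_duality: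
  assumes [measurable]: "A \<in> sets borel" "u \<in> borel_measurable borel"
  shows "w \<in> borel_measurable borel \<Longrightarrow> (\<integral>\<^sup>+x. indicator A x * w x * (killed A ^^ n) u x \<partial>L) =
    (\<integral>\<^sup>+x. indicator A x * u x * (dual.killed A ^^ n) w x \<partial>L)"
proof (induction n arbitrary: w)
  case 0
  show ?case by (simp add: ac_simps)
next
  case (Suc n)
  note [measurable] = Suc.prems
    and [measurable] = kernel_op_measurable[OF kernel_op_funpow[OF kernel_op_killed]]
  have "(\<integral>\<^sup>+x. indicator A x * w x * (killed A ^^ Suc n) u x \<partial>L) =
      (\<integral>\<^sup>+x. (indicator A x * w x) * St (\<lambda>x. indicator A x * (killed A ^^ n) u x) x \<partial>L)"
    by (simp add: killed_def[of A "(killed A ^^ n) u"])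
  also have "\<dots> = (\<integral>\<^sup>+x. dual.killed A w x * (indicator A x * (killed A ^^ n) u x) \<partial>L)"
    unfolding dual.killed_def by (rule St_duality) measurable
  also have "\<dots> = (\<integral>\<^sup>+x. indicator A x * dual.killed A w x * (killed A ^^ n) u x \<partial>L)"
    by (simp add: ac_simps)
  also have "\<dots> = (\<integral>\<^sup>+x. indicator A x * u x * (dual.killed A ^^ n) (dual.killed A w) x \<partial>L)"
    by (rule Suc.IH) measurable
  finally show ?case by (simp add: funpow_swap1)
qed

text \<open>By reversing time, the invariance of the flow reduces to the fact that the reversed walk leaves
  \<open>A\<close> almost surely.\<close>

lemma entrance_exit:
  assumes A [measurable]: "A \<in> sets borel" and [measurable]: "f \<in> borel_measurable borel"
    and G: "open G" "G \<inter> Z \<noteq> {}" "G \<inter> Z \<inter> A = {}"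
  shows "(\<integral>\<^sup>+x. exit_op A f x \<partial>entrance A) = (\<integral>\<^sup>+x. f x \<partial>entrance (- A))"
proof -
  let ?u = "killed (- A) f" and ?v = "dual.St (indicator (- A))"
  note [measurable] = kernel_op_measurable[OF kernel_op_funpow[OF kernel_op_killed]]
    kernel_op_measurable[OF kernel_op_funpow[OF dual.kernel_op_killed]]
  have "(\<integral>\<^sup>+x. exit_op A f x \<partial>entrance A) = (\<integral>\<^sup>+x. (\<Sum>n. indicator A x * ?v x * (killed A ^^ n) ?u x) \<partial>L)"
    by (subst nn_integral_entrance) (auto simp: exit_op_def green_def intro!: nn_integral_cong)
  also have "\<dots> = (\<Sum>n. \<integral>\<^sup>+x. indicator A x * ?v x * (killed A ^^ n) ?u x \<partial>L)"
    by (rule nn_integral_suminf) measurable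
  also have "\<dots> = (\<Sum>n. \<integral>\<^sup>+x. indicator A x * ?u x * (dual.killed A ^^ n) ?v x \<partial>L)"
    by (intro suminf_cong killed_duality) auto
  also have "\<dots> = (\<integral>\<^sup>+x. (\<Sum>n. indicator A x * ?u x * (dual.killed A ^^ n) ?v x) \<partial>L)"
    by (rule nn_integral_suminf[symmetric]) measurable
  \<comment> \<open>Summed over their length, the reversed paths that stay in \<open>A\<close> and
    then leave make up the reversed exit probability.\<close>
  also have "\<dots> = (\<integral>\<^sup>+x. indicator A x * ?u x * dual.exit_op A (\<lambda>_. 1) x \<partial>L)"
    by (intro nn_integral_cong) (simp add: dual.exit_op_def dual.green_def dual.killed_def[of "- A"])
  also have "\<dots> = (\<integral>\<^sup>+x. indicator A x * ?u x \<partial>L)"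
    using L_Z dual.exit_1[OF A G] by (intro nn_integral_cong_AE) auto
  also have "\<dots> = (\<integral>\<^sup>+x. f x \<partial>entrance (- A))"
    by (subst entrance_eq_flow) auto
  finally show ?thesis .
qed

lemma entrance_cycle:
  assumes A [measurable]: "A \<in> sets borel" and [measurable]: "f \<in> borel_measurable borel"
    and G: "open G" "G \<inter> Z \<noteq> {}" "G \<inter> Z \<inter> A = {}" and G': "open G'" "G' \<inter> Z \<noteq> {}" "G' \<inter> Z \<subseteq> A"
  shows "(\<integral>\<^sup>+x. exit_op A (exit_op (- A) f) x \<partial>entrance A) = (\<integral>\<^sup>+x. f x \<partial>entrance A)"
proof -
  have "G' \<inter> Z \<inter> - A = {}" using G' by auto
  then show ?thesis
    using entrance_exit[OF A _ G, of "exit_op (- A) f"] entrance_exit[of "- A" f G'] G' by simp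
qed

text \<open>An invariant measure of the entrance chain is the flow into \<open>A\<close> of its occupation measure over
  one cycle, which is invariant for the walk.\<close>

lemma entrance_unique:
  assumes A [measurable]: "A \<in> sets borel" and "enterable D Z A"
    and \<nu>: "sets \<nu> = sets borel" and \<nu>_ZA: "AE x in \<nu>. x \<in> Z \<inter> A"
    and fin: "\<And>C. compact C \<Longrightarrow> C \<subseteq> A \<Longrightarrow> emeasure \<nu> C < \<infinity>"
    and inv: "\<And>f. f \<in> borel_measurable borel \<Longrightarrow>
      (\<integral>\<^sup>+x. exit_op A (exit_op (- A) f) x \<partial>\<nu>) = (\<integral>\<^sup>+x. f x \<partial>\<nu>)"
  obtains c where "c < \<infinity>" "\<nu> = scale_measure c (entrance A)"
proof -
  have [measurable_cong]: "sets \<nu> = sets borel" by (rule \<nu>)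
  \<comment> \<open>Occupation over one cycle from a point of \<open>A\<close>: the time in
    \<open>A\<close> until the first exit, then the time outside until the return.\<close>
  let ?T = "\<lambda>f x. green A f x + exit_op A (green (- A) f) x"
  have "kernel_op ?T"
    by (intro kernel_op_plus kernel_op_comp[OF kernel_op_exit kernel_op_green] kernel_op_green) auto
  then obtain \<mu> where \<mu>: "sets \<mu> = sets borel"
    and int: "\<And>f. f \<in> borel_measurable borel \<Longrightarrow> (\<integral>\<^sup>+x. f x \<partial>\<mu>) = (\<integral>\<^sup>+x. ?T f x \<partial>\<nu>)"
    using \<nu> by (rule kernel_op_push_measure) blast
  have \<mu>_inv: "(\<integral>\<^sup>+x. St f x \<partial>\<mu>) = (\<integral>\<^sup>+x. f x \<partial>\<mu>)" if [measurable]: "f \<in> borel_measurable borel" for f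
  proof -
    \<comment> \<open>A step moves the cycle by one unit of time: its starting point is lost and the
      first point of the next cycle, with law given by \<open>?V\<close>, is gained. By
      \<open>inv\<close> the two balance under \<open>\<nu>\<close>.\<close>
    let ?V = "exit_op A (exit_op (- A) f)" and ?V' = "exit_op A (green (- A) (killed (- A) f))"
    have "exit_op A (green (- A) (St f)) x = ?V' x + ?V x" for x
    proof -
      have "green (- A) (St f) = (\<lambda>x. green (- A) (killed (- A) f) x + exit_op (- A) f x)"
        by (simp add: fun_eq_iff green_St)
      then show ?thesis by (simp add: kernel_op_add[OF kernel_op_exit])
    qed
    then have "(\<integral>\<^sup>+x. St f x \<partial>\<mu>) = (\<integral>\<^sup>+x. (green A (killed A f) x + exit_op A f x + ?V' x) + ?V x \<partial>\<nu>)"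
      by (subst int) (auto simp: green_St ac_simps)
    also have "\<dots> = (\<integral>\<^sup>+x. green A (killed A f) x + exit_op A f x + ?V' x \<partial>\<nu>) + (\<integral>\<^sup>+x. f x \<partial>\<nu>)"
      by (subst nn_integral_add) (auto simp: inv)
    also have "\<dots> = (\<integral>\<^sup>+x. (green A (killed A f) x + exit_op A f x + ?V' x) + f x \<partial>\<nu>)"
      by (subst nn_integral_add) auto
    also have "\<dots> = (\<integral>\<^sup>+x. ?T f x \<partial>\<nu>)"
    proof (rule nn_integral_cong)
      fix x
      have "green (- A) f = (\<lambda>x. f x + green (- A) (killed (- A) f) x)"
        by (rule ext, rule green_unfold(2)) auto
      then have "exit_op A (green (- A) f) x = exit_op A f x + ?V' x"
        by (simp add: kernel_op_add[OF kernel_op_exit])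
      then show "green A (killed A f) x + exit_op A f x + ?V' x + f x = ?T f x"
        using green_unfold(2)[OF A that, of x] by (simp add: ac_simps)
    qed
    finally show ?thesis by (simp add: int)
  qed
  have \<mu>_Z: "AE x in \<mu>. x \<in> Z"
  proof -
    have "?T (indicator (- Z)) x = 0" if "x \<in> Z" for x
    proof -
      have g0: "green B (indicator (- Z)) y = 0" if "y \<in> Z" "B \<in> sets borel" for B y
        using green_cong_Z[of "indicator (- Z)" "\<lambda>_. 0" y B] that
          kernel_op_cmult[OF kernel_op_green, of B "\<lambda>_. 0" 0] by (simp add: fun_eq_iff)
      have "exit_op A (green (- A) (indicator (- Z))) x = exit_op A (\<lambda>_. 0) x"
        by (rule exit_cong) (auto simp: g0 that)
      then show ?thesis
        using g0[OF that A] kernel_op_cmult[OF kernel_op_exit, of A "\<lambda>_. 0" 0] by (simp add: fun_eq_iff)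
    qed
    then have "emeasure \<mu> (- Z) = 0"
      using int[of "indicator (- Z)"] \<nu>_ZA
      by (simp add: \<mu> nn_integral_0_iff_AE) (auto elim!: eventually_mono)
    then show ?thesis
      by (intro AE_I[of _ _ "- Z"]) (auto simp: \<mu>)
  qed
  \<comment> \<open>The integrand vanishes on \<open>A\<close>, so only the part of the cycle
    outside \<open>A\<close> counts. The steps from there into \<open>A\<close> add up to the return
    law, which \<open>inv\<close> turns back into \<open>\<nu>\<close>.\<close>
  have flow: "(\<integral>\<^sup>+x. indicator (- A) x * killed A f x \<partial>\<mu>) = (\<integral>\<^sup>+x. f x \<partial>\<nu>)"
    if [measurable]: "f \<in> borel_measurable borel" for f
  proof -
    let ?u = "\<lambda>x. indicator (- A) x * killed A f x"
    have "?T ?u x = exit_op A (exit_op (- A) f) x" if x: "x \<in> Z \<inter> A" for x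
    proof -
      have "green A ?u x = green A (\<lambda>_. 0) x"
        using x by (intro green_cong) auto
      also have "\<dots> = 0"
        using kernel_op_cmult[OF kernel_op_green, of A "\<lambda>_. 0" 0] by (simp add: fun_eq_iff)
      finally have "green A ?u x = 0" .
      moreover have "exit_op A (green (- A) ?u) x = exit_op A (exit_op (- A) f) x"
      proof (rule exit_cong)
        fix y assume "y \<in> Z - A"
        then show "green (- A) ?u y = exit_op (- A) f y"
          unfolding exit_op_def by (intro green_cong) auto
      qed (use x in auto)
      ultimately show ?thesis by simp
    qed
    then have "AE x in \<nu>. ?T ?u x = exit_op A (exit_op (- A) f) x"
      using \<nu>_ZA by (rule eventually_mono[rotated])
    then have "(\<integral>\<^sup>+x. ?T ?u x \<partial>\<nu>) = (\<integral>\<^sup>+x. exit_op A (exit_op (- A) f) x \<partial>\<nu>)"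
      by (rule nn_integral_cong_AE)
    then show ?thesis
      by (subst int) (auto simp: inv)
  qed
  obtain J C p where J: "open J" "J \<inter> Z \<noteq> {}" "J \<inter> Z \<inter> A = {}" and C: "compact C" "C \<subseteq> A"
    and p: "0 < p" "\<And>y. y \<in> J \<inter> Z \<Longrightarrow> p \<le> St (indicator C) y"
    using \<open>enterable D Z A\<close> unfolding enterable_def by blast
  have [measurable]: "J \<in> sets borel" "C \<in> sets borel"
    using J C by (auto intro: borel_compact)
  \<comment> \<open>The flow of \<open>\<mu>\<close> into the compact set \<open>C\<close> is the
    finite mass of \<open>C\<close> under \<open>\<nu>\<close>, and each point of \<open>J\<close>
    contributes at least \<open>p\<close> to it; so \<open>J\<close> has finite occupation
    mass.\<close>
  have "p * emeasure \<mu> J = (\<integral>\<^sup>+x. p * indicator J x \<partial>\<mu>)"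
    by (subst nn_integral_cmult_indicator) (auto simp: \<mu>)
  also have "\<dots> \<le> (\<integral>\<^sup>+x. indicator (- A) x * killed A (indicator C) x \<partial>\<mu>)"
  proof (rule nn_integral_mono_AE)
    have "(\<lambda>x. indicator A x * indicator C x) = (indicator C :: real \<Rightarrow> ennreal)"
      using C by (auto simp: fun_eq_iff indicator_def)
    then have k: "killed A (indicator C) = St (indicator C)" by (simp add: killed_def)
    have "p * indicator J x \<le> indicator (- A) x * killed A (indicator C) x" if "x \<in> Z" for x
      using J p(2)[of x] that unfolding k by (auto simp: indicator_def)
    then show "AE x in \<mu>. p * indicator J x \<le> indicator (- A) x * killed A (indicator C) x"
      using \<mu>_Z by auto
  qed
  also have "\<dots> = emeasure \<nu> C"
    by (subst flow) (auto simp: \<nu>)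
  also have "\<dots> < \<infinity>" by (rule fin[OF C])
  finally have "emeasure \<mu> J < \<infinity>"
    using p by (auto simp: ennreal_mult_less_top)
  note locally_finite[OF \<mu> \<mu>_inv \<mu>_Z J(1,2) this]
  then obtain c where c: "c < \<infinity>" "\<mu> = scale_measure c L"
    using unique_invariant[OF \<mu> \<mu>_inv \<mu>_Z] by blast
  have "\<nu> = scale_measure c (entrance A)"
  proof (rule measure_eqI)
    fix B assume "B \<in> sets \<nu>"
    then have B [measurable]: "B \<in> sets borel" by (simp add: \<nu>)
    have "emeasure \<nu> B = (\<integral>\<^sup>+x. indicator (- A) x * killed A (indicator B) x \<partial>\<mu>)"
      by (subst flow) (auto simp: \<nu>)
    also have "\<dots> = c * (\<integral>\<^sup>+x. indicator (- A) x * killed A (indicator B) x \<partial>L)"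
      unfolding c(2) by (rule nn_integral_scale_measure) measurable
    also have "\<dots> = c * emeasure (entrance A) B"
      by (subst entrance_eq_flow[symmetric]) (auto simp: sets_entrance)
    finally show "emeasure \<nu> B = emeasure (scale_measure c (entrance A)) B" by simp
  qed (simp add: \<nu> sets_entrance)
  then show ?thesis using c that by blast
qed

text \<open>A harmonic function of the entrance chain extends to a function \<open>H\<close> that is harmonic for the
  walk up to null sets, so that \<open>density L H\<close> is invariant for the reversed walk.\<close>

lemma entrance_Liouville:
  assumes A [measurable]: "A \<in> sets borel"
    and h [measurable]: "h \<in> borel_measurable borel" and h_le: "\<And>x. h x \<le> 1"
    and harmonic: "AE x in entrance A. h x = exit_op A (exit_op (- A) h) x"
  obtains c where "AE x in entrance A. h x = c" "AE x in entrance (- A). exit_op (- A) h x = c"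
proof -
  let ?u = "exit_op (- A) h"
  define H where "H = (\<lambda>x. indicator A x * exit_op A ?u x + indicator (- A) x * ?u x)"
  have H_meas [measurable]: "H \<in> borel_measurable borel" unfolding H_def by measurable
  have u_le: "exit_op B f x \<le> 1" if "B \<in> sets borel" "f \<in> borel_measurable borel" "\<And>x. f x \<le> 1" for B f x
    using kernel_op_mono[OF kernel_op_exit, of B f "\<lambda>_. 1"] exit_le_1[of B x] that
    by (auto simp: le_fun_def intro: order_trans)
  have H_le: "H x \<le> 1" for x
    unfolding H_def using u_le h_le by (cases "x \<in> A") auto
  have St_H: "St H x = killed A (exit_op A ?u) x + killed (- A) ?u x" for x
    unfolding H_def killed_def by (rule St_add) auto
  \<comment> \<open>The harmonic equation may fail on a null set with indicator \<open>?b\<close>.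
    Written as a flow, its nullity says that from almost every point outside \<open>A\<close> a
    single step into \<open>A\<close> misses it.\<close>
  let ?b = "\<lambda>x. if h x = exit_op A ?u x then 0 else 1 :: ennreal"
  have b: "?b \<in> borel_measurable borel" by measurable
  have "(\<integral>\<^sup>+x. indicator (- A) x * killed A ?b x \<partial>L) = (\<integral>\<^sup>+x. ?b x \<partial>entrance A)"
    by (rule entrance_eq_flow[symmetric, OF A b])
  also have "\<dots> = 0"
    using harmonic b by (subst nn_integral_0_iff_AE) (auto simp: measurable_cong_sets[OF sets_entrance refl])
  finally have "AE x in L. indicator (- A) x * killed A ?b x = 0"
    using b by (subst (asm) nn_integral_0_iff_AE) auto
  then have H_harmonic: "AE x in L. H x = St H x"
  proof eventually_elim
    case (elim x)
    show ?case
    proof (cases "x \<in> A")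
      case True
      then show ?thesis
        unfolding St_H using exit_unfold[OF A, of ?u x] by (simp add: H_def add.commute)
    next
      case False
      then have "killed A ?b x = 0" using elim by simp
      then have "AE y in D. indicator A (x + y) * ?b (x + y) = 0"
        unfolding killed_def step_op_def using b
        by (subst (asm) nn_integral_0_iff_AE) (auto simp: measurable_cong_sets[OF sets_D refl])
      then have "killed A h x = killed A (exit_op A ?u) x"
        unfolding killed_def step_op_def
        by (intro nn_integral_cong_AE) (auto elim!: eventually_mono simp: indicator_def split: if_splits)
      moreover have "H x = killed A h x + killed (- A) ?u x"
        using False exit_unfold[of "- A" h x] by (simp add: H_def)
      ultimately show ?thesis by (simp add: St_H)
    qed
  qed
  let ?\<mu> = "density L H"
  have "(\<integral>\<^sup>+x. dual.St f x \<partial>?\<mu>) = (\<integral>\<^sup>+x. f x \<partial>?\<mu>)" if [measurable]: "f \<in> borel_measurable borel" for f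
  proof -
    have "(\<integral>\<^sup>+x. dual.St f x \<partial>?\<mu>) = (\<integral>\<^sup>+x. dual.St f x * H x \<partial>L)"
      by (subst nn_integral_density) (auto simp: mult.commute)
    also have "\<dots> = (\<integral>\<^sup>+x. f x * St H x \<partial>L)"
      by (rule St_duality[symmetric]) auto
    also have "\<dots> = (\<integral>\<^sup>+x. f x * H x \<partial>L)"
      using H_harmonic by (intro nn_integral_cong_AE) (auto elim!: eventually_mono)
    also have "\<dots> = (\<integral>\<^sup>+x. f x \<partial>?\<mu>)"
      by (subst nn_integral_density) (auto simp: mult.commute)
    finally show ?thesis .
  qed
  moreover have "AE x in ?\<mu>. x \<in> Z"
    using L_Z by (subst AE_density) auto
  moreover have "emeasure ?\<mu> {- r..r} < \<infinity>" for r
  proof -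
    have "emeasure ?\<mu> {- r..r} = (\<integral>\<^sup>+x. H x * indicator {- r..r} x \<partial>L)"
      by (rule emeasure_density) auto
    also have "\<dots> \<le> (\<integral>\<^sup>+x. indicator {- r..r} x \<partial>L)"
      using H_le by (intro nn_integral_mono) (auto simp: indicator_def)
    also have "\<dots> < \<infinity>" using L_bounded[of r] by simp
    finally show ?thesis .
  qed
  ultimately obtain c where c: "c < \<infinity>" "?\<mu> = scale_measure c L"
    using dual.unique_invariant[of ?\<mu>] by (auto simp: sets_L)
  have "?\<mu> = density L (\<lambda>_. c)"
    unfolding c(2) by (rule measure_eqI) (auto simp: emeasure_density_const sets_L)
  then have Hc: "AE x in L. H x = c"
    by (subst (asm) L.density_unique_iff) auto
  have "AE x in entrance A. H x = c \<and> x \<in> A" "AE x in entrance (- A). H x = c \<and> x \<notin> A"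
    using Hc by (auto intro!: AE_entrance elim!: eventually_mono)
  then have "AE x in entrance A. h x = c" "AE x in entrance (- A). exit_op (- A) h x = c"
    using harmonic by (auto simp: H_def elim!: eventually_elim2)
  then show ?thesis using that by blast
qed

end

section \<open>Hitting open sets\<close>

text \<open>The complement of the support is a union of open null sets, and Lindelof's theorem
  reduces it to a countable one.\<close>

lemma AE_top_support:
  assumes D: "sets D = sets borel" shows "AE y in D. y \<in> top_support D"
proof -
  let ?F = "{U. open U \<and> emeasure D U = 0}"
  obtain F where F: "F \<subseteq> ?F" "countable F" "\<Union>F = \<Union>?F"
    using Lindelof[of ?F] by blast
  have "(\<Union>U\<in>F. U) \<in> null_sets D"
    using F by (intro null_sets_UN') (auto simp: null_sets_def D)
  then have "emeasure D (\<Union>F) = 0" by auto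
  moreover have "- top_support D = \<Union>F"
    unfolding F(3) by (auto simp: top_support_def not_less)
  moreover have "open (\<Union>F)" using F by blast
  ultimately show ?thesis
    by (intro AE_I[of _ _ "\<Union>F"]) (auto simp: D)
qed

section \<open>The walk on the product space of its steps\<close>

abbreviation seq_space :: "real measure \<Rightarrow> (nat \<Rightarrow> real) measure" where
  "seq_space D \<equiv> PiM (UNIV :: nat set) (\<lambda>_. D)"

definition partial_sum :: "(nat \<Rightarrow> real) \<Rightarrow> nat \<Rightarrow> real" where
  "partial_sum \<omega> n = (\<Sum>i<n. \<omega> i)"

lemma partial_sum_0: "partial_sum \<omega> 0 = 0"
  by (simp add: partial_sum_def)

lemma partial_sum_case_nat: "partial_sum (case_nat y \<omega>) (Suc n) = y + partial_sum \<omega> n"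
  unfolding partial_sum_def by (subst sum.lessThan_Suc_shift) simp

text \<open>\<open>comb_seq k\<close> continues a path after \<open>k\<close> steps by another one;
  with \<open>PiM_comb_seq\<close> this expresses the independence of past and future.\<close>

lemma partial_sum_comb_seq: "partial_sum (comb_seq k \<omega> \<omega>') (k + m) = partial_sum \<omega> k + partial_sum \<omega>' m"
proof (induction m)
  case 0
  show ?case unfolding partial_sum_def by (auto simp: comb_seq_def intro!: sum.cong)
next
  case (Suc m)
  then show ?case by (simp add: partial_sum_def comb_seq_def)
qed

text \<open>A canonical version of the walk, in which the steps are the coordinates of a product
  measure. \<open>Z\<close> enters through its minimality \<open>Z_least\<close>, which is how
  hitting is transferred from the support to all of \<open>Z\<close>.\<close>

locale recurrent_steps =
  fixes D :: "real measure" and Z :: "real set"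
  assumes prob_D: "prob_space D"
    and sets_D [measurable_cong]: "sets D = sets borel"
    and closed_Z: "closed Z" and subgroup_Z: "additive_subgroup Z"
    and Z_support: "top_support D \<subseteq> Z"
    and Z_least: "\<And>H. closed H \<Longrightarrow> additive_subgroup H \<Longrightarrow> top_support D \<subseteq> H \<Longrightarrow> Z \<subseteq> H"
    and recurrent: "\<And>G. open G \<Longrightarrow> 0 \<in> G \<Longrightarrow> AE \<omega> in seq_space D. \<exists>\<^sub>\<infinity>n. partial_sum \<omega> n \<in> G"
begin

sublocale D: prob_space D by (rule prob_D)

sublocale sequence_space D
  by unfold_locales

lemma partial_sum_measurable [measurable]: "(\<lambda>\<omega>. partial_sum \<omega> n) \<in> borel_measurable (seq_space D)"
  unfolding partial_sum_def by measurable

lemma AE_D_Z: "AE y in D. y \<in> Z"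
  using AE_top_support[OF sets_D] Z_support by (auto elim!: eventually_mono)

text \<open>Two sets of limit positions are compared: those approached almost surely form a closed
  set, those approached with positive probability are stable under addition. Recurrence makes them
  equal, hence a closed subgroup that contains the support.\<close>

definition hit_points :: "real set" where
  "hit_points = {y. \<forall>e>0. AE \<omega> in seq_space D. \<exists>n. partial_sum \<omega> n \<in> ball y e}"

definition possible_points :: "real set" where
  "possible_points = {y. \<forall>e>0. \<exists>n. emeasure (seq_space D) {\<omega> \<in> space (seq_space D). partial_sum \<omega> n \<in> ball y e} > 0}"

lemma hit_possible: "hit_points \<subseteq> possible_points"
proof
  fix y assume y: "y \<in> hit_points"
  show "y \<in> possible_points"
    unfolding possible_points_def
  proof safe
    fix e :: real assume "0 < e"
    then have *: "AE \<omega> in seq_space D. \<exists>n. partial_sum \<omega> n \<in> ball y e" using y by (auto simp: hit_points_def)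
    show "\<exists>n. emeasure (seq_space D) {\<omega> \<in> space (seq_space D). partial_sum \<omega> n \<in> ball y e} > 0"
    proof (rule ccontr)
      assume "\<not> ?thesis"
      then have "emeasure (seq_space D) {\<omega> \<in> space (seq_space D). partial_sum \<omega> n \<in> ball y e} = 0" for n
        by (simp add: zero_less_iff_neq_zero)
      then have "AE \<omega> in seq_space D. partial_sum \<omega> n \<notin> ball y e" for n
        by (subst AE_iff_measurable[OF _ refl]) auto
      then have "AE \<omega> in seq_space D. \<forall>n. partial_sum \<omega> n \<notin> ball y e"
        by (simp add: AE_all_countable)
      with * have "AE \<omega> in seq_space D. False" by eventually_elim auto
      then show False by simp
    qed
  qed
qed

text \<open>If \<open>y\<close> is possible but \<open>- y\<close> were not hit almost surely, then with positive probability the walk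
  would first come close to \<open>y\<close> and afterwards stay away from \<open>0\<close>.\<close>

lemma possible_hit_minus:
  assumes y: "y \<in> possible_points" shows "- y \<in> hit_points"
  unfolding hit_points_def
proof safe
  interpret SS: pair_sigma_finite S S ..
  fix e :: real assume e: "0 < e"
  then obtain k where k: "emeasure (seq_space D) {\<omega> \<in> space (seq_space D). partial_sum \<omega> k \<in> ball y (e / 2)} > 0"
    using y half_gt_zero[OF e] unfolding possible_points_def by blast
  have "AE \<omega> in seq_space D. \<exists>\<^sub>\<infinity>n. partial_sum \<omega> n \<in> ball 0 (e / 2)"
    using e by (intro recurrent) auto
  then have "AE \<omega> in distr (S \<Otimes>\<^sub>M S) S (\<lambda>(\<omega>, \<omega>'). comb_seq k \<omega> \<omega>'). \<exists>\<^sub>\<infinity>n. partial_sum \<omega> n \<in> ball 0 (e / 2)"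
    by (simp only: PiM_comb_seq)
  then have "AE p in S \<Otimes>\<^sub>M S. \<exists>\<^sub>\<infinity>n. partial_sum (case p of (\<omega>, \<omega>') \<Rightarrow> comb_seq k \<omega> \<omega>') n \<in> ball 0 (e / 2)"
    by (rule AE_distrD[rotated]) (rule measurable_comb_seq)
  then have "AE \<omega> in S. AE \<omega>' in S. \<exists>\<^sub>\<infinity>n. partial_sum (comb_seq k \<omega> \<omega>') n \<in> ball 0 (e / 2)"
    using SS.AE_pair by fastforce
  moreover have "\<not> (AE \<omega> in S. partial_sum \<omega> k \<notin> ball y (e / 2))"
    using k by (subst AE_iff_measurable[OF _ refl]) auto
  ultimately have "\<not> (AE \<omega> in S. \<not> (partial_sum \<omega> k \<in> ball y (e / 2) \<and>
      (AE \<omega>' in S. \<exists>\<^sub>\<infinity>n. partial_sum (comb_seq k \<omega> \<omega>') n \<in> ball 0 (e / 2))))"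
    by (smt (verit) eventually_elim2)
  \<comment> \<open>One past is fixed that ends near \<open>y\<close> and after which the walk
    almost surely comes back near 0; the later increments then add up to nearly
    \<open>- y\<close>.\<close>
  then obtain \<omega> where \<omega>: "partial_sum \<omega> k \<in> ball y (e / 2)"
    and AE: "AE \<omega>' in S. \<exists>\<^sub>\<infinity>n. partial_sum (comb_seq k \<omega> \<omega>') n \<in> ball 0 (e / 2)"
    using AE_I2[of S] by blast
  from AE show "AE \<omega>' in S. \<exists>n. partial_sum \<omega>' n \<in> ball (- y) e"
  proof eventually_elim
    case (elim \<omega>')
    then obtain n where n: "n \<ge> k" "partial_sum (comb_seq k \<omega> \<omega>') n \<in> ball 0 (e / 2)"
      unfolding INFM_nat_le by blast
    then have "partial_sum \<omega> k + partial_sum \<omega>' (n - k) \<in> ball 0 (e / 2)"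
      using partial_sum_comb_seq[of k \<omega> \<omega>' "n - k"] by simp
    then have "partial_sum \<omega>' (n - k) \<in> ball (- y) e"
      using \<omega> by (auto simp: dist_real_def abs_real_def split: if_splits)
    then show ?case by blast
  qed
qed

text \<open>Negation maps possible points to hit points, and hit points are possible; negating twice
  closes the circle.\<close>

lemma possible_eq_hit: "possible_points = hit_points"
proof
  show "possible_points \<subseteq> hit_points"
  proof
    fix y assume "y \<in> possible_points"
    then have "- y \<in> possible_points"
      using possible_hit_minus hit_possible by blast
    then show "y \<in> hit_points" using possible_hit_minus[of "- y"] by simp
  qed
qed (rule hit_possible)

text \<open>By independence the walk comes near \<open>y\<close> in \<open>n\<close> steps and then
  moves by nearly \<open>z\<close> in \<open>m\<close> further ones with positive
  probability.\<close>

lemma possible_add: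
  assumes y: "y \<in> possible_points" and z: "z \<in> possible_points"
  shows "y + z \<in> possible_points"
  unfolding possible_points_def
proof safe
  fix e :: real assume e: "0 < e"
  let ?P = "\<lambda>n y e. {\<omega> \<in> space S. partial_sum \<omega> n \<in> ball y e}"
  obtain n m where nm: "emeasure S (?P n y (e / 2)) > 0" "emeasure S (?P m z (e / 2)) > 0"
    using y z half_gt_zero[OF e] unfolding possible_points_def by blast
  let ?f = "\<lambda>(\<omega>, \<omega>'). comb_seq n \<omega> \<omega>'"
  have target: "?P (n + m) (y + z) e \<in> sets S"
    using measurable_sets[OF partial_sum_measurable[of "n + m"], of "ball (y + z) e"]
    by (simp add: vimage_def Int_def conj_commute)
  have "0 < emeasure S (?P n y (e / 2)) * emeasure S (?P m z (e / 2))"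
    using nm by (simp add: ennreal_zero_less_mult_iff)
  also have "\<dots> = emeasure (S \<Otimes>\<^sub>M S) (?P n y (e / 2) \<times> ?P m z (e / 2))"
    by (rule P.emeasure_pair_measure_Times[symmetric]) auto
  also have "\<dots> \<le> emeasure (S \<Otimes>\<^sub>M S) (?f -` ?P (n + m) (y + z) e \<inter> space (S \<Otimes>\<^sub>M S))"
  proof (rule emeasure_mono)
    have "comb_seq n \<omega> \<omega>' \<in> ?P (n + m) (y + z) e" if "\<omega> \<in> ?P n y (e / 2)" "\<omega>' \<in> ?P m z (e / 2)" for \<omega> \<omega>'
    proof -
      have "(\<omega>, \<omega>') \<in> space (S \<Otimes>\<^sub>M S)" using that by (simp add: space_pair_measure)
      then have "comb_seq n \<omega> \<omega>' \<in> space S"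
        using measurable_space[OF measurable_comb_seq, of "(\<omega>, \<omega>')" D n] by simp
      moreover have "partial_sum \<omega> n + partial_sum \<omega>' m \<in> ball (y + z) e"
        using that by (auto simp: dist_real_def abs_real_def split: if_splits)
      ultimately show ?thesis by (simp only: partial_sum_comb_seq mem_Collect_eq)
    qed
    then show "?P n y (e / 2) \<times> ?P m z (e / 2) \<subseteq> ?f -` ?P (n + m) (y + z) e \<inter> space (S \<Otimes>\<^sub>M S)"
      by (auto simp: space_pair_measure)
    show "?f -` ?P (n + m) (y + z) e \<inter> space (S \<Otimes>\<^sub>M S) \<in> sets (S \<Otimes>\<^sub>M S)"
      by (rule measurable_sets[OF measurable_comb_seq target])
  qed
  also have "\<dots> = emeasure (distr (S \<Otimes>\<^sub>M S) S ?f) (?P (n + m) (y + z) e)"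
    by (rule emeasure_distr[OF measurable_comb_seq target, symmetric])
  finally show "\<exists>n. emeasure S (?P n (y + z) e) > 0"
    unfolding PiM_comb_seq by blast
qed

lemma Z_hit: "Z \<subseteq> hit_points"
proof (rule Z_least)
  have zero: "0 \<in> hit_points" by (auto simp: hit_points_def partial_sum_0 intro!: exI[of _ 0] always_eventually)
  show "additive_subgroup hit_points"
    unfolding additive_subgroup_def
    using zero possible_add possible_hit_minus possible_eq_hit by auto
  show "closed hit_points"
    unfolding closed_sequential_limits
  proof safe
    fix u l assume u: "\<forall>n. u n \<in> hit_points" "u \<longlonglongrightarrow> l"
    show "l \<in> hit_points"
      unfolding hit_points_def
    proof safe
      fix e :: real assume e: "0 < e"
      then obtain n where n: "dist (u n) l < e / 2"
        using u(2) by (metis LIMSEQ_iff_nz half_gt_zero lim_sequentially order_refl)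
      have "AE \<omega> in S. \<exists>k. partial_sum \<omega> k \<in> ball (u n) (e / 2)"
        using u(1) half_gt_zero[OF e] unfolding hit_points_def by blast
      then show "AE \<omega> in S. \<exists>k. partial_sum \<omega> k \<in> ball l e"
      proof eventually_elim
        case (elim \<omega>)
        then obtain k where "dist (u n) (partial_sum \<omega> k) < e / 2" by auto
        then have "dist l (partial_sum \<omega> k) < e"
          using n by (metis dist_commute dist_triangle_half_r)
        then show ?case by auto
      qed
    qed
  qed
  show "top_support D \<subseteq> hit_points"
    unfolding possible_eq_hit[symmetric]
  proof
    fix y assume y: "y \<in> top_support D"
    show "y \<in> possible_points"
      unfolding possible_points_def
    proof safe
      fix e :: real assume "0 < e"
      then have "0 < emeasure D (ball y e)" using y by (auto simp: top_support_def)
      also have "\<dots> = emeasure (distr S D (\<lambda>\<omega>. \<omega> 0)) (ball y e)"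
        by (subst PiM_component) (auto simp: prob_D)
      also have "\<dots> = emeasure S {\<omega> \<in> space S. partial_sum \<omega> 1 \<in> ball y e}"
        by (subst emeasure_distr) (auto simp: partial_sum_def sets_D intro!: arg_cong[where f="emeasure S"])
      finally show "\<exists>n. emeasure S {\<omega> \<in> space S. partial_sum \<omega> n \<in> ball y e} > 0" by blast
    qed
  qed
qed

lemma hits_open:
  assumes "open G" "G \<inter> Z \<noteq> {}" "x \<in> Z"
  shows "AE \<omega> in S. \<exists>n. x + partial_sum \<omega> n \<in> G"
proof -
  obtain b where b: "b \<in> G" "b \<in> Z" using assms by auto
  then obtain e where e: "e > 0" "ball b e \<subseteq> G" using assms openE by blast
  have "b - x \<in> Z" using subgroup_Z b assms unfolding additive_subgroup_def by (metis add_uminus_conv_diff)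
  then have "AE \<omega> in S. \<exists>n. partial_sum \<omega> n \<in> ball (b - x) e"
    using Z_hit e by (auto simp: hit_points_def)
  then show ?thesis
  proof eventually_elim
    case (elim \<omega>)
    then obtain n where "partial_sum \<omega> n \<in> ball (b - x) e" by blast
    then have "x + partial_sum \<omega> n \<in> ball b e" by (auto simp: dist_real_def abs_real_def split: if_splits)
    then show ?case using e by blast
  qed
qed

lemma emeasure_S_first_step:
  assumes [measurable]: "A \<in> sets S"
  shows "emeasure S A = (\<integral>\<^sup>+y. emeasure S (case_nat y -` A \<inter> space S) \<partial>D)"
proof -
  have m: "(\<lambda>(s, \<omega>). case_nat s \<omega>) \<in> D \<Otimes>\<^sub>M S \<rightarrow>\<^sub>M S" by measurable
  have "emeasure S A = emeasure (distr (D \<Otimes>\<^sub>M S) S (\<lambda>(s, \<omega>). case_nat s \<omega>)) A"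
    by (simp only: PiM_iter)
  also have "\<dots> = emeasure (D \<Otimes>\<^sub>M S) ((\<lambda>(s, \<omega>). case_nat s \<omega>) -` A \<inter> space (D \<Otimes>\<^sub>M S))"
    by (rule emeasure_distr[OF m]) fact
  also have "\<dots> = (\<integral>\<^sup>+y. emeasure S (Pair y -` ((\<lambda>(s, \<omega>). case_nat s \<omega>) -` A \<inter> space (D \<Otimes>\<^sub>M S))) \<partial>D)"
    by (rule P.emeasure_pair_measure_alt) (rule measurable_sets[OF m], fact)
  also have "\<dots> = (\<integral>\<^sup>+y. emeasure S (case_nat y -` A \<inter> space S) \<partial>D)"
    by (intro nn_integral_cong arg_cong[where f="emeasure S"]) (auto simp: space_pair_measure)
  finally show ?thesis .
qed

text \<open>Optional stopping without stopping times: by induction, \<open>m\<close> times the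
  probability of hitting \<open>G\<close> within \<open>n\<close> steps is at most
  \<open>g x\<close>. By \<open>hits_open\<close> these probabilities increase to 1.\<close>

lemma minimum_principle:
  assumes g: "g \<in> borel_measurable borel" and G: "open G" "G \<inter> Z \<noteq> {}"
    and super: "\<And>x. x \<in> Z \<Longrightarrow> step_op D g x \<le> g x" and m: "\<And>x. x \<in> G \<inter> Z \<Longrightarrow> m \<le> g x" and x: "x \<in> Z"
  shows "m \<le> g x"
proof -
  let ?A = "\<lambda>n x. {\<omega> \<in> space S. \<exists>k\<le>n. x + partial_sum \<omega> k \<in> G}"
  have [measurable]: "G \<in> sets borel" using G by simp
  have A [measurable]: "?A n x \<in> sets S" for n x by measurable
  have le: "m * emeasure S (?A n x) \<le> g x" if "x \<in> Z" for n x
    using that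
  proof (induction n arbitrary: x)
    case 0
    show ?case
    proof (cases "x \<in> G")
      case True
      have "m * emeasure S (?A 0 x) \<le> m * 1"
        by (intro mult_left_mono P.measure_le_1) auto
      then show ?thesis using m[of x] True 0 by auto
    qed (simp add: partial_sum_0)
  next
    case (Suc n)
    show ?case
    proof (cases "x \<in> G")
      case True
      have "m * emeasure S (?A (Suc n) x) \<le> m * 1"
        by (intro mult_left_mono P.measure_le_1) auto
      then show ?thesis using m[of x] True Suc.prems by auto
    next
      case False
      \<comment> \<open>Since \<open>x\<close> lies outside \<open>G\<close>, time 0 is no hit, and
        the remaining \<open>n\<close> steps start afresh from \<open>x + y\<close>.\<close>
      have eq: "case_nat y -` ?A (Suc n) x \<inter> space S = ?A n (x + y)" for y
      proof -
        have "case_nat y \<omega> \<in> space S" if "\<omega> \<in> space S" for \<omega>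
          using that sets_eq_imp_space_eq[OF sets_D] by (auto simp: space_PiM split: nat.split)
        moreover have "(\<exists>k\<le>Suc n. x + partial_sum (case_nat y \<omega>) k \<in> G) \<longleftrightarrow> (\<exists>k\<le>n. x + y + partial_sum \<omega> k \<in> G)" for \<omega>
          using False by (auto simp: partial_sum_0 partial_sum_case_nat add.assoc le_Suc_eq less_Suc_eq_le
            Ex_less_Suc2 simp flip: less_Suc_eq_le)
        ultimately show ?thesis by auto
      qed
      have [measurable]: "(\<lambda>y. emeasure S (?A n (x + y))) \<in> borel_measurable D"
        using P.measurable_emeasure_Pair[of "{p \<in> space (D \<Otimes>\<^sub>M S). \<exists>k\<le>n. x + fst p + partial_sum (snd p) k \<in> G}" D]
        by (simp add: space_pair_measure vimage_def sets_eq_imp_space_eq[OF sets_D] cong: measurable_cong)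
      have "m * emeasure S (?A (Suc n) x) = m * (\<integral>\<^sup>+y. emeasure S (?A n (x + y)) \<partial>D)"
        by (subst emeasure_S_first_step[OF A]) (simp only: eq)
      also have "\<dots> = (\<integral>\<^sup>+y. m * emeasure S (?A n (x + y)) \<partial>D)"
        by (rule nn_integral_cmult[symmetric]) measurable
      also have "\<dots> \<le> step_op D g x"
        unfolding step_op_def
      proof (rule nn_integral_mono_AE)
        show "AE y in D. m * emeasure S (?A n (x + y)) \<le> g (x + y)"
          using AE_D_Z
        proof eventually_elim
          case (elim y)
          then have "x + y \<in> Z" using Suc.prems subgroup_Z by (auto simp: additive_subgroup_def)
          then show ?case by (rule Suc.IH)
        qed
      qed
      also have "\<dots> \<le> g x" by (rule super[OF Suc.prems])
      finally show ?thesis .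
    qed
  qed
  have "(SUP n. emeasure S (?A n x)) = emeasure S (\<Union>n. ?A n x)"
    by (rule SUP_emeasure_incseq) (auto simp: incseq_def intro: order_trans)
  also have "\<dots> = emeasure S (space S)"
    using hits_open[OF G x] by (intro emeasure_eq_AE) auto
  finally have "m * 1 = m * (SUP n. emeasure S (?A n x))"
    by (simp add: P.emeasure_space_1)
  also have "\<dots> = (SUP n. m * emeasure S (?A n x))"
    by (simp add: SUP_mult_left_ennreal)
  also have "\<dots> \<le> g x"
    by (rule SUP_least) (rule le[OF x])
  finally show ?thesis by simp
qed

end

section \<open>Closed subgroups of the reals and their Haar measure\<close>

lemma subgroup_of_int_mult:
  assumes Z: "additive_subgroup Z" and x: "x \<in> Z" shows "of_int k * x \<in> Z"
proof -
  have nat: "of_nat n * x \<in> Z" for n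
    using Z x by (induction n) (auto simp: additive_subgroup_def distrib_right)
  show ?thesis
  proof (cases "k \<ge> 0")
    case True
    then show ?thesis using nat[of "nat k"] by simp
  next
    case False
    then have "- (of_nat (nat (- k)) * x) \<in> Z" using nat[of "nat (- k)"] Z unfolding additive_subgroup_def by blast
    moreover have "real (nat (- k)) = - of_int k" using False by simp
    ultimately show ?thesis by simp
  qed
qed

lemma subgroup_pos:
  assumes Z: "additive_subgroup Z" "Z \<noteq> {0}"
  obtains a :: real where "a \<in> Z" "0 < a"
proof -
  obtain a where a: "a \<in> Z" "a \<noteq> 0" using Z by (auto simp: additive_subgroup_def)
  then have "- a \<in> Z" using Z by (auto simp: additive_subgroup_def)
  then show ?thesis using a that[of a] that[of "- a"] by linarith
qed

lemma floor_remainder: "0 < x \<Longrightarrow> 0 \<le> y - of_int \<lfloor>y / x\<rfloor> * x \<and> y - of_int \<lfloor>y / x\<rfloor> * x < (x :: real)"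
proof
  assume x: "0 < x"
  have "of_int \<lfloor>y / x\<rfloor> \<le> y / x" "y / x < of_int \<lfloor>y / x\<rfloor> + 1" by linarith+
  then have "of_int \<lfloor>y / x\<rfloor> * x \<le> y / x * x" "y / x * x < (of_int \<lfloor>y / x\<rfloor> + 1) * x"
    using x mult_right_mono[of "of_int \<lfloor>y / x\<rfloor>" "y / x" x]
      mult_strict_right_mono[of "y / x" "of_int \<lfloor>y / x\<rfloor> + 1" x] by simp_all
  then show "0 \<le> y - of_int \<lfloor>y / x\<rfloor> * x" "y - of_int \<lfloor>y / x\<rfloor> * x < x"
    using x by (simp_all add: distrib_right)
qed

text \<open>Arbitrarily small positive elements have dense multiples, and a closed dense set is
  everything. Otherwise there is a least positive element, attained as an infimum because
  \<open>Z\<close> is closed, and remainders modulo it vanish.\<close>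

lemma closed_subgroup_cases:
  assumes "closed Z" and Z: "additive_subgroup Z" "Z \<noteq> {0}"
  obtains "Z = UNIV" | h :: real where "0 < h" "Z = range (\<lambda>k::int. h * of_int k)"
proof (cases "\<forall>e>0. \<exists>x\<in>Z. 0 < x \<and> x < e")
  case True
  have "y \<in> closure Z" for y
    unfolding closure_approachable
  proof safe
    fix e :: real assume "0 < e"
    then obtain x where x: "x \<in> Z" "0 < x" "x < e" using True by blast
    have "dist (of_int \<lfloor>y / x\<rfloor> * x) y < e"
      using floor_remainder[OF x(2), of y] x by (simp add: dist_real_def)
    then show "\<exists>z\<in>Z. dist z y < e" using subgroup_of_int_mult[OF Z(1) x(1)] by blast
  qed
  then show ?thesis using that(1) \<open>closed Z\<close> by auto
next
  case False
  then obtain e where e: "0 < e" "\<And>x. x \<in> Z \<Longrightarrow> 0 < x \<Longrightarrow> e \<le> x" by force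
  obtain a where a: "a \<in> Z" "0 < a" using subgroup_pos[OF Z] .
  define h where "h = Inf (Z \<inter> {e..})"
  have bdd: "bdd_below (Z \<inter> {e..})" by (rule bdd_belowI[of _ e]) auto
  have "h \<in> Z \<inter> {e..}"
    unfolding h_def using a e \<open>closed Z\<close> bdd by (intro closed_contains_Inf) auto
  then have h: "h \<in> Z" "0 < h" using e by auto
  have least: "h \<le> x" if "x \<in> Z" "0 < x" for x
    unfolding h_def using that e bdd by (intro cInf_lower) auto
  have "x \<in> range (\<lambda>k::int. h * of_int k)" if x: "x \<in> Z" for x
  proof -
    let ?r = "x - of_int \<lfloor>x / h\<rfloor> * h"
    have "- (of_int \<lfloor>x / h\<rfloor> * h) \<in> Z"
      using subgroup_of_int_mult[OF Z(1) h(1)] Z by (auto simp: additive_subgroup_def)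
    then have "?r \<in> Z" using x Z unfolding additive_subgroup_def by (metis add_uminus_conv_diff)
    then have "?r = 0" using least[of ?r] floor_remainder[OF h(2), of x] by linarith
    then show ?thesis by (intro image_eqI[of _ _ "\<lfloor>x / h\<rfloor>"]) (simp_all add: mult.commute)
  qed
  moreover have "h * of_int k \<in> Z" for k
    using subgroup_of_int_mult[OF Z(1) h(1), of k] by (simp add: mult.commute)
  ultimately show ?thesis using that(2)[OF h(2)] by blast
qed

lemma lattice_not_UNIV: "0 < h \<Longrightarrow> range (\<lambda>k::int. h * of_int k) \<noteq> (UNIV :: real set)"
proof
  assume h: "0 < h" and "range (\<lambda>k::int. h * of_int k) = (UNIV :: real set)"
  then have "h / 2 \<in> range (\<lambda>k::int. h * of_int k)" by simp
  then obtain k :: int where "h / 2 = h * of_int k" by blast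
  then have "real_of_int (2 * k) = 1" using h by (simp add: field_simps)
  then have "2 * k = 1" by (simp only: of_int_eq_1_iff)
  then show False by presburger
qed

text \<open>Each spacing is a positive integer multiple of the other. This makes the definite
  description in \<open>haar\<close> denote the given spacing.\<close>

lemma lattice_span_unique:
  assumes "0 < h" "0 < h'" "range (\<lambda>k::int. h * of_int k) = range (\<lambda>k::int. h' * of_int k)"
  shows "h = (h' :: real)"
proof -
  have *: "h \<le> h'" if "0 < h" "0 < h'" "range (\<lambda>k::int. h * of_int k) = range (\<lambda>k::int. h' * of_int k)" for h h' :: real
  proof -
    have "h' * of_int 1 \<in> range (\<lambda>k::int. h * of_int k)" unfolding that(3) by (rule rangeI)
    then obtain k :: int where k: "h' = h * of_int k" by auto
    then have "0 < k" using that by (simp add: zero_less_mult_iff)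
    then have "1 \<le> real_of_int k" by linarith
    then show ?thesis using k that by simp
  qed
  show ?thesis using *[of h h'] *[of h' h] assms by simp
qed

lemma haar_lattice:
  assumes h: "0 < h" and Z: "Z = range (\<lambda>k::int. h * of_int k)"
  shows "sets (haar Z) = sets borel"
    and "B \<in> sets borel \<Longrightarrow> emeasure (haar Z) B = ennreal h * emeasure (count_space Z) (B \<inter> Z)"
proof -
  have the: "(THE h. h > 0 \<and> Z = range (\<lambda>k::int. h * of_int k)) = h"
    using h Z lattice_span_unique by (intro the_equality) auto
  have haar: "haar Z = distr (scale_measure (ennreal h) (count_space Z)) borel (\<lambda>z. z)"
    unfolding haar_def the Let_def using lattice_not_UNIV[OF h] Z by simp
  show "sets (haar Z) = sets borel" by (simp add: haar)
  assume "B \<in> sets borel"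
  moreover have "(\<lambda>z. z) \<in> scale_measure (ennreal h) (count_space Z) \<rightarrow>\<^sub>M borel"
    by (simp add: measurable_cong_sets[OF sets_scale_measure refl])
  ultimately show "emeasure (haar Z) B = ennreal h * emeasure (count_space Z) (B \<inter> Z)"
    unfolding haar by (subst emeasure_distr) (simp_all add: space_scale_measure)
qed

text \<open>The measure is Lebesgue measure or consists of equal point masses, which a translation
  by a lattice element permutes. The list is what \<open>recurrent_law\<close> asks of
  \<open>L\<close>.\<close>

lemma haar_facts:
  assumes "closed Z" and Z: "additive_subgroup Z" "Z \<noteq> {0}"
  shows sets_haar: "sets (haar Z) = sets borel"
    and AE_haar: "AE x in haar Z. x \<in> Z"
    and haar_plus: "z \<in> Z \<Longrightarrow> distr (haar Z) borel (\<lambda>x. x + z) = haar Z"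
    and haar_bounded: "emeasure (haar Z) {- r..r} < \<infinity>"
    and haar_pos: "emeasure (haar Z) {-1<..<1} > 0"
proof -
  have "sets (haar Z) = sets borel \<and> (AE x in haar Z. x \<in> Z) \<and>
    (z \<in> Z \<longrightarrow> distr (haar Z) borel (\<lambda>x. x + z) = haar Z) \<and> emeasure (haar Z) {- r..r} < \<infinity> \<and>
    emeasure (haar Z) {-1<..<1} > 0"
  proof (cases rule: closed_subgroup_cases[OF assms])
    case 1
    have "(\<lambda>x. x + z) = (+) z" by (auto simp: add.commute)
    then have "distr lborel borel (\<lambda>x. x + z) = lborel"
      using lborel_distr_plus[of z] by simp
    then show ?thesis
      using 1 by (simp add: haar_def emeasure_lborel_Icc_eq)
  next
    case (2 h)
    note em = haar_lattice(2)[OF 2]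
    have sets: "sets (haar Z) = sets borel" by (rule haar_lattice(1)[OF 2])
    have [measurable_cong]: "sets (haar Z) = sets borel" by (rule sets)
    have "AE x in haar Z. x \<in> Z"
      using em[of "- Z"] \<open>closed Z\<close> by (intro AE_I[of _ _ "- Z"]) (auto simp: sets)
    moreover have "distr (haar Z) borel (\<lambda>x. x + z) = haar Z" if z: "z \<in> Z"
    proof (rule measure_eqI)
      fix B assume "B \<in> sets (distr (haar Z) borel (\<lambda>x. x + z))"
      then have B [measurable]: "B \<in> sets borel" by simp
      have B': "(\<lambda>x. x + z) -` B \<in> sets borel"
        using measurable_sets[of "\<lambda>x. x + z" borel borel B] by simp
      have Zd: "x - z \<in> Z" "x + z \<in> Z" if "x \<in> Z" for x
        using that z Z unfolding additive_subgroup_def by (metis add_uminus_conv_diff)+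
      have bij: "bij_betw (\<lambda>x. x + z) ((\<lambda>x. x + z) -` B \<inter> Z) (B \<inter> Z)"
        by (rule bij_betw_byWitness[where f'="\<lambda>x. x - z"]) (auto simp: Zd)
      have "emeasure (count_space Z) ((\<lambda>x. x + z) -` B \<inter> Z) = emeasure (count_space Z) (B \<inter> Z)"
        using bij_betw_finite[OF bij] bij_betw_same_card[OF bij] by (simp add: emeasure_count_space)
      then show "emeasure (distr (haar Z) borel (\<lambda>x. x + z)) B = emeasure (haar Z) B"
        using B B' sets_eq_imp_space_eq[OF sets] by (simp add: emeasure_distr em)
    qed (simp add: sets)
    moreover have "emeasure (haar Z) {- r..r} < \<infinity>"
    proof -
      have "{- r..r} \<inter> Z \<subseteq> (\<lambda>k::int. h * of_int k) ` {- \<lceil>r / h\<rceil>..\<lceil>r / h\<rceil>}"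
      proof
        fix x assume "x \<in> {- r..r} \<inter> Z"
        then obtain k :: int where k: "x = h * of_int k" "- r \<le> h * of_int k" "h * of_int k \<le> r"
          using 2 by auto
        then have "- (r / h) \<le> of_int k" "of_int k \<le> r / h" using 2(1) by (simp_all add: field_simps)
        then have "k \<in> {- \<lceil>r / h\<rceil>..\<lceil>r / h\<rceil>}" by (simp add: minus_le_iff le_ceiling_iff)
        then show "x \<in> (\<lambda>k::int. h * of_int k) ` {- \<lceil>r / h\<rceil>..\<lceil>r / h\<rceil>}" using k by blast
      qed
      then have "finite ({- r..r} \<inter> Z)" by (rule finite_subset) simp
      then show ?thesis by (simp add: em emeasure_count_space ennreal_mult_less_top of_nat_less_top)
    qed
    moreover have "emeasure (haar Z) {-1<..<1} > 0"
    proof -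
      have "0 \<in> {-1<..<1} \<inter> Z" using Z by (auto simp: additive_subgroup_def)
      then have "{-1<..<1} \<inter> Z \<noteq> {}" by blast
      then have "emeasure (count_space Z) ({-1<..<1} \<inter> Z) \<noteq> 0"
        by (simp add: emeasure_count_space card_eq_0_iff)
      then show ?thesis using 2(1) by (simp add: em ennreal_zero_less_mult_iff zero_less_iff_neq_zero)
    qed
    ultimately show ?thesis using sets by blast
  qed
  then show "sets (haar Z) = sets borel" "AE x in haar Z. x \<in> Z"
    "z \<in> Z \<Longrightarrow> distr (haar Z) borel (\<lambda>x. x + z) = haar Z" "emeasure (haar Z) {- r..r} < \<infinity>"
    "emeasure (haar Z) {-1<..<1} > 0"
    by blast+
qed

section \<open>The half-lines can be entered\<close>

context recurrent_steps
begin

lemma recurrent_law_haar: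
  assumes "Z \<noteq> {0}" shows "recurrent_law D Z (haar Z)"
proof -
  note haar = haar_facts[OF closed_Z subgroup_Z assms]
  show ?thesis
    by unfold_locales (use haar prob_D sets_D closed_Z subgroup_Z AE_D_Z minimum_principle in blast)+
qed

text \<open>If the steps were almost surely at most 0, the indicator of \<open>{0..}\<close> would
  be superharmonic and equal to 1 on \<open>{0<..}\<close>; the minimum principle would then give 1
  at a negative point.\<close>

lemma D_pos:
  assumes "Z \<noteq> {0}" shows "emeasure D {0<..} > 0"
proof (rule ccontr)
  assume "\<not> ?thesis"
  then have "AE y in D. y \<notin> {0<..}"
    by (subst AE_iff_measurable[of "{0<..}"]) (auto simp: sets_D sets_eq_imp_space_eq[OF sets_D] zero_less_iff_neq_zero)
  then have "AE y in D. indicator {0..} (x + y) \<le> (indicator {0..} x :: ennreal)" for x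
    by eventually_elim (auto simp: indicator_def)
  then have "step_op D (indicator {0..}) x \<le> step_op D (\<lambda>_. indicator {0..} x) x" for x
    unfolding step_op_def by (rule nn_integral_mono_AE)
  then have super: "step_op D (indicator {0..}) x \<le> indicator {0..} x" for x
    by (simp add: step_op_def D.emeasure_space_1)
  obtain a where a: "a \<in> Z" "0 < a" using subgroup_pos[OF subgroup_Z assms] .
  have ma: "- a \<in> Z" using a subgroup_Z by (auto simp: additive_subgroup_def)
  have "(1 :: ennreal) \<le> indicator {0..} (- a)"
    by (rule minimum_principle[of "indicator {0..}" "{0<..}"]) (use a ma super in auto)
  then show False using a by simp
qed

lemma D_neg:
  assumes "Z \<noteq> {0}" shows "emeasure D {..<0} > 0"
proof (rule ccontr)
  assume "\<not> ?thesis"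
  then have "AE y in D. y \<notin> {..<0}"
    by (subst AE_iff_measurable[of "{..<0}"]) (auto simp: sets_D sets_eq_imp_space_eq[OF sets_D] zero_less_iff_neq_zero)
  then have "AE y in D. indicator {..0} (x + y) \<le> (indicator {..0} x :: ennreal)" for x
    by eventually_elim (auto simp: indicator_def)
  then have "step_op D (indicator {..0}) x \<le> step_op D (\<lambda>_. indicator {..0} x) x" for x
    unfolding step_op_def by (rule nn_integral_mono_AE)
  then have super: "step_op D (indicator {..0}) x \<le> indicator {..0} x" for x
    by (simp add: step_op_def D.emeasure_space_1)
  obtain a where a: "a \<in> Z" "0 < a" using subgroup_pos[OF subgroup_Z assms] .
  have ma: "- a \<in> Z" using a subgroup_Z by (auto simp: additive_subgroup_def)
  then have "- a \<in> {..<0} \<inter> Z" using a by simp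
  then have ne: "{..<0} \<inter> Z \<noteq> {}" by blast
  have "(1 :: ennreal) \<le> indicator {..0} a"
    by (rule minimum_principle[of "indicator {..0}" "{..<0}"]) (use a ne super in auto)
  then show False using a by simp
qed

text \<open>Countably many compact intervals exhaust the open half-line, so one of them is charged.
  The bound \<open>N\<close> keeps the target of a step compact, the gap \<open>e\<close> makes
  entering possible from a whole interval.\<close>

lemma D_pos_interval:
  assumes "Z \<noteq> {0}" obtains e N where "0 < e" "emeasure D {e..N} > 0"
proof (rule ccontr)
  assume *: "\<not> thesis"
  have "emeasure D {1 / Suc n..real n} = 0" for n
    using that[of "1 / Suc n" "real n"] * by (auto simp: zero_less_iff_neq_zero)
  then have "(\<Union>n. {1 / Suc n..real n}) \<in> null_sets D"
    by (intro null_sets_UN) (auto simp: null_sets_def sets_D)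
  moreover have "{0<..} \<subseteq> (\<Union>n. {1 / Suc n..real n})"
  proof
    fix x :: real assume "x \<in> {0<..}"
    then obtain n where n: "1 / Suc n < x" using nat_approx_posE[of x] by auto
    obtain m where m: "x \<le> real m" using real_arch_simple[of x] by blast
    have "1 / Suc (max n m) \<le> 1 / real (Suc n)" by (simp add: frac_le)
    then have "x \<in> {1 / Suc (max n m)..real (max n m)}" using n m by (auto simp del: of_nat_Suc)
    then show "x \<in> (\<Union>n. {1 / Suc n..real n})" by blast
  qed
  ultimately have "emeasure D {0<..} = 0"
    using emeasure_mono[of "{0<..}" "\<Union>n. {1 / Suc n..real n}" D] by (auto simp: null_sets_def)
  then show False using D_pos[OF assms] by simp
qed

lemma D_neg_interval:
  assumes "Z \<noteq> {0}" obtains e N where "0 < e" "emeasure D {- N..- e} > 0"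
proof (rule ccontr)
  assume *: "\<not> thesis"
  have "emeasure D {- real n..- (1 / Suc n)} = 0" for n
    using that[of "1 / Suc n" "real n"] * by (auto simp: zero_less_iff_neq_zero)
  then have "(\<Union>n. {- real n..- (1 / Suc n)}) \<in> null_sets D"
    by (intro null_sets_UN) (auto simp: null_sets_def sets_D)
  moreover have "{..<0} \<subseteq> (\<Union>n. {- real n..- (1 / Suc n)})"
  proof
    fix x :: real assume "x \<in> {..<0}"
    then obtain n where n: "1 / Suc n < - x" using nat_approx_posE[of "- x"] by auto
    obtain m where m: "- x \<le> real m" using real_arch_simple[of "- x"] by blast
    have "1 / Suc (max n m) \<le> 1 / real (Suc n)" by (simp add: frac_le)
    then have "x \<in> {- real (max n m)..- (1 / Suc (max n m))}" using n m by (auto simp del: of_nat_Suc)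
    then show "x \<in> (\<Union>n. {- real n..- (1 / Suc n)})" by blast
  qed
  ultimately have "emeasure D {..<0} = 0"
    using emeasure_mono[of "{..<0}" "\<Union>n. {- real n..- (1 / Suc n)}" D] by (auto simp: null_sets_def)
  then show False using D_neg[OF assms] by simp
qed

lemma step_op_indicator_ge:
  assumes "B \<in> sets borel" "\<And>y. y \<in> B \<Longrightarrow> x + y \<in> C"
  shows "emeasure D B \<le> step_op D (indicator C) x"
proof -
  have "emeasure D B = (\<integral>\<^sup>+y. indicator B y \<partial>D)" using assms by (simp add: sets_D)
  also have "\<dots> \<le> step_op D (indicator C) x"
    unfolding step_op_def using assms by (intro nn_integral_mono) (auto simp: indicator_def)
  finally show ?thesis .
qed

text \<open>From \<open>[- e, 0)\<close> a step in \<open>[e, N]\<close> lands in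
  \<open>[0, N]\<close>. In a lattice the nearest negative point is \<open>- h\<close>, so
  \<open>e\<close> is replaced by \<open>h\<close>; no mass is lost, because a positive point of
  \<open>Z\<close> is at least \<open>h\<close>, and the interval from \<open>- 2 h\<close> to 0
  isolates \<open>- h\<close>.\<close>

lemma enterable_nonneg:
  assumes Z: "Z \<noteq> {0}" shows "enterable D Z {0..}"
proof -
  obtain e N where e: "0 < e" "emeasure D {e..N} > 0" using D_pos_interval[OF Z] .
  have "\<exists>e J. emeasure D {e..N} > 0 \<and> open J \<and> J \<inter> Z \<noteq> {} \<and> J \<inter> Z \<subseteq> {- e..<0}"
  proof (cases rule: closed_subgroup_cases[OF closed_Z subgroup_Z Z])
    case 1
    have "- (e / 2) \<in> {- e<..<0}" using e by simp
    then show ?thesis using e 1 by (intro exI[of _ e] exI[of _ "{- e<..<0}"]) auto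
  next
    case (2 h)
    have int: "k = 1" if "0 < h * real_of_int k" "h * real_of_int k < 2 * h" for k
    proof -
      have "0 < k" "real_of_int k < 2" using that 2(1) by (simp_all add: zero_less_mult_iff mult.commute)
      then show "k = 1" by linarith
    qed
    have "h \<le> x" if "x \<in> Z" "0 < x" for x
    proof -
      have "x \<in> range (\<lambda>k::int. h * of_int k)" using that 2 by blast
      then obtain k :: int where k: "x = h * of_int k" by blast
      then have "1 \<le> k" using that 2(1) by (simp add: zero_less_mult_iff)
      then have "1 \<le> real_of_int k" by simp
      then show ?thesis using k 2(1) by simp
    qed
    then have "emeasure D {e..N} \<le> emeasure D {h..N}"
      using AE_D_Z e by (intro emeasure_mono_AE) (auto simp: sets_D elim!: eventually_mono)
    moreover have "{-2 * h<..<0} \<inter> Z \<subseteq> {- h..<0}"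
    proof
      fix x assume x: "x \<in> {-2 * h<..<0} \<inter> Z"
      then have "x \<in> range (\<lambda>k::int. h * of_int k)" using 2 by blast
      then obtain k :: int where k: "x = h * of_int k" by blast
      then show "x \<in> {- h..<0}" using int[of "- k"] x by (auto simp: minus_equation_iff[of _ 1])
    qed
    moreover have "- h \<in> {-2 * h<..<0} \<inter> Z"
    proof -
      have "h * of_int (-1) \<in> Z" unfolding 2(2) by (rule rangeI)
      then show ?thesis using 2(1) by simp
    qed
    moreover have "0 < emeasure D {h..N}" using e(2) calculation(1) by (rule less_le_trans)
    ultimately show ?thesis
      by (intro exI[of _ h] exI[of _ "{-2 * h<..<0}"] conjI open_greaterThanLessThan) blast+
  qed
  then obtain e J where J: "emeasure D {e..N} > 0" "open J" "J \<inter> Z \<noteq> {}" "J \<inter> Z \<subseteq> {- e..<0}" by blast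
  have "emeasure D {e..N} \<le> step_op D (indicator {0..N}) y" if "y \<in> J \<inter> Z" for y
    using J(4) that by (intro step_op_indicator_ge) (auto dest!: subsetD)
  then show ?thesis
    unfolding enterable_def using J
    by (intro exI[of _ J] exI[of _ "{0..N}"] exI[of _ "emeasure D {e..N}"]) auto
qed

text \<open>The half-line omits 0, so the compact target must keep a distance from it: from
  \<open>[0, e / 2]\<close> a step down by at least \<open>e\<close> lands at or below
  \<open>- e / 2\<close>. In a lattice \<open>J\<close> isolates the point 0.\<close>

lemma enterable_neg:
  assumes Z: "Z \<noteq> {0}" shows "enterable D Z {..<0}"
proof -
  obtain e N where e: "0 < e" "emeasure D {- N..- e} > 0" using D_neg_interval[OF Z] .
  have "\<exists>J. open J \<and> J \<inter> Z \<noteq> {} \<and> J \<inter> Z \<subseteq> {0..e / 2}"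
  proof (cases rule: closed_subgroup_cases[OF closed_Z subgroup_Z Z])
    case 1
    have "e / 4 \<in> {0<..<e / 2}" using e by simp
    then show ?thesis using 1 by (intro exI[of _ "{0<..<e / 2}"]) auto
  next
    case (2 h)
    have "{- h<..<h} \<inter> Z \<subseteq> {0..e / 2}"
    proof
      fix x assume x: "x \<in> {- h<..<h} \<inter> Z"
      then have "x \<in> range (\<lambda>k::int. h * of_int k)" using 2 by blast
      then obtain k :: int where k: "x = h * of_int k" by blast
      have "\<bar>h * of_int k\<bar> < h" using x k by auto
      then have "\<bar>real_of_int k\<bar> < 1" using 2(1) by (simp add: abs_mult)
      then have "k = 0" by linarith
      then show "x \<in> {0..e / 2}" using k e by simp
    qed
    moreover have "0 \<in> {- h<..<h} \<inter> Z" using 2(1) subgroup_Z by (auto simp: additive_subgroup_def)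
    ultimately show ?thesis by (intro exI[of _ "{- h<..<h}"] conjI) (simp, blast)
  qed
  then obtain J where J: "open J" "J \<inter> Z \<noteq> {}" "J \<inter> Z \<subseteq> {0..e / 2}" by blast
  have "emeasure D {- N..- e} \<le> step_op D (indicator {- N..- (e / 2)}) y" if "y \<in> J \<inter> Z" for y
    using J(3) that by (intro step_op_indicator_ge) (auto dest!: subsetD)
  moreover have "{- N..- (e / 2)} \<subseteq> {..<0}" using e by auto
  ultimately show ?thesis
    unfolding enterable_def using J e
    by (intro exI[of _ J] exI[of _ "{- N..- (e / 2)}"] exI[of _ "emeasure D {- N..- e}"]) auto
qed

end

section \<open>Overshoots and first-step analysis\<close>

definition crosses :: "(nat \<Rightarrow> real) \<Rightarrow> nat \<Rightarrow> bool" where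
  "crosses s k \<longleftrightarrow> s (k - 1) < 0 \<and> s k \<ge> 0 \<or> s (k - 1) \<ge> 0 \<and> s k < 0"

lemma crossing_time_Suc: "crossing_time s (Suc n) = Inf {enat k | k. enat k > crossing_time s n \<and> crosses s k}"
  by (simp add: crosses_def)

declare crossing_time.simps(2) [simp del]

lemma Inf_enat_in: "A \<noteq> {} \<Longrightarrow> Inf A \<in> (A :: enat set)"
  unfolding Inf_enat_def by (auto intro: LeastI)

lemma eSuc_Inf_enat: "eSuc (Inf A) = Inf (eSuc ` A)"
proof (cases "A = {}")
  case False
  then have "Inf A \<in> A" by (rule Inf_enat_in)
  then show ?thesis
    by (intro antisym INF_greatest INF_lower) (auto intro: Inf_lower)
qed (simp add: top_enat_def)

text \<open>Shifting a path lowers its crossing times by one. Time 0 would be the exception, since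
  \<open>k - 1\<close> is truncated there, but the strict bound \<open>t < k\<close> excludes
  it.\<close>

lemma eSuc_image_crossings:
  "eSuc ` {enat k | k. enat k > t \<and> crosses (\<lambda>k. s (Suc k)) k} = {enat k | k. enat k > eSuc t \<and> crosses s k}"
proof safe
  fix k assume "t < enat k" "crosses (\<lambda>k. s (Suc k)) k"
  moreover then obtain j where "k = Suc j" by (cases k) (auto simp: enat_0)
  ultimately show "\<exists>l. eSuc (enat k) = enat l \<and> eSuc t < enat l \<and> crosses s l"
    by (intro exI[of _ "Suc k"]) (auto simp: crosses_def eSuc_enat[symmetric])
next
  fix k assume *: "eSuc t < enat k" "crosses s k"
  then obtain j where j: "k = Suc j" by (cases k) (auto simp: enat_0)
  then have "t < enat j" using * by (simp flip: eSuc_enat)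
  moreover then obtain i where "j = Suc i" by (cases j) (auto simp: enat_0)
  ultimately show "enat k \<in> eSuc ` {enat k |k. t < enat k \<and> crosses (\<lambda>k. s (Suc k)) k}"
    using * j by (intro image_eqI[of _ _ "enat j"]) (auto simp: crosses_def eSuc_enat)
qed

text \<open>A crossing at time 1 uses up one index, whereas without one the index survives the
  shift; these are the two branches of the first-step analysis.\<close>

lemma crossing_time_shift_crossing:
  assumes "crosses s 1" shows "crossing_time s (Suc n) = eSuc (crossing_time (\<lambda>k. s (Suc k)) n)"
proof (induction n)
  case 0
  have "Inf {enat k | k. enat k > 0 \<and> crosses s k} = 1"
  proof (rule antisym)
    show "Inf {enat k | k. enat k > 0 \<and> crosses s k} \<le> 1"
      using assms by (intro Inf_lower) (auto simp: one_enat_def enat_0_iff intro!: exI[of _ 1])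
    show "1 \<le> Inf {enat k | k. enat k > 0 \<and> crosses s k}"
      by (intro Inf_greatest) (auto simp: one_enat_def enat_0_iff)
  qed
  then show ?case by (simp add: crossing_time_Suc one_eSuc)
next
  case (Suc n)
  show ?case
    unfolding crossing_time_Suc[of s "Suc n"] crossing_time_Suc[of "\<lambda>k. s (Suc k)" n] Suc
    by (simp add: eSuc_Inf_enat eSuc_image_crossings)
qed

lemma crossing_time_shift_no_crossing:
  assumes "\<not> crosses s 1" shows "crossing_time s (Suc n) = eSuc (crossing_time (\<lambda>k. s (Suc k)) (Suc n))"
proof (induction n)
  case 0
  have "enat k > 0 \<and> crosses s k \<longleftrightarrow> enat k > eSuc 0 \<and> crosses s k" for k
  proof (cases "k \<le> 1")
    case True
    then have "k = 0 \<or> k = 1" by auto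
    then show ?thesis using assms by (auto simp: enat_0)
  next
    case False
    then show ?thesis by (simp add: one_eSuc[symmetric] one_enat_def enat_0_iff)
  qed
  then have "{enat k | k. enat k > 0 \<and> crosses s k} = {enat k | k. enat k > eSuc 0 \<and> crosses s k}" by blast
  then show ?case
    unfolding crossing_time_Suc crossing_time.simps(1) eSuc_Inf_enat eSuc_image_crossings
    by (rule arg_cong)
next
  case (Suc n)
  show ?case
    unfolding crossing_time_Suc[of s "Suc n"] crossing_time_Suc[of "\<lambda>k. s (Suc k)" "Suc n"] Suc
    by (simp add: eSuc_Inf_enat eSuc_image_crossings)
qed

lemma overshoot_0: "overshoot s 0 = s 0"
  by (simp add: overshoot_def zero_enat_def)

lemma overshoot_shift_crossing:
  "crosses s 1 \<Longrightarrow> overshoot s (Suc n) = overshoot (\<lambda>k. s (Suc k)) n"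
  unfolding overshoot_def crossing_time_shift_crossing
  by (cases "crossing_time (\<lambda>k. s (Suc k)) n") (simp_all add: eSuc_enat)

lemma overshoot_shift_no_crossing:
  "\<not> crosses s 1 \<Longrightarrow> overshoot s (Suc n) = overshoot (\<lambda>k. s (Suc k)) (Suc n)"
  unfolding overshoot_def crossing_time_shift_no_crossing
  by (cases "crossing_time (\<lambda>k. s (Suc k)) (Suc n)") (simp_all add: eSuc_enat)

text \<open>The infimum is spelled out by quantifiers over natural numbers, which makes
  measurability follow by induction on \<open>n\<close>.\<close>

lemma crossing_time_eq_enat:
  "crossing_time s (Suc n) = enat k \<longleftrightarrow>
    (\<exists>i<k. crossing_time s n = enat i) \<and> crosses s k \<and>
    (\<forall>j<k. \<not> ((\<exists>i<j. crossing_time s n = enat i) \<and> crosses s j))"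
proof -
  have less: "crossing_time s n < enat j \<longleftrightarrow> (\<exists>i<j. crossing_time s n = enat i)" for j
    by (cases "crossing_time s n") auto
  let ?A = "{enat k | k. crossing_time s n < enat k \<and> crosses s k}"
  have "Inf ?A = enat k \<longleftrightarrow> enat k \<in> ?A \<and> (\<forall>j<k. enat j \<notin> ?A)"
  proof
    assume eq: "Inf ?A = enat k"
    have "?A \<noteq> {}"
    proof
      assume "?A = {}"
      then have "Inf ?A = \<infinity>" by (simp only: Inf_empty top_enat_def)
      then show False using eq by simp
    qed
    then have "Inf ?A \<in> ?A" by (rule Inf_enat_in)
    moreover have "enat j \<notin> ?A" if "j < k" for j
      using Inf_lower[of "enat j" ?A] eq that by auto
    ultimately show "enat k \<in> ?A \<and> (\<forall>j<k. enat j \<notin> ?A)" using eq by simp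
  next
    assume *: "enat k \<in> ?A \<and> (\<forall>j<k. enat j \<notin> ?A)"
    show "Inf ?A = enat k"
    proof (rule antisym)
      show "Inf ?A \<le> enat k" using * by (intro Inf_lower) blast
      show "enat k \<le> Inf ?A"
      proof (rule Inf_greatest)
        fix a assume "a \<in> ?A"
        then obtain j where "a = enat j" "enat j \<in> ?A" by blast
        then show "enat k \<le> a" using * not_less by auto
      qed
    qed
  qed
  then show ?thesis by (simp add: crossing_time_Suc less)
qed

text \<open>The crossing time has countably many values, and for each of them the overshoot is a
  coordinate or the default 0.\<close>

lemma overshoot_measurable [measurable]:
  "(\<lambda>s. overshoot s n) \<in> borel_measurable (PiM UNIV (\<lambda>_::nat. borel))"
proof -
  let ?S = "PiM UNIV (\<lambda>_::nat. borel :: real measure)"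
  have [measurable]: "Measurable.pred ?S (\<lambda>s. crosses s k)" for k
    unfolding crosses_def by measurable
  have [measurable]: "Measurable.pred ?S (\<lambda>s. crossing_time s n = enat k)" for n k
  proof (induction n arbitrary: k)
    case 0
    show ?case by simp
  next
    case (Suc n)
    note [measurable] = Suc
    show ?case unfolding crossing_time_eq_enat by measurable
  qed
  have ct: "(\<lambda>s. crossing_time s n) \<in> ?S \<rightarrow>\<^sub>M count_space UNIV"
  proof (subst measurable_count_space_eq2_countable, safe)
    fix e
    show "(\<lambda>s. crossing_time s n) -` {e} \<inter> space ?S \<in> sets ?S"
    proof (cases e)
      case (enat k)
      have "{s \<in> space ?S. crossing_time s n = enat k} \<in> sets ?S" by measurable
      then show ?thesis using enat by (simp add: vimage_def Int_def conj_commute)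
    next
      case infinity
      have "{s \<in> space ?S. \<forall>k. crossing_time s n \<noteq> enat k} \<in> sets ?S" by measurable
      moreover have "{s \<in> space ?S. \<forall>k. crossing_time s n \<noteq> enat k} = (\<lambda>s. crossing_time s n) -` {e} \<inter> space ?S"
        using infinity by auto
      ultimately show ?thesis by simp
    qed
  qed auto
  have "(\<lambda>s. case e of enat k \<Rightarrow> s k | \<infinity> \<Rightarrow> 0) \<in> borel_measurable ?S" for e
    by (cases e) simp_all
  then show ?thesis
    unfolding overshoot_def by (rule measurable_compose_countable[OF _ ct])
qed

section \<open>Overshoot distributions as exit laws\<close>

locale overshoot_law = recurrent_law D Z L + steps: recurrent_steps D Z for D Z L
begin

abbreviation "S \<equiv> seq_space D"

definition overshoot_prob :: "nat \<Rightarrow> real set \<Rightarrow> real \<Rightarrow> ennreal" where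
  "overshoot_prob n B x = emeasure S {\<omega> \<in> space S. overshoot (\<lambda>k. x + partial_sum \<omega> k) n \<in> B}"

lemma walk_measurable [measurable]:
  "(\<lambda>(x, \<omega>). \<lambda>k. x + partial_sum \<omega> k) \<in> borel \<Otimes>\<^sub>M S \<rightarrow>\<^sub>M PiM UNIV (\<lambda>_::nat. borel)"
proof (rule measurable_PiM_single')
  fix k
  show "(\<lambda>p. (case p of (x, \<omega>) \<Rightarrow> \<lambda>k. x + partial_sum \<omega> k) k) \<in> borel_measurable (borel \<Otimes>\<^sub>M S)"
    by (simp add: split_beta')
qed (auto simp: space_PiM)

lemma overshoot_walk_measurable:
  "(\<lambda>(x, \<omega>). overshoot (\<lambda>k. x + partial_sum \<omega> k) n) \<in> borel_measurable (borel \<Otimes>\<^sub>M S)"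
  using measurable_compose[OF walk_measurable overshoot_measurable[of n]] by (simp add: split_beta')

lemma overshoot_event_sets:
  assumes "B \<in> sets borel"
  shows "{\<omega> \<in> space S. overshoot (\<lambda>k. x + partial_sum \<omega> k) n \<in> B} \<in> sets S"
proof -
  have "(\<lambda>\<omega>. overshoot (\<lambda>k. x + partial_sum \<omega> k) n) \<in> borel_measurable S"
    using measurable_compose[OF measurable_Pair1' overshoot_walk_measurable[of n], of x] by simp
  from measurable_sets[OF this assms] show ?thesis
    by (simp add: vimage_def Int_def conj_commute)
qed

lemma overshoot_prob_measurable [measurable]:
  assumes B: "B \<in> sets borel"
  shows "overshoot_prob n B \<in> borel_measurable borel"
proof -
  let ?Q = "(\<lambda>(x, \<omega>). overshoot (\<lambda>k. x + partial_sum \<omega> k) n) -` B \<inter> space (borel \<Otimes>\<^sub>M S)"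
  have "?Q \<in> sets (borel \<Otimes>\<^sub>M S)" by (rule measurable_sets[OF overshoot_walk_measurable B])
  then have "(\<lambda>x. emeasure S (Pair x -` ?Q)) \<in> borel_measurable borel"
    by (rule steps.P.measurable_emeasure_Pair)
  moreover have "Pair x -` ?Q = {\<omega> \<in> space S. overshoot (\<lambda>k. x + partial_sum \<omega> k) n \<in> B}" for x
    by (auto simp: space_pair_measure)
  ultimately show ?thesis by (simp add: overshoot_prob_def[abs_def])
qed

lemma overshoot_prob_le_1: "overshoot_prob n B x \<le> 1"
  unfolding overshoot_prob_def by (rule steps.P.measure_le_1)

lemma overshoot_prob_0: "overshoot_prob 0 B x = indicator B x"
  using steps.P.emeasure_space_1
  by (cases "x \<in> B") (simp_all add: overshoot_prob_def overshoot_0 partial_sum_0)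

text \<open>For a half-line, leaving \<open>A\<close> in the first step is the same as crossing at
  time 1: a step inside keeps the number of pending crossings, a step outside lowers it by
  one.\<close>

lemma overshoot_prob_Suc:
  assumes B [measurable]: "B \<in> sets borel" and A: "A = {0..} \<or> A = {..<0}" and x: "x \<in> A"
  shows "overshoot_prob (Suc n) B x =
    killed (- A) (overshoot_prob n B) x + killed A (overshoot_prob (Suc n) B) x"
proof -
  have [measurable]: "A \<in> sets borel" using A by auto
  let ?E = "\<lambda>n x. {\<omega> \<in> space S. overshoot (\<lambda>k. x + partial_sum \<omega> k) n \<in> B}"
  let ?f = "\<lambda>y. indicator (- A) y * overshoot_prob n B y + indicator A y * overshoot_prob (Suc n) B y"
  have eq: "emeasure S (case_nat y -` ?E (Suc n) x \<inter> space S) = ?f (x + y)" for y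
  proof -
    have space: "case_nat y \<omega> \<in> space S" if "\<omega> \<in> space S" for \<omega>
      using that sets_eq_imp_space_eq[OF sets_D] by (auto simp: space_PiM split: nat.split)
    have ov: "overshoot (\<lambda>k. x + partial_sum (case_nat y \<omega>) k) (Suc n) =
      overshoot (\<lambda>k. x + y + partial_sum \<omega> k) (if x + y \<in> A then Suc n else n)" for \<omega>
    proof -
      let ?s = "\<lambda>k. x + partial_sum (case_nat y \<omega>) k"
      have s': "(\<lambda>k. ?s (Suc k)) = (\<lambda>k. x + y + partial_sum \<omega> k)"
        by (simp add: partial_sum_case_nat add.assoc)
      have "?s 0 = x" "?s 1 = x + y"
        using partial_sum_case_nat[of y \<omega> 0] by (simp_all add: partial_sum_0)
      then have "crosses ?s 1 \<longleftrightarrow> x + y \<notin> A"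
        using A x by (auto simp: crosses_def)
      then show ?thesis
        using overshoot_shift_crossing[of ?s n] overshoot_shift_no_crossing[of ?s n] unfolding s' by simp
    qed
    have "case_nat y -` ?E (Suc n) x \<inter> space S = ?E (if x + y \<in> A then Suc n else n) (x + y)"
      using space by (auto simp: ov)
    then show ?thesis
      by (cases "x + y \<in> A") (simp_all add: overshoot_prob_def)
  qed
  have "overshoot_prob (Suc n) B x = St ?f x"
    unfolding overshoot_prob_def[of "Suc n" B x] step_op_def
    by (subst steps.emeasure_S_first_step[OF overshoot_event_sets[OF B]]) (simp only: eq)
  also have "\<dots> = killed (- A) (overshoot_prob n B) x + killed A (overshoot_prob (Suc n) B) x"
    unfolding killed_def by (rule St_add) measurable
  finally show ?thesis .
qed

text \<open>The first-step equation has only one bounded solution, so the random exit time itself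
  never has to be analysed.\<close>

lemma overshoot_prob_exit:
  assumes B [measurable]: "B \<in> sets borel" and A: "A = {0..} \<or> A = {..<0}"
    and G: "open G" "G \<inter> Z \<noteq> {}" "G \<inter> Z \<inter> A = {}" and x: "x \<in> Z \<inter> A"
  shows "overshoot_prob (Suc n) B x = exit_op A (overshoot_prob n B) x"
proof (rule exit_unique[OF _ G _ _ _ _ x])
  show "A \<in> sets borel" using A by auto
  show "overshoot_prob (Suc n) B x \<le> 1" for x by (rule overshoot_prob_le_1)
  show "overshoot_prob (Suc n) B x =
      killed (- A) (overshoot_prob n B) x + killed A (overshoot_prob (Suc n) B) x" if "x \<in> Z \<inter> A" for x
    using that by (intro overshoot_prob_Suc[OF B A]) auto
qed measurable

lemma overshoot_prob_1:
  assumes "B \<in> sets borel" "A = {0..} \<or> A = {..<0}"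
    "open G" "G \<inter> Z \<noteq> {}" "G \<inter> Z \<inter> A = {}" "x \<in> Z \<inter> A"
  shows "overshoot_prob 1 B x = exit_op A (indicator B) x"
  using overshoot_prob_exit[OF assms, of 0] by (simp add: overshoot_prob_0[abs_def])

lemma overshoot_prob_2:
  assumes B: "B \<in> sets borel" and A: "A = {0..} \<or> A = {..<0}"
    and G: "open G" "G \<inter> Z \<noteq> {}" "G \<inter> Z \<inter> A = {}" and G': "open G'" "G' \<inter> Z \<noteq> {}" "G' \<inter> Z \<inter> - A = {}"
    and x: "x \<in> Z \<inter> A"
  shows "overshoot_prob 2 B x = exit_op A (exit_op (- A) (indicator B)) x"
proof -
  have A': "- A = {0..} \<or> - A = {..<0}" using A by auto
  have "overshoot_prob 2 B x = exit_op A (overshoot_prob 1 B) x"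
    using overshoot_prob_exit[OF B A G x, of 1] by (simp add: numeral_2_eq_2)
  also have "\<dots> = exit_op A (exit_op (- A) (indicator B)) x"
    using x by (intro exit_cong overshoot_prob_1[OF B A' G']) auto
  finally show ?thesis .
qed

end

section \<open>Chains given by operators\<close>

lemma sets_borel_on_iff: "E \<in> sets borel \<Longrightarrow> B \<in> sets (borel_on E) \<longleftrightarrow> B \<in> sets borel \<and> B \<subseteq> E"
  by (auto simp: sets_restrict_space_iff)

text \<open>Operators act on functions on the whole line, while the chain lives on \<open>E\<close>;
  \<open>T_cong\<close> says that from \<open>E\<close> only values on \<open>E\<close>
  matter.\<close>

locale op_chain =
  fixes E :: "real set" and T :: "(real \<Rightarrow> ennreal) \<Rightarrow> real \<Rightarrow> ennreal" and K :: "real \<Rightarrow> real measure"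
  assumes E [measurable]: "E \<in> sets borel"
    and T: "kernel_op T"
    and T_cong: "\<And>f g x. x \<in> E \<Longrightarrow> (\<And>y. y \<in> E \<Longrightarrow> f y = g y) \<Longrightarrow> T f x = T g x"
    and T_1: "\<And>x. x \<in> E \<Longrightarrow> T (\<lambda>_. 1) x = 1"
    and sets_K: "\<And>x. x \<in> E \<Longrightarrow> sets (K x) = sets (borel_on E)"
    and emeasure_K: "\<And>x B. x \<in> E \<Longrightarrow> B \<in> sets (borel_on E) \<Longrightarrow> emeasure (K x) B = T (indicator B) x"
begin

lemmas T_measurable [measurable] = kernel_op_measurable[OF T]

lemma K_prob: assumes x: "x \<in> E" shows "prob_space (K x)"
proof (rule prob_spaceI)
  have "E \<in> sets (borel_on E)" using sets.top[of "borel_on E"] by (simp add: space_restrict_space)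
  then have "emeasure (K x) E = T (indicator E) x" by (rule emeasure_K[OF x])
  also have "\<dots> = T (\<lambda>_. 1) x" by (rule T_cong[OF x]) simp
  finally show "emeasure (K x) (space (K x)) = 1"
    using T_1[OF x] sets_eq_imp_space_eq[OF sets_K[OF x]] by (simp add: space_restrict_space)
qed

lemma borel_chain: "borel_chain E K"
proof
  show "K \<in> borel_on E \<rightarrow>\<^sub>M prob_algebra (borel_on E)"
  proof (rule measurable_prob_algebraI)
    show "prob_space (K x)" if "x \<in> space (borel_on E)" for x
      using that K_prob by (simp add: space_restrict_space)
    show "K \<in> borel_on E \<rightarrow>\<^sub>M subprob_algebra (borel_on E)"
    proof (rule measurable_subprob_algebra)
      fix B assume B: "B \<in> sets (borel_on E)"
      then have "B \<in> sets borel" by (simp add: sets_borel_on_iff)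
      then have "T (indicator B) \<in> borel_measurable (borel_on E)"
        by (intro measurable_restrict_space1 T_measurable) auto
      then show "(\<lambda>x. emeasure (K x) B) \<in> borel_measurable (borel_on E)"
        using emeasure_K[OF _ B] by (subst measurable_cong[where g="T (indicator B)"]) (auto simp: space_restrict_space)
    qed (auto simp: space_restrict_space K_prob sets_K intro: prob_space_imp_subprob_space)
  qed
qed

lemma nn_integral_K:
  assumes x: "x \<in> E" and f: "f \<in> borel_measurable (borel_on E)"
  shows "(\<integral>\<^sup>+y. f y \<partial>K x) = T (\<lambda>y. f y * indicator E y) x"
proof -
  have f' [measurable]: "(\<lambda>y. f y * indicator E y) \<in> borel_measurable borel"
    using f by (simp add: borel_measurable_restrict_space_iff_ennreal)
  \<comment> \<open>Pushing the point mass at \<open>x\<close> through \<open>T\<close> recovers the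
    kernel at \<open>x\<close> as a measure on the line; \<open>K x\<close> is its restriction to
    \<open>E\<close>.\<close>
  obtain \<mu> where \<mu>: "sets \<mu> = sets borel"
    and int: "\<And>f. f \<in> borel_measurable borel \<Longrightarrow> (\<integral>\<^sup>+y. f y \<partial>\<mu>) = (\<integral>\<^sup>+y. T f y \<partial>return borel x)"
    using kernel_op_push_measure[OF T, of "return borel x"] by auto
  have E\<mu>: "E \<inter> space \<mu> \<in> sets \<mu>" using sets_eq_imp_space_eq[OF \<mu>] by (simp add: \<mu>)
  have "K x = restrict_space \<mu> E"
  proof (rule measure_eqI)
    show s: "sets (K x) = sets (restrict_space \<mu> E)"
      using sets_K[OF x] by (simp add: sets_restrict_space \<mu>)
    fix B assume "B \<in> sets (K x)"
    then have B: "B \<in> sets (borel_on E)" using sets_K[OF x] by simp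
    then have B': "B \<in> sets borel" "B \<subseteq> E" by (auto simp: sets_borel_on_iff)
    have "emeasure (restrict_space \<mu> E) B = (\<integral>\<^sup>+y. indicator B y \<partial>\<mu>)"
      using E\<mu> B' by (simp add: emeasure_restrict_space \<mu>)
    also have "\<dots> = T (indicator B) x"
      using B' by (subst int) (auto simp: nn_integral_return)
    finally show "emeasure (K x) B = emeasure (restrict_space \<mu> E) B"
      using emeasure_K[OF x B] by simp
  qed
  then have "(\<integral>\<^sup>+y. f y \<partial>K x) = (\<integral>\<^sup>+y. f y * indicator E y \<partial>\<mu>)"
    using nn_integral_restrict_space[OF E\<mu>] by simp
  also have "\<dots> = T (\<lambda>y. f y * indicator E y) x"
    by (subst int) (auto simp: nn_integral_return)
  finally show ?thesis .
qed

text \<open>Everything is transferred from measures on \<open>E\<close> to measures on the line that are carried by \<open>E\<close>.\<close>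

lemma chain_properties:
  assumes \<Lambda>: "sets \<Lambda> = sets borel" and \<Lambda>_E: "AE x in \<Lambda>. x \<in> E"
    and bounded: "\<And>r. emeasure \<Lambda> {- r..r} < \<infinity>"
    and inv: "\<And>f. f \<in> borel_measurable borel \<Longrightarrow> (\<integral>\<^sup>+x. T f x \<partial>\<Lambda>) = (\<integral>\<^sup>+x. f x \<partial>\<Lambda>)"
    and \<nu>: "sets \<nu> = sets (borel_on E)"
    and \<nu>_eq: "\<And>B. B \<in> sets (borel_on E) \<Longrightarrow> emeasure \<nu> B = emeasure \<Lambda> B"
    and E_ne: "E \<noteq> {}"
    and C: "C \<in> sets borel" "C \<subseteq> {- r..r}"
    and no_escape: "\<And>w x. w \<in> borel_measurable borel \<Longrightarrow> (\<And>x. w x \<le> 1) \<Longrightarrow>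
      (\<And>x. x \<in> E \<Longrightarrow> w x = T (\<lambda>y. indicator (- C) y * w y) x) \<Longrightarrow> x \<in> E \<Longrightarrow> w x = 0"
    and Liouville: "\<And>h. h \<in> borel_measurable borel \<Longrightarrow> (\<And>x. h x \<le> 1) \<Longrightarrow>
      (AE x in \<Lambda>. h x = T h x) \<Longrightarrow> \<exists>c. AE x in \<Lambda>. h x = c"
    and unique: "\<And>\<Lambda>'. sets \<Lambda>' = sets borel \<Longrightarrow> AE x in \<Lambda>'. x \<in> E \<Longrightarrow>
      (\<And>C. compact C \<Longrightarrow> C \<subseteq> E \<Longrightarrow> emeasure \<Lambda>' C < \<infinity>) \<Longrightarrow>
      (\<And>f. f \<in> borel_measurable borel \<Longrightarrow> (\<integral>\<^sup>+x. T f x \<partial>\<Lambda>') = (\<integral>\<^sup>+x. f x \<partial>\<Lambda>')) \<Longrightarrow>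
      \<exists>c<\<infinity>. \<Lambda>' = scale_measure c \<Lambda>"
  shows "recurrent_measure E K \<nu> \<and> ergodic_measure E K \<nu> \<and> uniquely_invariant_measure E K \<nu>"
proof -
  have space_\<Lambda>: "space \<Lambda> = UNIV" using sets_eq_imp_space_eq[OF \<Lambda>] by simp
  have [measurable_cong]: "sets \<Lambda> = sets borel" by (rule \<Lambda>)
  have E\<Lambda>: "E \<inter> space \<Lambda> \<in> sets \<Lambda>" by (simp add: space_\<Lambda> \<Lambda>)
  interpret borel_chain E K by (rule borel_chain)
  have \<nu>_restrict: "\<nu> = restrict_space \<Lambda> E"
  proof (rule measure_eqI)
    show "sets \<nu> = sets (restrict_space \<Lambda> E)" by (simp add: \<nu> sets_restrict_space \<Lambda>)
    fix B assume "B \<in> sets \<nu>"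
    then have "B \<in> sets (borel_on E)" by (simp add: \<nu>)
    then show "emeasure \<nu> B = emeasure (restrict_space \<Lambda> E) B"
      using \<nu>_eq E\<Lambda> by (subst emeasure_restrict_space) (auto simp: sets_borel_on_iff)
  qed
  have AE_\<nu>: "(AE x in \<nu>. P x) \<longleftrightarrow> (AE x in \<Lambda>. P x)" for P
  proof -
    have "(AE x in \<nu>. P x) \<longleftrightarrow> (AE x in \<Lambda>. x \<in> E \<longrightarrow> P x)"
      unfolding \<nu>_restrict by (rule AE_restrict_space_iff[OF E\<Lambda>])
    also have "\<dots> \<longleftrightarrow> (AE x in \<Lambda>. P x)"
      using \<Lambda>_E by (auto elim!: eventually_elim2)
    finally show ?thesis .
  qed
  have int_\<nu>: "(\<integral>\<^sup>+x. f x \<partial>\<nu>) = (\<integral>\<^sup>+x. f x \<partial>\<Lambda>)" for f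
  proof -
    have "(\<integral>\<^sup>+x. f x \<partial>\<nu>) = (\<integral>\<^sup>+x. f x * indicator E x \<partial>\<Lambda>)"
      unfolding \<nu>_restrict by (rule nn_integral_restrict_space[OF E\<Lambda>])
    also have "\<dots> = (\<integral>\<^sup>+x. f x \<partial>\<Lambda>)"
      using \<Lambda>_E by (intro nn_integral_cong_AE) (auto elim!: eventually_mono)
    finally show ?thesis .
  qed
  have "invariant_measure E K \<nu>"
    unfolding invariant_measure_def
  proof (intro conjI ballI \<nu>)
    fix B assume B: "B \<in> sets (borel_on E)"
    then have B': "B \<in> sets borel" by (simp add: sets_borel_on_iff)
    have "(\<integral>\<^sup>+x. emeasure (K x) B \<partial>\<nu>) = (\<integral>\<^sup>+x. T (indicator B) x \<partial>\<nu>)"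
      using emeasure_K[OF _ B] sets_eq_imp_space_eq[OF \<nu>] by (intro nn_integral_cong) auto
    also have "\<dots> = emeasure \<Lambda> B"
      unfolding int_\<nu> using B' by (subst inv) (auto simp: \<Lambda>)
    finally show "(\<integral>\<^sup>+x. emeasure (K x) B \<partial>\<nu>) = emeasure \<nu> B" by (simp add: \<nu>_eq[OF B])
  qed
  moreover have "sigma_finite_measure \<nu>"
    unfolding \<nu>_restrict
    by (intro sigma_finite_measure_restrict_space sigma_finite_of_bounded[OF \<Lambda> bounded]) (simp add: \<Lambda>)
  ultimately interpret invariant_chain E K \<nu>
    using E_ne by (intro invariant_chain.intro borel_chain invariant_chain_axioms.intro)
  have restrict_meas: "(\<lambda>x. f x * indicator E x) \<in> borel_measurable borel"
    if "f \<in> borel_measurable (borel_on E)" for f :: "real \<Rightarrow> ennreal"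
    using that by (simp add: borel_measurable_restrict_space_iff_ennreal)
  have bounded_\<nu>: "emeasure \<nu> (B \<inter> E) < \<infinity>" if "B \<in> sets borel" "B \<subseteq> {- r..r}" for B r
  proof -
    have "emeasure \<nu> (B \<inter> E) = emeasure \<Lambda> (B \<inter> E)"
      using that by (intro \<nu>_eq) (auto simp: sets_borel_on_iff)
    also have "\<dots> \<le> emeasure \<Lambda> {- r..r}"
      using that by (intro emeasure_mono) (auto simp: \<Lambda>)
    also have "\<dots> < \<infinity>" by (rule bounded)
    finally show ?thesis .
  qed
  have "recurrent_measure E K \<nu>"
  proof (rule recurrent_measureI)
    show "C \<inter> E \<in> sets (borel_on E)" using C by (auto simp: sets_borel_on_iff)
    show "emeasure \<nu> (C \<inter> E) < \<infinity>" by (rule bounded_\<nu>[OF C])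
    show "no_escape (C \<inter> E)"
      unfolding no_escape_def
    proof (intro ballI impI)
      fix w x assume w: "w \<in> borel_measurable (borel_on E)" "\<forall>x\<in>E. w x \<le> 1"
        "\<forall>x\<in>E. w x = (\<integral>\<^sup>+y. indicator (- (C \<inter> E)) y * w y \<partial>K x)" and x: "x \<in> E"
      let ?w = "\<lambda>x. w x * indicator E x"
      have "?w x = 0"
      proof (rule no_escape[OF restrict_meas[OF w(1)] _ _ x])
        show "?w x \<le> 1" for x using w(2) by (auto simp: indicator_def)
        show "?w x = T (\<lambda>y. indicator (- C) y * ?w y) x" if x: "x \<in> E" for x
        proof -
          have "indicator (- (C \<inter> E)) \<in> borel_measurable (borel_on E)"
            using C by (intro measurable_restrict_space1) simp
          then have m: "(\<lambda>y. indicator (- (C \<inter> E)) y * w y) \<in> borel_measurable (borel_on E)"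
            using w(1) by (rule borel_measurable_times_ennreal)
          have "?w x = T (\<lambda>y. indicator (- (C \<inter> E)) y * w y * indicator E y) x"
            using w(3) x nn_integral_K[OF x m] by simp
          also have "\<dots> = T (\<lambda>y. indicator (- C) y * ?w y) x"
            by (rule T_cong[OF x]) (auto simp: indicator_def)
          finally show ?thesis .
        qed
      qed
      then show "w x = 0" using x by simp
    qed
  qed
  moreover have "ergodic_measure E K \<nu>"
  proof (rule ergodic_measureI)
    fix h assume h: "h \<in> borel_measurable (borel_on E)" "\<And>x. x \<in> E \<Longrightarrow> h x \<le> 1"
      "AE x in \<nu>. h x = (\<integral>\<^sup>+y. h y \<partial>K x)"
    let ?h = "\<lambda>x. h x * indicator E x"
    have "AE x in \<Lambda>. ?h x = T ?h x"
      using h(3) \<Lambda>_E unfolding AE_\<nu> by eventually_elim (simp add: nn_integral_K[OF _ h(1)])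
    moreover have "?h x \<le> 1" for x using h(2) by (cases "x \<in> E") auto
    ultimately obtain c where "AE x in \<Lambda>. ?h x = c"
      using Liouville[OF restrict_meas[OF h(1)]] by blast
    then have "AE x in \<nu>. h x = c"
      using \<Lambda>_E unfolding AE_\<nu> by eventually_elim simp
    then show "\<exists>c. AE x in \<nu>. h x = c" by blast
  qed
  moreover have "uniquely_invariant_measure E K \<nu>"
    unfolding uniquely_invariant_measure_def
  proof (intro conjI allI impI)
    show "invariant_measure E K \<nu>" by (rule inv)
    show "locally_finite_on E \<nu>"
      unfolding locally_finite_on_def
    proof
      fix x assume "x \<in> E"
      have "{x - 1<..<x + 1} \<subseteq> {- (\<bar>x\<bar> + 1)..\<bar>x\<bar> + 1}" by auto
      from bounded_\<nu>[OF _ this] have "emeasure \<nu> ({x - 1<..<x + 1} \<inter> E) < \<infinity>" by simp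
      then show "\<exists>U. open U \<and> x \<in> U \<and> emeasure \<nu> (U \<inter> E) < \<infinity>"
        by (intro exI[of _ "{x - 1<..<x + 1}"]) auto
    qed
    fix \<nu>' assume "invariant_measure E K \<nu>' \<and> locally_finite_on E \<nu>'"
    then have \<nu>': "sets \<nu>' = sets (borel_on E)"
      and inv': "\<And>B. B \<in> sets (borel_on E) \<Longrightarrow> (\<integral>\<^sup>+x. emeasure (K x) B \<partial>\<nu>') = emeasure \<nu>' B"
      and fin': "\<And>x. x \<in> E \<Longrightarrow> \<exists>U. open U \<and> x \<in> U \<and> emeasure \<nu>' (U \<inter> E) < \<infinity>"
      by (auto simp: invariant_measure_def locally_finite_on_def)
    have space_\<nu>': "space \<nu>' = E" using sets_eq_imp_space_eq[OF \<nu>'] by (simp add: space_restrict_space)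
    have id: "(\<lambda>x. x) \<in> \<nu>' \<rightarrow>\<^sub>M borel"
      unfolding measurable_cong_sets[OF \<nu>' refl] by (intro measurable_restrict_space1) simp
    \<comment> \<open>The competing invariant measure is extended by zero to the line, where
      \<open>unique\<close> applies.\<close>
    define \<Lambda>' where "\<Lambda>' = distr \<nu>' borel (\<lambda>x. x)"
    have \<Lambda>': "sets \<Lambda>' = sets borel" by (simp add: \<Lambda>'_def)
    have em: "emeasure \<Lambda>' B = emeasure \<nu>' (B \<inter> E)" if "B \<in> sets borel" for B
      using that unfolding \<Lambda>'_def by (subst emeasure_distr[OF id]) (simp_all add: space_\<nu>')
    have int': "(\<integral>\<^sup>+x. f x \<partial>\<Lambda>') = (\<integral>\<^sup>+x. f x \<partial>\<nu>')" if "f \<in> borel_measurable borel" for f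
      unfolding \<Lambda>'_def using that by (subst nn_integral_distr[OF id]) auto
    have "\<exists>c<\<infinity>. \<Lambda>' = scale_measure c \<Lambda>"
    proof (rule unique[OF \<Lambda>'])
      show "AE x in \<Lambda>'. x \<in> E"
        using em[of "- E"] by (intro AE_I[of _ _ "- E"]) (auto simp: \<Lambda>')
      show "emeasure \<Lambda>' C < \<infinity>" if C: "compact C" "C \<subseteq> E" for C
      proof -
        \<comment> \<open>Local finiteness refers to the subspace topology of \<open>E\<close>: it
          controls compact subsets of \<open>E\<close>, but not bounded ones near an end point that
          \<open>E\<close> omits.\<close>
        obtain U where U: "\<And>x. x \<in> C \<Longrightarrow> open (U x) \<and> x \<in> U x \<and> emeasure \<nu>' (U x \<inter> E) < \<infinity>"
          using fin' C by (metis subsetD)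
        obtain F where F: "F \<subseteq> C" "finite F" "C \<subseteq> (\<Union>x\<in>F. U x)"
          by (rule compactE_image[OF C(1), of C U]) (use U in auto)
        have s: "U x \<inter> E \<in> sets \<nu>'" if "x \<in> F" for x
          using U[of x] F(1) that borel_open[of "U x"] by (auto simp: \<nu>' sets_borel_on_iff)
        have "emeasure \<Lambda>' C = emeasure \<nu>' C"
          using em[of C] C by (simp add: borel_compact Int_absorb2)
        also have "\<dots> \<le> emeasure \<nu>' (\<Union>x\<in>F. U x \<inter> E)"
          using F C s by (intro emeasure_mono sets.finite_UN) auto
        also have "\<dots> \<le> (\<Sum>x\<in>F. emeasure \<nu>' (U x \<inter> E))"
          using F s by (intro emeasure_subadditive_finite) auto
        also have "\<dots> < \<infinity>"
          using F U by (auto simp: subset_eq)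
        finally show ?thesis .
      qed
      fix f :: "real \<Rightarrow> ennreal" assume f: "f \<in> borel_measurable borel"
      \<comment> \<open>Invariance of the competitor is given on sets only; comparing it with its
        image under \<open>T\<close> extends this to functions.\<close>
      obtain \<mu> where \<mu>: "sets \<mu> = sets borel"
        and int: "\<And>f. f \<in> borel_measurable borel \<Longrightarrow> (\<integral>\<^sup>+y. f y \<partial>\<mu>) = (\<integral>\<^sup>+y. T f y \<partial>\<Lambda>')"
        using kernel_op_push_measure[OF T \<Lambda>'] by blast
      have "\<mu> = \<Lambda>'"
      proof (rule measure_eqI)
        fix B assume "B \<in> sets \<mu>"
        then have B: "B \<in> sets borel" by (simp add: \<mu>)
        then have BE: "B \<inter> E \<in> sets (borel_on E)" by (auto simp: sets_borel_on_iff)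
        have "emeasure \<mu> B = (\<integral>\<^sup>+y. T (indicator B) y \<partial>\<Lambda>')"
          using B int[of "indicator B"] by (simp add: \<mu>)
        also have "\<dots> = (\<integral>\<^sup>+y. T (indicator B) y \<partial>\<nu>')"
          using B by (intro int' T_measurable) simp
        also have "\<dots> = (\<integral>\<^sup>+y. emeasure (K y) (B \<inter> E) \<partial>\<nu>')"
          using emeasure_K[OF _ BE]
          by (intro nn_integral_cong) (auto simp: space_\<nu>' intro!: T_cong split: split_indicator)
        also have "\<dots> = emeasure \<Lambda>' B"
          by (simp add: inv'[OF BE] em[OF B])
        finally show "emeasure \<mu> B = emeasure \<Lambda>' B" .
      qed (simp add: \<mu> \<Lambda>')
      then show "(\<integral>\<^sup>+x. T f x \<partial>\<Lambda>') = (\<integral>\<^sup>+x. f x \<partial>\<Lambda>')"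
        using int[OF f] by simp
    qed
    then obtain c where c: "c < \<infinity>" "\<Lambda>' = scale_measure c \<Lambda>" by blast
    have "\<nu>' = scale_measure (ennreal (enn2real c)) \<nu>"
    proof (rule measure_eqI)
      fix B assume "B \<in> sets \<nu>'"
      then have B: "B \<in> sets (borel_on E)" by (simp add: \<nu>')
      then have B': "B \<in> sets borel" "B \<inter> E = B" by (auto simp: sets_borel_on_iff)
      have "emeasure \<nu>' B = emeasure \<Lambda>' B" using em[OF B'(1)] B'(2) by simp
      then show "emeasure \<nu>' B = emeasure (scale_measure (ennreal (enn2real c)) \<nu>) B"
        using c \<nu>_eq[OF B] by simp
    qed (simp add: \<nu> \<nu>')
    then show "\<exists>c::real. c \<ge> 0 \<and> \<nu>' = scale_measure (ennreal c) \<nu>"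
      using enn2real_nonneg by blast
  qed
  ultimately show ?thesis by blast
qed

end

section \<open>The chains of entrances and of exits\<close>

context two_sided_law
begin

lemma entrance_bounded:
  assumes [measurable]: "A \<in> sets borel" shows "emeasure (entrance A) {- r..r} < \<infinity>"
proof -
  have le: "indicator A x * dual.St (indicator (- A)) x \<le> 1" for x
  proof -
    have "dual.St (indicator (- A)) x \<le> dual.St (\<lambda>_. 1) x"
      unfolding step_op_def by (intro nn_integral_mono) (auto simp: indicator_def)
    then show ?thesis by (auto simp: indicator_def dual.St_const)
  qed
  have "emeasure (entrance A) {- r..r} =
      (\<integral>\<^sup>+x. indicator A x * dual.St (indicator (- A)) x * indicator {- r..r} x \<partial>L)"
    unfolding entrance_def by (rule emeasure_density) (auto simp: sets_L)
  also have "\<dots> \<le> (\<integral>\<^sup>+x. indicator {- r..r} x \<partial>L)"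
  proof (rule nn_integral_mono)
    fix x
    show "indicator A x * dual.St (indicator (- A)) x * indicator {- r..r} x \<le> (indicator {- r..r} x :: ennreal)"
      using mult_right_mono[OF le[of x], of "indicator {- r..r} x"] by simp
  qed
  also have "\<dots> < \<infinity>" using L_bounded[of r] by (simp add: sets_L)
  finally show ?thesis .
qed

lemma AE_entrance_mem: "A \<in> sets borel \<Longrightarrow> AE x in entrance A. x \<in> Z \<inter> A"
  using L_Z by (intro AE_entrance) (auto elim!: eventually_mono)

text \<open>With \<open>b\<close> the indicator of the set where they differ, each function is at
  most the other plus \<open>\<infinity> * b\<close>, and \<open>T\<close> annihilates the second
  term at \<open>x\<close>.\<close>

lemma kernel_op_null:
  assumes T: "kernel_op T" and [measurable]: "f \<in> borel_measurable borel" "g \<in> borel_measurable borel"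
    and null: "T (\<lambda>y. if f y = g y then 0 else 1) x = 0"
  shows "T f x = T g x"
proof -
  have *: "T f x \<le> T g x" if [measurable]: "f \<in> borel_measurable borel" "g \<in> borel_measurable borel"
    and null: "T (\<lambda>y. if f y = g y then 0 else 1) x = 0" for f g
  proof -
    let ?b = "\<lambda>y. if f y = g y then 0 else 1 :: ennreal"
    have b [measurable]: "?b \<in> borel_measurable borel" by measurable
    have "T f x \<le> T (\<lambda>y. g y + \<infinity> * ?b y) x"
      using kernel_op_mono[OF T, of f "\<lambda>y. g y + \<infinity> * ?b y"] by (auto simp: le_fun_def)
    also have "\<dots> = T g x + T (\<lambda>y. \<infinity> * ?b y) x"
      by (subst kernel_op_add[OF T]) auto
    also have "T (\<lambda>y. \<infinity> * ?b y) x = 0"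
      by (subst kernel_op_cmult[OF T b]) (simp add: null)
    finally show ?thesis by simp
  qed
  have "(\<lambda>y. if g y = f y then 0 else 1 :: ennreal) = (\<lambda>y. if f y = g y then 0 else 1)" by auto
  then show ?thesis using *[of f g] *[of g f] null by (intro antisym) auto
qed

lemma entrance_chain_properties:
  assumes A [measurable]: "A \<in> sets borel" and A1: "enterable D Z A" and A2: "enterable D Z (- A)"
    and K: "\<And>x. x \<in> Z \<inter> A \<Longrightarrow> sets (K x) = sets (borel_on (Z \<inter> A))"
      "\<And>x B. x \<in> Z \<inter> A \<Longrightarrow> B \<in> sets (borel_on (Z \<inter> A)) \<Longrightarrow>
        emeasure (K x) B = exit_op A (exit_op (- A) (indicator B)) x"
    and \<nu>: "sets \<nu> = sets (borel_on (Z \<inter> A))"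
      "\<And>B. B \<in> sets (borel_on (Z \<inter> A)) \<Longrightarrow> emeasure \<nu> B = emeasure (entrance A) B"
  shows "recurrent_measure (Z \<inter> A) K \<nu> \<and> ergodic_measure (Z \<inter> A) K \<nu> \<and>
    uniquely_invariant_measure (Z \<inter> A) K \<nu>"
proof -
  obtain J C p where J: "open J" "J \<inter> Z \<noteq> {}" "J \<inter> Z \<inter> A = {}" and C: "compact C" "C \<subseteq> A"
    and p: "0 < p" "\<And>y. y \<in> J \<inter> Z \<Longrightarrow> p \<le> St (indicator C) y"
    using A1 unfolding enterable_def by blast
  obtain J' where J': "open J'" "J' \<inter> Z \<noteq> {}" "J' \<inter> Z \<inter> - A = {}"
    using A2 unfolding enterable_def by blast
  let ?T = "\<lambda>f. exit_op A (exit_op (- A) f)"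
  interpret op_chain "Z \<inter> A" ?T K
  proof
    show "kernel_op ?T" by (intro kernel_op_comp[OF kernel_op_exit kernel_op_exit]) auto
    show "?T f x = ?T g x" if "x \<in> Z \<inter> A" "\<And>y. y \<in> Z \<inter> A \<Longrightarrow> f y = g y" for f g x
      using that by (intro exit_cong) auto
    show "?T (\<lambda>_. 1) x = 1" if "x \<in> Z \<inter> A" for x
    proof -
      have "?T (\<lambda>_. 1) x = exit_op A (\<lambda>_. 1) x"
        using that exit_1[OF _ J'] by (intro exit_cong) auto
      then show ?thesis using exit_1[OF A J, of x] that by simp
    qed
  qed (use K in auto)
  have Cb: "C \<in> sets borel" using C by (simp add: borel_compact)
  obtain r where "C \<subseteq> {- r..r}"
    using compact_imp_bounded[OF C(1)] unfolding bounded_iff by (auto simp: abs_le_iff subset_eq minus_le_iff)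
  show ?thesis
  proof (rule chain_properties[OF sets_entrance AE_entrance_mem[OF A] entrance_bounded[OF A] _ \<nu> _ Cb \<open>C \<subseteq> {- r..r}\<close>])
    show "(\<integral>\<^sup>+x. ?T f x \<partial>entrance A) = (\<integral>\<^sup>+x. f x \<partial>entrance A)" if "f \<in> borel_measurable borel" for f
      using entrance_cycle[OF A that J J'(1,2)] J'(3) by blast
    show "Z \<inter> A \<noteq> {}" using J' by blast
    show "w x = 0" if w: "w \<in> borel_measurable borel" "\<And>x. w x \<le> 1"
      "\<And>x. x \<in> Z \<inter> A \<Longrightarrow> w x = ?T (\<lambda>y. indicator (- C) y * w y) x" and x: "x \<in> Z \<inter> A" for w x
      by (rule entrance_no_escape[OF A Cb C(2) J p w(1,2) _ x]) (simp_all add: w(3)[symmetric])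
    show "\<exists>c. AE x in entrance A. h x = c" if "h \<in> borel_measurable borel" "\<And>x. h x \<le> 1"
      "AE x in entrance A. h x = ?T h x" for h
      using entrance_Liouville[OF A that] by blast
    show "\<exists>c<\<infinity>. \<Lambda>' = scale_measure c (entrance A)" if \<Lambda>': "sets \<Lambda>' = sets borel" "AE x in \<Lambda>'. x \<in> Z \<inter> A"
      "\<And>C. compact C \<Longrightarrow> C \<subseteq> Z \<inter> A \<Longrightarrow> emeasure \<Lambda>' C < \<infinity>"
      "\<And>f. f \<in> borel_measurable borel \<Longrightarrow> (\<integral>\<^sup>+x. ?T f x \<partial>\<Lambda>') = (\<integral>\<^sup>+x. f x \<partial>\<Lambda>')" for \<Lambda>'
    proof -
      have "emeasure \<Lambda>' C < \<infinity>" if C: "compact C" "C \<subseteq> A" for C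
      proof -
        have "emeasure \<Lambda>' C = emeasure \<Lambda>' (Z \<inter> C)"
          using \<Lambda>'(2) C by (intro emeasure_eq_AE) (auto simp: \<Lambda>'(1) borel_compact)
        also have "\<dots> < \<infinity>"
          using C closed_Z by (intro \<Lambda>'(3) closed_Int_compact) auto
        finally show ?thesis .
      qed
      then show ?thesis
        using entrance_unique[OF A A1 \<Lambda>'(1,2) _ \<Lambda>'(4)] by metis
    qed
  qed
qed

text \<open>Each step of this chain exchanges \<open>A\<close> and its complement, so two steps from
  \<open>A\<close> form the entrance chain of \<open>A\<close>. All claims are reduced to that
  chain, and one more step determines the other half.\<close>

lemma alternating_chain_properties:
  assumes A [measurable]: "A \<in> sets borel" and A1: "enterable D Z A" and A2: "enterable D Z (- A)"
    and K: "\<And>x. x \<in> Z \<Longrightarrow> sets (K x) = sets (borel_on Z)"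
      "\<And>x B. x \<in> Z \<Longrightarrow> B \<in> sets (borel_on Z) \<Longrightarrow>
        emeasure (K x) B = exit_op (if x \<in> A then A else - A) (indicator B) x"
    and \<nu>: "sets \<nu> = sets (borel_on Z)"
      "\<And>B. B \<in> sets (borel_on Z) \<Longrightarrow> emeasure \<nu> B = emeasure (entrance A) B + emeasure (entrance (- A)) B"
  shows "recurrent_measure Z K \<nu> \<and> ergodic_measure Z K \<nu> \<and> uniquely_invariant_measure Z K \<nu>"
proof -
  obtain J C p where J: "open J" "J \<inter> Z \<noteq> {}" "J \<inter> Z \<inter> A = {}" and C: "compact C" "C \<subseteq> A"
    and p: "0 < p" "\<And>y. y \<in> J \<inter> Z \<Longrightarrow> p \<le> St (indicator C) y"
    using A1 unfolding enterable_def by blast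
  obtain J' where J': "open J'" "J' \<inter> Z \<noteq> {}" "J' \<inter> Z \<inter> - A = {}"
    using A2 unfolding enterable_def by blast
  let ?T = "\<lambda>f x. indicator A x * exit_op A f x + indicator (- A) x * exit_op (- A) f x"
  have TA: "?T f x = exit_op A f x" if "x \<in> A" for f x using that by simp
  have TB: "?T f x = exit_op (- A) f x" if "x \<notin> A" for f x using that by simp
  have kT: "kernel_op ?T"
    by (intro kernel_op_plus kernel_op_comp[OF kernel_op_indicator kernel_op_exit]) auto
  note T_meas [measurable] = kernel_op_measurable[OF kT]
  interpret op_chain Z ?T K
  proof
    show "kernel_op ?T" by (rule kT)
    show "?T f x = ?T g x" if "x \<in> Z" "\<And>y. y \<in> Z \<Longrightarrow> f y = g y" for f g x
      using that by (intro arg_cong2[where f="(+)"] arg_cong2[where f="(*)"] refl exit_cong) auto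
    show "?T (\<lambda>_. 1) x = 1" if "x \<in> Z" for x
      using exit_1[OF A J that] exit_1[OF _ J' that] by (cases "x \<in> A") auto
  qed (use K in auto)
  have Cb: "C \<in> sets borel" using C by (simp add: borel_compact)
  obtain r where r: "C \<subseteq> {- r..r}"
    using compact_imp_bounded[OF C(1)] unfolding bounded_iff by (auto simp: abs_le_iff subset_eq minus_le_iff)
  define \<Lambda> where "\<Lambda> = density L (\<lambda>x. indicator A x * dual.St (indicator (- A)) x +
    indicator (- A) x * dual.St (indicator (- (- A))) x)"
  have \<Lambda>: "sets \<Lambda> = sets borel" by (simp add: \<Lambda>_def sets_L)
  have [measurable_cong]: "sets \<Lambda> = sets borel" by (rule \<Lambda>)
  have int: "(\<integral>\<^sup>+x. f x \<partial>\<Lambda>) = (\<integral>\<^sup>+x. f x \<partial>entrance A) + (\<integral>\<^sup>+x. f x \<partial>entrance (- A))"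
    if [measurable]: "f \<in> borel_measurable borel" for f
    unfolding \<Lambda>_def
    by (subst nn_integral_density) (auto simp: nn_integral_entrance nn_integral_add[symmetric] distrib_right)
  have em: "emeasure \<Lambda> B = emeasure (entrance A) B + emeasure (entrance (- A)) B" if "B \<in> sets borel" for B
    using int[of "indicator B"] that by (simp add: \<Lambda> sets_entrance)
  have AE_\<Lambda>: "(AE x in \<Lambda>. P x)" if PA: "AE x in entrance A. P x" and PB: "AE x in entrance (- A). P x" for P
  proof -
    obtain N1 where N1: "{x \<in> space (entrance A). \<not> P x} \<subseteq> N1" "emeasure (entrance A) N1 = 0" "N1 \<in> sets (entrance A)"
      using PA by (rule AE_E)
    obtain N2 where N2: "{x \<in> space (entrance (- A)). \<not> P x} \<subseteq> N2" "emeasure (entrance (- A)) N2 = 0" "N2 \<in> sets (entrance (- A))"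
      using PB by (rule AE_E)
    have b: "N1 \<inter> N2 \<in> sets borel" using N1 N2 by (simp add: sets_entrance)
    have "emeasure (entrance A) (N1 \<inter> N2) = 0" "emeasure (entrance (- A)) (N1 \<inter> N2) = 0"
      using N1 N2 emeasure_mono[of "N1 \<inter> N2" N1 "entrance A"] emeasure_mono[of "N1 \<inter> N2" N2 "entrance (- A)"] by auto
    then have "emeasure \<Lambda> (N1 \<inter> N2) = 0" using em[OF b] by simp
    then show ?thesis
      using N1(1) N2(1) b sets_eq_imp_space_eq[OF sets_entrance] by (intro AE_I[of _ _ "N1 \<inter> N2"]) (auto simp: \<Lambda>)
  qed
  have AE_\<Lambda>D: "AE x in entrance A. P x" "AE x in entrance (- A). P x" if P\<Lambda>: "AE x in \<Lambda>. P x" for P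
  proof -
    obtain N where N: "{x \<in> space \<Lambda>. \<not> P x} \<subseteq> N" "emeasure \<Lambda> N = 0" "N \<in> sets \<Lambda>"
      using P\<Lambda> by (rule AE_E)
    have "emeasure (entrance A) N = 0" "emeasure (entrance (- A)) N = 0"
      using N em[of N] by (auto simp: \<Lambda>)
    then show "AE x in entrance A. P x" "AE x in entrance (- A). P x"
      using N sets_eq_imp_space_eq[OF \<Lambda>] by (auto intro!: AE_I[of _ _ N] simp: \<Lambda> sets_entrance)
  qed
  have memA: "AE x in entrance A. x \<in> Z \<inter> A" and memB: "AE x in entrance (- A). x \<in> Z \<inter> - A"
    using AE_entrance_mem[of A] AE_entrance_mem[of "- A"] by auto
  show ?thesis
  proof (rule chain_properties[OF \<Lambda> _ _ _ \<nu>(1) _ _ Cb r])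
    show "AE x in \<Lambda>. x \<in> Z"
      using memA memB by (intro AE_\<Lambda>) (auto elim!: eventually_mono)
    show "emeasure \<Lambda> {- r..r} < \<infinity>" for r
      using entrance_bounded[of A r] entrance_bounded[of "- A" r] by (simp add: em)
    show "(\<integral>\<^sup>+x. ?T f x \<partial>\<Lambda>) = (\<integral>\<^sup>+x. f x \<partial>\<Lambda>)" if [measurable]: "f \<in> borel_measurable borel" for f
    proof -
      have "(\<integral>\<^sup>+x. ?T f x \<partial>\<Lambda>) = (\<integral>\<^sup>+x. ?T f x \<partial>entrance A) + (\<integral>\<^sup>+x. ?T f x \<partial>entrance (- A))"
        by (rule int) measurable
      also have "(\<integral>\<^sup>+x. ?T f x \<partial>entrance A) = (\<integral>\<^sup>+x. exit_op A f x \<partial>entrance A)"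
        by (intro nn_integral_cong_AE) (use memA in \<open>eventually_elim, auto\<close>)
      also have "\<dots> = (\<integral>\<^sup>+x. f x \<partial>entrance (- A))"
        by (rule entrance_exit[OF A that J])
      also have "(\<integral>\<^sup>+x. ?T f x \<partial>entrance (- A)) = (\<integral>\<^sup>+x. exit_op (- A) f x \<partial>entrance (- A))"
        by (intro nn_integral_cong_AE) (use memB in \<open>eventually_elim, auto\<close>)
      also have "\<dots> = (\<integral>\<^sup>+x. f x \<partial>entrance A)"
        using entrance_exit[OF _ that J'] by simp
      finally show ?thesis using int[OF that] by (simp add: add.commute)
    qed
    show "emeasure \<nu> B = emeasure \<Lambda> B" if "B \<in> sets (borel_on Z)" for B
      using that \<nu>(2)[OF that] em by (simp add: sets_borel_on_iff)
    show "Z \<noteq> {}" using Z_0 by blast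
    show "w x = 0" if w [measurable]: "w \<in> borel_measurable borel" and w1: "\<And>x. w x \<le> 1"
      and w2: "\<And>x. x \<in> Z \<Longrightarrow> w x = ?T (\<lambda>y. indicator (- C) y * w y) x" and x: "x \<in> Z" for w x
    proof -
      let ?w = "\<lambda>y. indicator (- C) y * w y"
      have wB: "w y = exit_op (- A) ?w y" if "y \<in> Z - A" for y
        using w2[of y] that TB[of y ?w] by simp
      \<comment> \<open>Since \<open>C\<close> lies in \<open>A\<close>, discarding it changes
        nothing outside \<open>A\<close>, and the two one-step equations combine into the one for
        the entrance chain.\<close>
      have wA: "w y = exit_op A (exit_op (- A) ?w) y" if "y \<in> Z \<inter> A" for y
      proof -
        have "w y = exit_op A ?w y" using w2[of y] that TA[of y ?w] by simp
        also have "\<dots> = exit_op A (exit_op (- A) ?w) y"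
        proof (rule exit_cong)
          fix z assume z: "z \<in> Z - A"
          then have "z \<notin> C" using C by blast
          then show "?w z = exit_op (- A) ?w z" using wB[OF z] by simp
        qed (use that in auto)
        finally show ?thesis .
      qed
      have zero: "w y = 0" if "y \<in> Z \<inter> A" for y
        by (rule entrance_no_escape[OF A Cb C(2) J p w w1 _ that]) (simp_all add: wA[symmetric])
      show "w x = 0"
      proof (cases "x \<in> A")
        case False
        have "w x = exit_op (- A) (\<lambda>_. 0) x"
          using False x zero by (subst wB) (auto intro!: exit_cong)
        also have "\<dots> = 0"
          using kernel_op_cmult[OF kernel_op_exit, of "- A" "\<lambda>_. 0" 0] by (simp add: fun_eq_iff)
        finally show ?thesis .
      qed (use zero x in auto)
    qed
    show "\<exists>c. AE x in \<Lambda>. h x = c" if h [measurable]: "h \<in> borel_measurable borel" and h1: "\<And>x. h x \<le> 1"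
      and "AE x in \<Lambda>. h x = ?T h x" for h
    proof -
      have hA: "AE x in entrance A. h x = exit_op A h x" and hB: "AE x in entrance (- A). h x = exit_op (- A) h x"
        using AE_\<Lambda>D[OF that(3)] memA memB by (auto elim!: eventually_elim2)
      let ?u = "exit_op (- A) h"
      \<comment> \<open>The equation outside \<open>A\<close> holds up to a null set of
        \<open>entrance (- A)\<close>. As \<open>exit_op A\<close> carries \<open>entrance A\<close>
        to that measure, almost no exit from \<open>A\<close> meets the null set, and the one-step
        equations compose.\<close>
      let ?b = "\<lambda>y. if h y = ?u y then 0 else 1 :: ennreal"
      have b: "?b \<in> borel_measurable borel" by measurable
      have "(\<integral>\<^sup>+x. exit_op A ?b x \<partial>entrance A) = (\<integral>\<^sup>+x. ?b x \<partial>entrance (- A))"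
        by (rule entrance_exit[OF A b J])
      also have "\<dots> = (\<integral>\<^sup>+x. 0 \<partial>entrance (- A))"
        using hB by (intro nn_integral_cong_AE) (auto elim!: eventually_mono)
      finally have "(\<integral>\<^sup>+x. exit_op A ?b x \<partial>entrance A) = 0" by simp
      moreover have "exit_op A ?b \<in> borel_measurable (entrance A)"
        using exit_measurable[OF A b] by (simp add: measurable_cong_sets[OF sets_entrance refl])
      ultimately have "AE x in entrance A. exit_op A ?b x = 0"
        using nn_integral_0_iff_AE by blast
      then have "AE x in entrance A. h x = exit_op A ?u x"
        using hA by eventually_elim (use kernel_op_null[OF kernel_op_exit[OF A] h] in auto)
      then obtain c where c: "AE x in entrance A. h x = c" "AE x in entrance (- A). ?u x = c"
        using entrance_Liouville[OF A h h1] by blast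
      have "AE x in entrance (- A). h x = c"
        using c(2) hB by eventually_elim simp
      then show ?thesis using AE_\<Lambda>[OF c(1)] by blast
    qed
    show "\<exists>c<\<infinity>. \<Lambda>' = scale_measure c \<Lambda>" if \<Lambda>': "sets \<Lambda>' = sets borel" "AE x in \<Lambda>'. x \<in> Z"
      "\<And>C. compact C \<Longrightarrow> C \<subseteq> Z \<Longrightarrow> emeasure \<Lambda>' C < \<infinity>"
      "\<And>f. f \<in> borel_measurable borel \<Longrightarrow> (\<integral>\<^sup>+x. ?T f x \<partial>\<Lambda>') = (\<integral>\<^sup>+x. f x \<partial>\<Lambda>')" for \<Lambda>'
    proof -
      have [measurable_cong]: "sets \<Lambda>' = sets borel" by (rule \<Lambda>'(1))
      have zero: "exit_op B (\<lambda>_. 0) x = 0" if "B \<in> sets borel" for B x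
        using kernel_op_cmult[OF kernel_op_exit[OF that], of "\<lambda>_. 0" 0] by (simp add: fun_eq_iff)
      \<comment> \<open>Testing invariance with functions supported on one side gives two half-cycle
        relations; together they make the part of \<open>\<Lambda>'\<close> on \<open>A\<close>
        invariant for the entrance chain.\<close>
      have toB: "(\<integral>\<^sup>+x. indicator (- A) x * f x \<partial>\<Lambda>') = (\<integral>\<^sup>+x. indicator A x * exit_op A f x \<partial>\<Lambda>')"
        if [measurable]: "f \<in> borel_measurable borel" for f
      proof -
        have "(\<integral>\<^sup>+x. indicator (- A) x * f x \<partial>\<Lambda>') = (\<integral>\<^sup>+x. ?T (\<lambda>x. indicator (- A) x * f x) x \<partial>\<Lambda>')"
          by (rule \<Lambda>'(4)[symmetric]) measurable
        also have "\<dots> = (\<integral>\<^sup>+x. indicator A x * exit_op A f x \<partial>\<Lambda>')"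
        proof (rule nn_integral_cong_AE)
          have "?T (\<lambda>x. indicator (- A) x * f x) x = indicator A x * exit_op A f x" if "x \<in> Z" for x
            using that exit_cong[of A "\<lambda>x. indicator (- A) x * f x" f x]
              exit_cong[of "- A" "\<lambda>x. indicator (- A) x * f x" "\<lambda>_. 0" x] by (simp add: zero)
          then show "AE x in \<Lambda>'. ?T (\<lambda>x. indicator (- A) x * f x) x = indicator A x * exit_op A f x"
            using \<Lambda>'(2) by (rule eventually_mono[rotated])
        qed
        finally show ?thesis .
      qed
      have toA: "(\<integral>\<^sup>+x. indicator A x * f x \<partial>\<Lambda>') = (\<integral>\<^sup>+x. indicator (- A) x * exit_op (- A) f x \<partial>\<Lambda>')"
        if [measurable]: "f \<in> borel_measurable borel" for f
      proof -
        have "(\<integral>\<^sup>+x. indicator A x * f x \<partial>\<Lambda>') = (\<integral>\<^sup>+x. ?T (\<lambda>x. indicator A x * f x) x \<partial>\<Lambda>')"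
          by (rule \<Lambda>'(4)[symmetric]) measurable
        also have "\<dots> = (\<integral>\<^sup>+x. indicator (- A) x * exit_op (- A) f x \<partial>\<Lambda>')"
        proof (rule nn_integral_cong_AE)
          have "?T (\<lambda>x. indicator A x * f x) x = indicator (- A) x * exit_op (- A) f x" if "x \<in> Z" for x
            using that exit_cong[of "- A" "\<lambda>x. indicator A x * f x" f x]
              exit_cong[of A "\<lambda>x. indicator A x * f x" "\<lambda>_. 0" x] by (simp add: zero)
          then show "AE x in \<Lambda>'. ?T (\<lambda>x. indicator A x * f x) x = indicator (- A) x * exit_op (- A) f x"
            using \<Lambda>'(2) by (rule eventually_mono[rotated])
        qed
        finally show ?thesis .
      qed
      let ?\<mu> = "density \<Lambda>' (indicator A)"
      have int\<mu>: "(\<integral>\<^sup>+x. f x \<partial>?\<mu>) = (\<integral>\<^sup>+x. indicator A x * f x \<partial>\<Lambda>')" if "f \<in> borel_measurable borel" for f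
        using that by (intro nn_integral_density) (simp_all add: measurable_cong_sets[OF \<Lambda>'(1) refl])
      obtain c where c: "c < \<infinity>" "?\<mu> = scale_measure c (entrance A)"
      proof (rule entrance_unique[OF A A1, of ?\<mu>])
        show "sets ?\<mu> = sets borel" by (simp add: \<Lambda>'(1))
        show "AE x in ?\<mu>. x \<in> Z \<inter> A"
          using \<Lambda>'(2) by (subst AE_density) (auto elim!: eventually_mono simp: indicator_def split: if_splits)
        show "emeasure ?\<mu> C < \<infinity>" if C: "compact C" "C \<subseteq> A" for C
        proof -
          have Cb: "C \<in> sets borel" using C by (simp add: borel_compact)
          have "emeasure ?\<mu> C = (\<integral>\<^sup>+x. indicator A x * indicator C x \<partial>\<Lambda>')"
            using Cb by (intro emeasure_density) (auto simp: \<Lambda>'(1))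
          also have "\<dots> = (\<integral>\<^sup>+x. indicator (Z \<inter> C) x \<partial>\<Lambda>')"
            using \<Lambda>'(2) C by (intro nn_integral_cong_AE) (auto elim!: eventually_mono simp: indicator_def)
          also have "\<dots> = emeasure \<Lambda>' (Z \<inter> C)"
            using Cb by (simp add: \<Lambda>'(1))
          also have "\<dots> < \<infinity>"
            using C closed_Z by (intro \<Lambda>'(3) closed_Int_compact) auto
          finally show ?thesis .
        qed
        show "(\<integral>\<^sup>+x. exit_op A (exit_op (- A) f) x \<partial>?\<mu>) = (\<integral>\<^sup>+x. f x \<partial>?\<mu>)" if [measurable]: "f \<in> borel_measurable borel" for f
          using toB[of "exit_op (- A) f"] toA[of f] by (simp add: int\<mu>)
      qed
      have "\<Lambda>' = scale_measure c \<Lambda>"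
      proof (rule measure_eqI)
        fix B assume "B \<in> sets \<Lambda>'"
        then have B [measurable]: "B \<in> sets borel" by (simp add: \<Lambda>'(1))
        have scale: "(\<integral>\<^sup>+x. indicator A x * f x \<partial>\<Lambda>') = c * (\<integral>\<^sup>+x. f x \<partial>entrance A)"
          if [measurable]: "f \<in> borel_measurable borel" for f
        proof -
          have "(\<integral>\<^sup>+x. indicator A x * f x \<partial>\<Lambda>') = (\<integral>\<^sup>+x. f x \<partial>scale_measure c (entrance A))"
            using int\<mu>[OF that] c(2) by simp
          also have "\<dots> = c * (\<integral>\<^sup>+x. f x \<partial>entrance A)"
            by (rule nn_integral_scale_measure) measurable
          finally show ?thesis .
        qed
        have "emeasure \<Lambda>' B = (\<integral>\<^sup>+x. indicator B x \<partial>\<Lambda>')"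
          by (simp add: \<Lambda>'(1))
        also have "\<dots> = (\<integral>\<^sup>+x. indicator A x * indicator B x + indicator (- A) x * indicator B x \<partial>\<Lambda>')"
          by (intro nn_integral_cong) (auto simp: indicator_def)
        also have "\<dots> = (\<integral>\<^sup>+x. indicator A x * indicator B x \<partial>\<Lambda>') + (\<integral>\<^sup>+x. indicator (- A) x * indicator B x \<partial>\<Lambda>')"
          by (rule nn_integral_add) measurable
        \<comment> \<open>The mass outside \<open>A\<close> is the image of the mass on
          \<open>A\<close> under the exit law, so the same constant \<open>c\<close> governs both
          sides.\<close>
        also have "(\<integral>\<^sup>+x. indicator (- A) x * indicator B x \<partial>\<Lambda>') = c * (\<integral>\<^sup>+x. exit_op A (indicator B) x \<partial>entrance A)"
          by (subst toB) (auto simp: scale)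
        also have "(\<integral>\<^sup>+x. exit_op A (indicator B) x \<partial>entrance A) = (\<integral>\<^sup>+x. indicator B x \<partial>entrance (- A))"
          by (rule entrance_exit[OF A _ J]) measurable
        also have "(\<integral>\<^sup>+x. indicator A x * indicator B x \<partial>\<Lambda>') = c * (\<integral>\<^sup>+x. indicator B x \<partial>entrance A)"
          by (rule scale) measurable
        finally show "emeasure \<Lambda>' B = emeasure (scale_measure c \<Lambda>) B"
          by (simp add: em sets_entrance distrib_left)
      qed (simp add: \<Lambda> \<Lambda>'(1))
      then show ?thesis using c by blast
    qed
  qed
qed

end

section \<open>Random walks\<close>

lemma walk_eq_partial_sum: "walk X x \<omega> n = x + partial_sum (\<lambda>i. X (Suc i) \<omega>) n"
  by (simp add: walk_def partial_sum_def sum.atLeast1_atMost_eq)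

lemma
  assumes "random_walk_steps M X"
  shows random_walk_prob_space: "prob_space M"
    and random_walk_indep: "prob_space.indep_vars M (\<lambda>_. borel) X {1..}"
    and random_walk_identical: "\<And>n. n \<ge> 1 \<Longrightarrow> distr M borel (X n) = distr M borel (X 1)"
    and random_walk_nondegenerate: "\<not> (AE \<omega> in M. X 1 \<omega> = c)"
    and random_walk_measurable: "\<And>n. n \<ge> 1 \<Longrightarrow> X n \<in> borel_measurable M"
proof -
  show M: "prob_space M" and ind: "prob_space.indep_vars M (\<lambda>_. borel) X {1..}"
    and "\<And>n. n \<ge> 1 \<Longrightarrow> distr M borel (X n) = distr M borel (X 1)" "\<not> (AE \<omega> in M. X 1 \<omega> = c)"
    using assms unfolding random_walk_steps_def by blast+
  show "X n \<in> borel_measurable M" if "n \<ge> 1" for n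
    using ind that unfolding prob_space.indep_vars_def[OF M] by auto
qed

section \<open>Negating the steps\<close>

lemma random_walk_steps_uminus:
  assumes "random_walk_steps M X" shows "random_walk_steps M (\<lambda>n \<omega>. - X n \<omega>)"
proof -
  interpret prob_space M by (rule random_walk_prob_space[OF assms])
  note ind = random_walk_indep[OF assms] and d = random_walk_identical[OF assms]
    and nd = random_walk_nondegenerate[OF assms] and X [measurable] = random_walk_measurable[OF assms]
  have "indep_vars (\<lambda>_. borel) (\<lambda>n. uminus \<circ> X n) {1..}"
    by (rule indep_vars_compose[OF ind]) simp
  moreover
  have dm: "distr M borel (\<lambda>\<omega>. - X n \<omega>) = distr (distr M borel (X n)) borel uminus" if "n \<ge> 1" for n
    using X[OF that] by (subst distr_distr) (auto simp: comp_def)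
  have "distr M borel (\<lambda>\<omega>. - X n \<omega>) = distr M borel (\<lambda>\<omega>. - X 1 \<omega>)" if "n \<ge> 1" for n
    unfolding dm[OF that] dm[OF order_refl] d[OF that] ..
  moreover have "\<not> (AE \<omega> in M. - X 1 \<omega> = c)" for c
  proof
    assume "AE \<omega> in M. - X 1 \<omega> = c"
    then have "AE \<omega> in M. X 1 \<omega> = - c" by eventually_elim auto
    then show False using nd[of "- c"] by blast
  qed
  ultimately show ?thesis
    using prob_space_axioms unfolding random_walk_steps_def comp_def by blast
qed

lemma topologically_recurrent_uminus:
  assumes "topologically_recurrent M X" shows "topologically_recurrent M (\<lambda>n \<omega>. - X n \<omega>)"
  unfolding topologically_recurrent_def
proof safe
  fix G :: "real set" assume G: "open G" "0 \<in> G"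
  have "walk (\<lambda>n \<omega>. - X n \<omega>) 0 \<omega> n \<in> G \<longleftrightarrow> walk X 0 \<omega> n \<in> uminus ` G" for \<omega> n
    by (auto simp: walk_def sum_negf image_iff) (metis minus_minus)
  moreover have "open (uminus ` G)" "0 \<in> uminus ` G"
    using G by (auto simp: open_negations image_iff)
  ultimately show "\<P>(\<omega> in M. \<exists>\<^sub>\<infinity>n. walk (\<lambda>n \<omega>. - X n \<omega>) 0 \<omega> n \<in> G) = 1"
    using assms by (simp add: topologically_recurrent_def)
qed

lemma top_support_uminus:
  assumes D: "sets D = sets borel"
  shows "top_support (distr D borel uminus) = uminus ` top_support D"
proof -
  have m: "uminus \<in> D \<rightarrow>\<^sub>M (borel :: real measure)" by (simp add: measurable_cong_sets[OF D refl])
  have em: "emeasure (distr D borel uminus) U = emeasure D (uminus ` U)" if "open U" for U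
  proof -
    have "uminus -` U \<inter> space D = uminus ` U"
      using sets_eq_imp_space_eq[OF D] by (auto simp: image_iff) (metis minus_minus)
    then show ?thesis using that by (subst emeasure_distr[OF m]) auto
  qed
  have "- x \<in> top_support (distr D borel uminus) \<longleftrightarrow> x \<in> top_support D" for x
  proof
    assume *: "- x \<in> top_support (distr D borel uminus)"
    show "x \<in> top_support D"
      unfolding top_support_def
    proof safe
      fix U assume "open U" "x \<in> U"
      then have "open (uminus ` U)" "- x \<in> uminus ` U" by (auto simp: open_negations)
      then have "emeasure D (uminus ` uminus ` U) > 0"
        using * em by (auto simp: top_support_def)
      then show "emeasure D U > 0" by (simp add: image_image)
    qed
  next
    assume *: "x \<in> top_support D"
    show "- x \<in> top_support (distr D borel uminus)"
      unfolding top_support_def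
    proof safe
      fix U assume "open U" "- x \<in> U"
      then have "open (uminus ` U)" "x \<in> uminus ` U" by (auto simp: open_negations image_iff intro!: bexI[of _ "- x"])
      then show "emeasure (distr D borel uminus) U > 0"
        using * em[OF \<open>open U\<close>] by (auto simp: top_support_def)
    qed
  qed
  then have "y \<in> top_support (distr D borel uminus) \<longleftrightarrow> y \<in> uminus ` top_support D" for y
    by (metis (no_types, lifting) image_iff minus_minus)
  then show ?thesis by blast
qed

lemma closed_state_space: "closed (state_space M X)"
  unfolding state_space_def by (rule closed_Inter) auto

lemma subgroup_state_space: "additive_subgroup (state_space M X)"
  unfolding state_space_def additive_subgroup_def by blast

text \<open>A subgroup contains a set exactly when it contains the negatives, so both state spaces
  are intersections of the same family.\<close>

lemma state_space_uminus:
  assumes "X 1 \<in> borel_measurable M"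
  shows "state_space M (\<lambda>n \<omega>. - X n \<omega>) = state_space M X"
proof -
  have "distr M borel (\<lambda>\<omega>. - X 1 \<omega>) = distr (distr M borel (X 1)) borel uminus"
    using assms by (subst distr_distr) (auto simp: comp_def)
  then have supp: "top_support (distr M borel (\<lambda>\<omega>. - X 1 \<omega>)) = uminus ` top_support (distr M borel (X 1))"
    by (simp add: top_support_uminus)
  have sub: "uminus ` B \<subseteq> H \<longleftrightarrow> B \<subseteq> H" if "additive_subgroup H" for B H :: "real set"
  proof -
    have "- x \<in> H \<longleftrightarrow> x \<in> H" for x
      using that unfolding additive_subgroup_def by (metis minus_minus)
    then show ?thesis by auto
  qed
  show ?thesis
    unfolding state_space_def supp using sub by (intro arg_cong[where f=Inter] Collect_cong) blast
qed

text \<open>Independence gives the product law over the index set \<open>{1..}\<close>; reindexing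
  by \<open>Suc\<close> moves it to the natural numbers, where the canonical walk lives.\<close>

lemma distr_steps:
  assumes "random_walk_steps M X"
  shows "distr M (PiM UNIV (\<lambda>_. borel)) (\<lambda>\<omega> n. X (Suc n) \<omega>) = seq_space (distr M borel (X 1))"
proof -
  interpret prob_space M by (rule random_walk_prob_space[OF assms])
  let ?D = "distr M borel (X 1)"
  note ind = random_walk_indep[OF assms] and d = random_walk_identical[OF assms]
    and X [measurable] = random_walk_measurable[OF assms]
  have law: "distr M (PiM {1..} (\<lambda>_. borel)) (\<lambda>\<omega>. \<lambda>i\<in>{1..}. X i \<omega>) = PiM {1..} (\<lambda>i. distr M borel (X i))"
    using ind X by (subst (asm) indep_vars_iff_distr_eq_PiM') auto
  have "PiM {1..} (\<lambda>i. distr M borel (X i)) = PiM {1..} (\<lambda>_. ?D)"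
    by (rule PiM_cong[OF refl]) (rule d, simp)
  then have law': "distr M (PiM {1..} (\<lambda>_. borel)) (\<lambda>\<omega>. \<lambda>i\<in>{1..}. X i \<omega>) = PiM {1..} (\<lambda>_. ?D)"
    using law by simp
  have "seq_space ?D = distr (PiM {1..} (\<lambda>_. ?D)) (seq_space ?D) (\<lambda>\<omega>. \<lambda>n\<in>UNIV. \<omega> (Suc n))"
    by (rule distr_PiM_reindex[symmetric]) (auto intro: prob_space_distr)
  also have "\<dots> = distr (distr M (PiM {1..} (\<lambda>_. borel)) (\<lambda>\<omega>. \<lambda>i\<in>{1..}. X i \<omega>)) (seq_space ?D) (\<lambda>\<omega> n. \<omega> (Suc n))"
    unfolding law' by (simp add: restrict_def)
  also have "\<dots> = distr M (seq_space ?D) (\<lambda>\<omega> n. X (Suc n) \<omega>)"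
  proof (subst distr_distr)
    show "(\<lambda>\<omega> n. \<omega> (Suc n)) \<in> PiM {1..} (\<lambda>_. borel) \<rightarrow>\<^sub>M seq_space ?D"
      by (rule measurable_PiM_single') (auto simp: space_PiM intro!: measurable_component_singleton)
    show "(\<lambda>\<omega>. \<lambda>i\<in>{1..}. X i \<omega>) \<in> M \<rightarrow>\<^sub>M PiM {1..} (\<lambda>_. borel)"
      by (rule measurable_restrict) simp
  qed (simp add: comp_def)
  also have "\<dots> = distr M (PiM UNIV (\<lambda>_. borel)) (\<lambda>\<omega> n. X (Suc n) \<omega>)"
    by (rule distr_cong) (auto intro!: sets_PiM_cong)
  finally show ?thesis ..
qed

lemma measurable_steps:
  assumes "random_walk_steps M X"
  shows "(\<lambda>\<omega> n. X (Suc n) \<omega>) \<in> M \<rightarrow>\<^sub>M PiM UNIV (\<lambda>_::nat. borel)"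
proof (rule measurable_PiM_single')
  interpret prob_space M by (rule random_walk_prob_space[OF assms])
  show "X (Suc n) \<in> borel_measurable M" for n
    by (rule random_walk_measurable[OF assms]) simp
qed auto

lemma recurrent_steps_walk:
  assumes rw: "random_walk_steps M X" and rec: "topologically_recurrent M X"
  shows "recurrent_steps (distr M borel (X 1)) (state_space M X)"
proof (rule recurrent_steps.intro)
  interpret prob_space M by (rule random_walk_prob_space[OF rw])
  have "X 1 \<in> borel_measurable M"
    by (rule random_walk_measurable[OF rw]) simp
  then show "prob_space (distr M borel (X 1))" by (rule prob_space_distr)
  show "closed (state_space M X)" by (rule closed_state_space)
  show "additive_subgroup (state_space M X)" by (rule subgroup_state_space)
  show "top_support (distr M borel (X 1)) \<subseteq> state_space M X"
    unfolding state_space_def by blast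
  show "state_space M X \<subseteq> H" if "closed H" "additive_subgroup H" "top_support (distr M borel (X 1)) \<subseteq> H" for H
    unfolding state_space_def using that by blast
  show "AE \<omega> in seq_space (distr M borel (X 1)). \<exists>\<^sub>\<infinity>n. partial_sum \<omega> n \<in> G" if G: "open G" "0 \<in> G" for G
  proof -
    have [measurable]: "G \<in> sets borel" using G by simp
    have [measurable]: "(\<lambda>\<omega>. partial_sum \<omega> n) \<in> borel_measurable (PiM UNIV (\<lambda>_::nat. borel))" for n
      unfolding partial_sum_def by measurable
    let ?P = "\<lambda>\<omega>. \<exists>\<^sub>\<infinity>n. partial_sum \<omega> n \<in> G"
    have P: "{\<omega> \<in> space (PiM UNIV (\<lambda>_::nat. borel)). ?P \<omega>} \<in> sets (PiM UNIV (\<lambda>_::nat. borel))"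
      unfolding INFM_nat_le by measurable
    have ev: "{\<omega> \<in> space M. ?P (\<lambda>n. X (Suc n) \<omega>)} \<in> events"
      using measurable_sets[OF measurable_steps[OF rw] P] measurable_space[OF measurable_steps[OF rw]]
      by (auto simp: vimage_def Int_def conj_commute space_PiM)
    have "prob {\<omega> \<in> space M. ?P (\<lambda>n. X (Suc n) \<omega>)} = 1"
      using rec G by (simp add: topologically_recurrent_def walk_eq_partial_sum)
    then have "AE \<omega> in M. ?P (\<lambda>n. X (Suc n) \<omega>)"
      unfolding prob_Collect_eq_1[OF ev] .
    then show ?thesis
      unfolding distr_steps[OF rw, symmetric] using AE_distr_iff[OF measurable_steps[OF rw] P] by simp
  qed
qed simp

text \<open>A support inside \<open>{0}\<close> would make the step almost surely 0, which
  non-degeneracy forbids.\<close>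

lemma state_space_not_trivial:
  assumes "random_walk_steps M X" shows "state_space M X \<noteq> {0}"
proof
  interpret prob_space M by (rule random_walk_prob_space[OF assms])
  have X: "X 1 \<in> borel_measurable M"
    by (rule random_walk_measurable[OF assms]) simp
  assume "state_space M X = {0}"
  then have "top_support (distr M borel (X 1)) \<subseteq> {0}"
    unfolding state_space_def by blast
  then have "AE y in distr M borel (X 1). y = 0"
    using AE_top_support[of "distr M borel (X 1)"] by (auto elim!: eventually_mono)
  then have "AE \<omega> in M. X 1 \<omega> = 0"
    by (rule AE_distrD[OF X])
  then show False using random_walk_nondegenerate[OF assms] by blast
qed

lemma emeasure_overshoot_walk:
  assumes rw: "random_walk_steps M X" and B: "B \<in> sets borel"
    and law: "overshoot_law (distr M borel (X 1)) Z L"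
  shows "emeasure (distr M borel (\<lambda>\<omega>. overshoot (walk X x \<omega>) n)) B =
    overshoot_law.overshoot_prob (distr M borel (X 1)) n B x"
proof -
  interpret law: overshoot_law "distr M borel (X 1)" Z L by (rule law)
  let ?P = "PiM UNIV (\<lambda>_::nat. borel :: real measure)"
  let ?f = "\<lambda>\<omega>. overshoot (\<lambda>k. x + partial_sum \<omega> k) n"
  have sets: "sets law.S = sets ?P" by (intro sets_PiM_cong) auto
  have "(\<lambda>\<omega>. (\<lambda>k. x + partial_sum \<omega> k)) \<in> ?P \<rightarrow>\<^sub>M ?P"
    by (rule measurable_PiM_single') (auto simp: partial_sum_def)
  then have f: "?f \<in> borel_measurable ?P"
    by (rule measurable_compose[OF _ overshoot_measurable])
  have walk: "overshoot (walk X x \<omega>) n = ?f (\<lambda>k. X (Suc k) \<omega>)" for \<omega>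
    by (simp add: walk_eq_partial_sum[abs_def])
  have "distr M borel (\<lambda>\<omega>. overshoot (walk X x \<omega>) n) = distr law.S borel ?f"
    unfolding walk distr_steps[OF rw, symmetric]
    by (subst distr_distr[OF f measurable_steps[OF rw]]) (simp add: comp_def)
  then have "emeasure (distr M borel (\<lambda>\<omega>. overshoot (walk X x \<omega>) n)) B = emeasure (distr law.S borel ?f) B"
    by simp
  also have "\<dots> = emeasure law.S (?f -` B \<inter> space law.S)"
    using f B by (intro emeasure_distr) (simp_all only: measurable_cong_sets[OF sets refl])
  also have "?f -` B \<inter> space law.S = {\<omega> \<in> space law.S. ?f \<omega> \<in> B}" by blast
  also have "emeasure law.S \<dots> = law.overshoot_prob n B x"
    by (simp only: law.overshoot_prob_def)
  finally show ?thesis .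
qed

theorem corollary5p2:
  fixes M :: "'a measure" and X :: "nat \<Rightarrow> 'a \<Rightarrow> real"
  assumes "random_walk_steps M X"
    and "topologically_recurrent M X"
  shows
    "(let E = state_space M X \<inter> {0..}; K = up_overshoot_kernel M X; \<nu> = pi_plus M X in
        recurrent_measure E K \<nu> \<and> ergodic_measure E K \<nu> \<and> uniquely_invariant_measure E K \<nu>) \<and>
     (let E = state_space M X \<inter> {..<0}; K = down_overshoot_kernel M X; \<nu> = pi_minus M X in
        recurrent_measure E K \<nu> \<and> ergodic_measure E K \<nu> \<and> uniquely_invariant_measure E K \<nu>) \<and>
     (let E = state_space M X; K = overshoot_kernel M X; \<nu> = pi_both M X in
        recurrent_measure E K \<nu> \<and> ergodic_measure E K \<nu> \<and> uniquely_invariant_measure E K \<nu>)"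
proof -
  interpret prob_space M by (rule random_walk_prob_space[OF assms(1)])
  have X [measurable]: "X 1 \<in> borel_measurable M"
    by (rule random_walk_measurable[OF assms(1)]) simp
  define D where "D = distr M borel (X 1)"
  define Z where "Z = state_space M X"
  define L where "L = haar Z"
  have D': "distr D borel uminus = distr M borel (\<lambda>\<omega>. - X 1 \<omega>)"
    unfolding D_def using X by (subst distr_distr) (auto simp: comp_def simp del: One_nat_def)
  have Z_ne: "Z \<noteq> {0}" unfolding Z_def by (rule state_space_not_trivial[OF assms(1)])
  interpret steps: recurrent_steps D Z
    unfolding D_def Z_def by (rule recurrent_steps_walk[OF assms])
  \<comment> \<open>The reversed walk is again a recurrent walk with the same state space, so both
    directions share one \<open>Z\<close> and one \<open>L\<close>.\<close>
  interpret dual_steps: recurrent_steps "distr D borel uminus" Z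
    unfolding D' Z_def state_space_uminus[of X M, OF X, symmetric]
    by (rule recurrent_steps_walk[OF random_walk_steps_uminus[OF assms(1)] topologically_recurrent_uminus[OF assms(2)]])
  interpret law: recurrent_law D Z L
    unfolding L_def by (rule steps.recurrent_law_haar[OF Z_ne])
  interpret dual: recurrent_law "distr D borel uminus" Z L
    unfolding L_def by (rule dual_steps.recurrent_law_haar[OF Z_ne])
  interpret W: overshoot_law D Z L ..
  interpret T: two_sided_law D Z L ..
  have compl: "- {0..} = {..<0::real}" "- {..<0} = {0::real..}" by auto
  note enter = steps.enterable_nonneg[OF Z_ne] steps.enterable_neg[OF Z_ne]
  \<comment> \<open>Within \<open>Z\<close>, \<open>J\<close> is negative and \<open>J'\<close>
    nonnegative; they certify that \<open>{0..}\<close> and \<open>{..<0}\<close>, respectively, are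
    left almost surely.\<close>
  obtain J where J: "open J" "J \<inter> Z \<noteq> {}" "J \<inter> Z \<inter> {0..} = {}"
    using enter(1) unfolding enterable_def by blast
  obtain J' where J': "open J'" "J' \<inter> Z \<noteq> {}" "J' \<inter> Z \<inter> {..<0} = {}"
    using enter(2) unfolding enterable_def by blast
  have prob: "emeasure (distr M borel (\<lambda>\<omega>. overshoot (walk X x \<omega>) n)) B = W.overshoot_prob n B x"
    if "B \<in> sets borel" for x n B
    using emeasure_overshoot_walk[OF assms(1) that, of Z L x n] W.overshoot_law_axioms unfolding D_def by simp
  have kernel: "emeasure (restrict_space (distr M borel (\<lambda>\<omega>. overshoot (walk X x \<omega>) n)) E) B = W.overshoot_prob n B x"
    if "E \<in> sets borel" "B \<in> sets (borel_on E)" for x n B E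
    using that prob[of B x n] by (subst emeasure_restrict_space) (auto simp: sets_borel_on_iff)
  have sets_restrict: "sets (restrict_space N E) = sets (borel_on E)" if "sets N = sets borel" for N :: "real measure" and E
    using that by (simp add: sets_restrict_space)
  have walk_0: "walk X x \<omega> 0 = x" for x \<omega> by (simp add: walk_def)
  \<comment> \<open>A reversed step from \<open>x\<close> ends below zero exactly when the step
    exceeds \<open>x\<close>; both inequalities are strict because the target omits 0.\<close>
  have density_pos: "dual.St (indicator {..<0}) x = ennreal (prob {\<omega> \<in> space M. X 1 \<omega> > x})" for x
  proof -
    have "dual.St (indicator {..<0}) x = (\<integral>\<^sup>+y. indicator {..<0} (x - y) \<partial>D)"
      by (rule T.dual_St) simp
    also have "\<dots> = (\<integral>\<^sup>+y. indicator {x<..} y \<partial>D)"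
      by (rule nn_integral_cong) (simp add: indicator_def)
    also have "\<dots> = emeasure D {x<..}"
      by (rule nn_integral_indicator) (simp add: D_def)
    also have "\<dots> = emeasure M {\<omega> \<in> space M. X 1 \<omega> > x}"
      unfolding D_def by (subst emeasure_distr[OF X]) (auto intro!: arg_cong[where f="emeasure M"])
    finally show ?thesis by (simp add: emeasure_eq_measure)
  qed
  have density_neg: "dual.St (indicator {0..}) x = ennreal (prob {\<omega> \<in> space M. X 1 \<omega> \<le> x})" for x
  proof -
    have "dual.St (indicator {0..}) x = (\<integral>\<^sup>+y. indicator {0..} (x - y) \<partial>D)"
      by (rule T.dual_St) simp
    also have "\<dots> = (\<integral>\<^sup>+y. indicator {..x} y \<partial>D)"
      by (rule nn_integral_cong) (simp add: indicator_def)
    also have "\<dots> = emeasure D {..x}"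
      by (rule nn_integral_indicator) (simp add: D_def)
    also have "\<dots> = emeasure M {\<omega> \<in> space M. X 1 \<omega> \<le> x}"
      unfolding D_def by (subst emeasure_distr[OF X]) (auto intro!: arg_cong[where f="emeasure M"])
    finally show ?thesis by (simp add: emeasure_eq_measure)
  qed
  have St_meas: "dual.St (indicator A) \<in> borel_measurable L" if "A \<in> sets borel" for A
    using that by (simp add: measurable_cong_sets[OF law.sets_L refl])
  have restricted: "emeasure (density (restrict_space L E) f) B = (\<integral>\<^sup>+x. f x * indicator B x \<partial>L)"
    if "E \<in> sets borel" "B \<in> sets (borel_on E)" "f \<in> borel_measurable L" for E B and f :: "real \<Rightarrow> ennreal"
  proof -
    have EL: "E \<inter> space L \<in> sets L" using that by (simp add: law.space_L law.sets_L)
    have "emeasure (density (restrict_space L E) f) B = (\<integral>\<^sup>+x. f x * indicator B x \<partial>restrict_space L E)"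
      using that by (intro emeasure_density measurable_restrict_space1) (simp_all add: sets_restrict[OF law.sets_L])
    also have "\<dots> = (\<integral>\<^sup>+x. f x * indicator B x * indicator E x \<partial>L)"
      by (rule nn_integral_restrict_space[OF EL])
    also have "\<dots> = (\<integral>\<^sup>+x. f x * indicator B x \<partial>L)"
      using that by (intro nn_integral_cong) (auto simp: sets_borel_on_iff indicator_def)
    finally show ?thesis .
  qed
  have entrance_em: "emeasure (T.entrance A) B = (\<integral>\<^sup>+x. indicator A x * dual.St (indicator (- A)) x * indicator B x \<partial>L)"
    if "A \<in> sets borel" "B \<in> sets borel" for A B
    using T.nn_integral_entrance[of A "indicator B"] that by (simp add: T.sets_entrance)
  have plus: "recurrent_measure (Z \<inter> {0..}) (up_overshoot_kernel M X) (pi_plus M X) \<and>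
      ergodic_measure (Z \<inter> {0..}) (up_overshoot_kernel M X) (pi_plus M X) \<and>
      uniquely_invariant_measure (Z \<inter> {0..}) (up_overshoot_kernel M X) (pi_plus M X)"
  proof (rule T.entrance_chain_properties)
    show "sets (up_overshoot_kernel M X x) = sets (borel_on (Z \<inter> {0..}))" for x
      unfolding up_overshoot_kernel_def Z_def by (rule sets_restrict) simp
    show "emeasure (up_overshoot_kernel M X x) B =
        law.exit_op {0..} (law.exit_op (- {0..}) (indicator B)) x"
      if x: "x \<in> Z \<inter> {0..}" and B: "B \<in> sets (borel_on (Z \<inter> {0..}))" for x B
    proof -
      \<comment> \<open>From a start at or above zero the first crossing is downward, so the first
        up-crossing has index 2 and is reached by two exits.\<close>
      have "up_overshoot (walk X x \<omega>) 1 = overshoot (walk X x \<omega>) 2" for \<omega>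
        using x by (simp add: up_overshoot_def walk_0)
      then have "emeasure (up_overshoot_kernel M X x) B = W.overshoot_prob 2 B x"
        using kernel[OF _ B] by (simp add: up_overshoot_kernel_def Z_def[symmetric])
      also have "\<dots> = law.exit_op {0..} (law.exit_op (- {0..}) (indicator B)) x"
        using B J J' x by (intro W.overshoot_prob_2[of B "{0..}" J J']) (auto simp: sets_borel_on_iff compl)
      finally show ?thesis .
    qed
    show "sets (pi_plus M X) = sets (borel_on (Z \<inter> {0..}))"
      unfolding pi_plus_def Z_def[symmetric] L_def[symmetric] by (simp add: sets_restrict[OF law.sets_L])
    show "emeasure (pi_plus M X) B = emeasure (T.entrance {0..}) B" if B: "B \<in> sets (borel_on (Z \<inter> {0..}))" for B
    proof -
      have "emeasure (pi_plus M X) B = (\<integral>\<^sup>+x. dual.St (indicator {..<0}) x * indicator B x \<partial>L)"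
        unfolding pi_plus_def Z_def[symmetric] L_def[symmetric] density_pos[symmetric]
        using B by (intro restricted St_meas) auto
      also have "\<dots> = emeasure (T.entrance {0..}) B"
        using B by (subst entrance_em) (auto simp: sets_borel_on_iff compl indicator_def intro!: nn_integral_cong)
      finally show ?thesis .
    qed
  qed (use enter in \<open>simp_all add: compl\<close>)
  have minus: "recurrent_measure (Z \<inter> {..<0}) (down_overshoot_kernel M X) (pi_minus M X) \<and>
      ergodic_measure (Z \<inter> {..<0}) (down_overshoot_kernel M X) (pi_minus M X) \<and>
      uniquely_invariant_measure (Z \<inter> {..<0}) (down_overshoot_kernel M X) (pi_minus M X)"
  proof (rule T.entrance_chain_properties)
    show "sets (down_overshoot_kernel M X x) = sets (borel_on (Z \<inter> {..<0}))" for x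
      unfolding down_overshoot_kernel_def Z_def by (rule sets_restrict) simp
    show "emeasure (down_overshoot_kernel M X x) B =
        law.exit_op {..<0} (law.exit_op (- {..<0}) (indicator B)) x"
      if x: "x \<in> Z \<inter> {..<0}" and B: "B \<in> sets (borel_on (Z \<inter> {..<0}))" for x B
    proof -
      \<comment> \<open>From below zero the first crossing is upward, which again makes the index
        2.\<close>
      have "down_overshoot (walk X x \<omega>) 1 = overshoot (walk X x \<omega>) 2" for \<omega>
        using x by (simp add: down_overshoot_def walk_0)
      then have "emeasure (down_overshoot_kernel M X x) B = W.overshoot_prob 2 B x"
        using kernel[OF _ B] by (simp add: down_overshoot_kernel_def Z_def[symmetric])
      also have "\<dots> = law.exit_op {..<0} (law.exit_op (- {..<0}) (indicator B)) x"
        using B J J' x by (intro W.overshoot_prob_2[of B "{..<0}" J' J]) (auto simp: sets_borel_on_iff compl)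
      finally show ?thesis .
    qed
    show "sets (pi_minus M X) = sets (borel_on (Z \<inter> {..<0}))"
      unfolding pi_minus_def Z_def[symmetric] L_def[symmetric] by (simp add: sets_restrict[OF law.sets_L])
    show "emeasure (pi_minus M X) B = emeasure (T.entrance {..<0}) B" if B: "B \<in> sets (borel_on (Z \<inter> {..<0}))" for B
    proof -
      have "emeasure (pi_minus M X) B = (\<integral>\<^sup>+x. dual.St (indicator {0..}) x * indicator B x \<partial>L)"
        unfolding pi_minus_def Z_def[symmetric] L_def[symmetric] density_neg[symmetric]
        using B by (intro restricted St_meas) auto
      also have "\<dots> = emeasure (T.entrance {..<0}) B"
        using B by (subst entrance_em) (auto simp: sets_borel_on_iff compl indicator_def intro!: nn_integral_cong)
      finally show ?thesis .
    qed
  qed (use enter in \<open>simp_all add: compl\<close>)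
  have both: "recurrent_measure Z (overshoot_kernel M X) (pi_both M X) \<and>
      ergodic_measure Z (overshoot_kernel M X) (pi_both M X) \<and>
      uniquely_invariant_measure Z (overshoot_kernel M X) (pi_both M X)"
  proof (rule T.alternating_chain_properties[of "{0..}"])
    show "sets (overshoot_kernel M X x) = sets (borel_on Z)" for x
      unfolding overshoot_kernel_def Z_def by (rule sets_restrict) simp
    show "emeasure (overshoot_kernel M X x) B =
        law.exit_op (if x \<in> {0..} then {0..} else - {0..}) (indicator B) x"
      if x: "x \<in> Z" and B: "B \<in> sets (borel_on Z)" for x B
    proof -
      have "emeasure (overshoot_kernel M X x) B = W.overshoot_prob 1 B x"
        using kernel[OF _ B] by (simp add: overshoot_kernel_def Z_def[symmetric])
      then show ?thesis
        using B J J' x W.overshoot_prob_1[of B "{0..}" J x] W.overshoot_prob_1[of B "{..<0}" J' x]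
        by (auto simp: sets_borel_on_iff compl)
    qed
    show "sets (pi_both M X) = sets (borel_on Z)"
      unfolding pi_both_def Z_def[symmetric] L_def[symmetric] by (simp add: sets_restrict[OF law.sets_L])
    show "emeasure (pi_both M X) B = emeasure (T.entrance {0..}) B + emeasure (T.entrance (- {0..})) B"
      if B: "B \<in> sets (borel_on Z)" for B
    proof -
      let ?f = "\<lambda>x. indicator {0..} x * dual.St (indicator {..<0}) x + indicator {..<0} x * dual.St (indicator {0..}) x"
      have f: "?f \<in> borel_measurable L"
        by (simp add: measurable_cong_sets[OF law.sets_L refl])
      have "ennreal (indicator {0..} x * prob {\<omega> \<in> space M. X 1 \<omega> > x} +
          indicator {..<0} x * prob {\<omega> \<in> space M. X 1 \<omega> \<le> x}) = ?f x" for x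
        unfolding density_pos density_neg by (auto simp: indicator_def)
      then have "emeasure (pi_both M X) B = emeasure (density (restrict_space L Z) ?f) B"
        unfolding pi_both_def Z_def[symmetric] L_def[symmetric] by simp
      also have "\<dots> = (\<integral>\<^sup>+x. ?f x * indicator B x \<partial>L)"
        using B f by (intro restricted) auto
      also have "\<dots> = (\<integral>\<^sup>+x. indicator {0..} x * dual.St (indicator {..<0}) x * indicator B x +
          indicator {..<0} x * dual.St (indicator {0..}) x * indicator B x \<partial>L)"
        by (simp add: distrib_right)
      also have "\<dots> = (\<integral>\<^sup>+x. indicator {0..} x * dual.St (indicator {..<0}) x * indicator B x \<partial>L) +
          (\<integral>\<^sup>+x. indicator {..<0} x * dual.St (indicator {0..}) x * indicator B x \<partial>L)"
      proof (rule nn_integral_add)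
        have [measurable]: "B \<in> sets borel" using B by (simp add: sets_borel_on_iff)
        show "(\<lambda>x. indicator {0..} x * dual.St (indicator {..<0}) x * indicator B x) \<in> borel_measurable L"
          "(\<lambda>x. indicator {..<0} x * dual.St (indicator {0..}) x * indicator B x) \<in> borel_measurable L"
          unfolding measurable_cong_sets[OF law.sets_L refl] by measurable
      qed
      also have "\<dots> = emeasure (T.entrance {0..}) B + emeasure (T.entrance (- {0..})) B"
        using B by (simp add: entrance_em sets_borel_on_iff compl)
      finally show ?thesis .
    qed
  qed (use enter in \<open>simp_all add: compl\<close>)
  show ?thesis
    using plus minus both unfolding Let_def Z_def by blast
qed

end
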